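(* Let $m > n \ge 1$ be integers and let $A$ be an Artinian local $K$-algebra that is a quotient of a formal power series ring over $K$ in finitely many variables. The following are equivalent: (a) $A$ is an Artinian Gorenstein local ring with Hilbert function $\{1,m,n,1\}$; (b) $A \simeq A_F$ as $K$-algebras for some $F \in K[y_1,\dots,y_m]$ of the form $F = F_3 + y_{n+1}^2 + \dots + y_m^2$, where $F_3$ is a non degenerate form of degree three in $K[y_1,\dots,y_n]$.
   Context: $K$ is an algebraically closed field of characteristic zero. For a local ring $(A,\mathfrak m)$ that is a quotient of a power series ring over $K$ and has finite length, the Hilbert function is $HF_A(i)=\dim_K(\mathfrak m^i/\mathfrak m^{i+1})$; writing $HF_A=\{1,m,n,1\}$ means $HF_A(0)=1$, $HF_A(1)=m$, $HF_A(2)=n$, $HF_A(3)=1$ and $HF_A(i)=0$ for $i\ge 4$. $A$ is Gorenstein if $\dim_K(0:\mathfrak m)=1$. Let $R=K[[x_1,\dots,x_m]]$ and $P=K[y_1,\dots,y_m]$. $P$ is an $R$-module via $f\circ g = f(\partial_{y_1},\dots,\partial_{y_m})(g)$ for $f\in R$, $g\in P$, where $\partial_{y_i}$ is the partial derivative with respect to $y_i$. For $F\in P$ put $\mathrm{Ann}_R(F)=\{f\in R : f\circ F=0\}$ and $A_F=R/\mathrm{Ann}_R(F)$. A form $F_3\in K[y_1,\dots,y_n]$ of degree three is non degenerate if the $K$-vector space spanned by its partial derivatives of order two has dimension $n$; equivalently, the algebra $K[[x_1,\dots,x_n]]/\mathrm{Ann}(F_3)$ (defined by the same action in $n$ variables)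 has embedding dimension $n$. *)

theory Defs
  imports
    "HOL-Algebra.Algebra"
    "HOL-Algebra.Algebraic_Closure_Type"
    "HOL-Library.Poly_Mapping"
begin

text \<open>
  The ground field is a type \<open>'k\<close>; HOL-Algebra sees it through
  \<^const>\<open>ring_of_type_algebra\<close>. Variables are numbered from \<open>0\<close>, so \<open>x\<^sub>1,\<dots>,x\<^sub>m\<close> are the
  indices \<open>i < m\<close>, and \<open>y\<^bsub>n+1\<^esub>,\<dots>,y\<^sub>m\<close> are the indices \<open>n \<le> i < m\<close>.
\<close>

type_synonym mono = "nat \<Rightarrow>\<^sub>0 nat"
type_synonym 'k pseries = "mono \<Rightarrow> 'k"
type_synonym 'k mpoly = "mono \<Rightarrow>\<^sub>0 'k"


subsection \<open>Formal power series\<close>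

text \<open>The sum defining the product ranges over a finite set, see \<open>finite_mono_splits\<close>.\<close>

definition pseries_ring :: "nat \<Rightarrow> ('k::field, 'k pseries) module" where
  "pseries_ring m =
    \<lparr> carrier = {f. \<forall>e. f e \<noteq> 0 \<longrightarrow> Poly_Mapping.keys e \<subseteq> {..<m}},
      monoid.mult = (\<lambda>f g e. \<Sum>(a, b) | a + b = e. f a * g b),
      one = (\<lambda>e. if e = 0 then 1 else 0),
      ring.zero = (\<lambda>e. 0),
      add = (\<lambda>f g e. f e + g e),
      module.smult = (\<lambda>c f e. c * f e) \<rparr>"

lemma finite_mono_splits: "finite {(a, b). a + b = (e :: mono)}"
proof -
  let ?S = "{(a, b). a + b = (e :: mono)}"
  let ?F = "{f. \<forall>i. (i \<in> Poly_Mapping.keys e \<longrightarrow> f i \<in> {..Poly_Mapping.lookup e i}) \<and>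
                    (i \<notin> Poly_Mapping.keys e \<longrightarrow> f i = 0)}"
  have "finite (\<Union>i\<in>Poly_Mapping.keys e. {..Poly_Mapping.lookup e i})"
    by simp
  then have "finite {f. \<forall>i. (i \<in> Poly_Mapping.keys e \<longrightarrow>
        f i \<in> (\<Union>i\<in>Poly_Mapping.keys e. {..Poly_Mapping.lookup e i})) \<and>
      (i \<notin> Poly_Mapping.keys e \<longrightarrow> f i = 0)}"
    by (intro finite_set_of_finite_funs) auto
  then have F: "finite ?F"
    by (rule rev_finite_subset) blast
  have "inj_on (\<lambda>(a, b). Poly_Mapping.lookup a) ?S"
    by (auto simp: inj_on_def poly_mapping_eq_iff[symmetric])
  moreover have "(\<lambda>(a, b). Poly_Mapping.lookup a) ` ?S \<subseteq> ?F"
    by (auto simp: lookup_add in_keys_iff)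
  ultimately show ?thesis
    using F inj_on_finite by blast
qed


subsection \<open>Polynomials, partial derivatives and the action of power series\<close>

definition mpolys :: "nat \<Rightarrow> 'k::field mpoly set" where
  "mpolys m = {p. \<forall>e\<in>Poly_Mapping.keys p. Poly_Mapping.keys e \<subseteq> {..<m}}"

definition mvar :: "nat \<Rightarrow> 'k::field mpoly" where
  "mvar i = Poly_Mapping.single (Poly_Mapping.single i 1) 1"

definition mscale :: "'k::field \<Rightarrow> 'k mpoly \<Rightarrow> 'k mpoly" where
  "mscale c p = Poly_Mapping.single 0 c * p"

global_interpretation mpoly: vector_space "mscale :: 'k::field \<Rightarrow> 'k mpoly \<Rightarrow> 'k mpoly"
  defines mpoly_span = mpoly.span and mpoly_dim = mpoly.dim
  by unfold_locales
    (simp_all add: mscale_def distrib_left distrib_right single_add mult_single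
      flip: mult.assoc)

text \<open>Exponents with \<open>e\<^sub>i = 0\<close> contribute the coefficient \<open>0\<close>, so the truncated subtraction is
  harmless.\<close>

definition pdiff :: "nat \<Rightarrow> 'k::field mpoly \<Rightarrow> 'k mpoly" where
  "pdiff i p = (\<Sum>e\<in>Poly_Mapping.keys p.
     Poly_Mapping.single (e - Poly_Mapping.single i 1)
       (of_nat (Poly_Mapping.lookup e i) * Poly_Mapping.lookup p e))"

definition mono_diff :: "mono \<Rightarrow> 'k::field mpoly \<Rightarrow> 'k mpoly" where
  "mono_diff e =
     foldr (\<lambda>i. pdiff i ^^ Poly_Mapping.lookup e i) (sorted_list_of_set (Poly_Mapping.keys e))"

text \<open>\<open>f \<circ> g = f(\<partial>)(g)\<close>. For given \<open>g\<close>, only finitely many monomials \<open>e\<close> satisfy \<open>\<partial>\<^sup>e g \<noteq> 0\<close>.\<close>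

definition ps_act :: "'k::field pseries \<Rightarrow> 'k mpoly \<Rightarrow> 'k mpoly" where
  "ps_act f g = (\<Sum>e | mono_diff e g \<noteq> 0. mscale (f e) (mono_diff e g))"

definition Ann :: "nat \<Rightarrow> 'k::field mpoly \<Rightarrow> 'k pseries set" where
  "Ann m F = {f \<in> carrier (pseries_ring m). ps_act f F = 0}"

definition form3 :: "nat \<Rightarrow> 'k::field mpoly \<Rightarrow> bool" where
  "form3 n p \<longleftrightarrow> p \<in> mpolys n \<and>
     (\<forall>e\<in>Poly_Mapping.keys p. (\<Sum>i\<in>Poly_Mapping.keys e. Poly_Mapping.lookup e i) = 3)"

definition nondegenerate_form3 :: "nat \<Rightarrow> 'k::field mpoly \<Rightarrow> bool" where
  "nondegenerate_form3 n p \<longleftrightarrow> form3 n p \<and>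
     mpoly_dim (mpoly_span {pdiff i (pdiff j p) | i j. i < n \<and> j < n}) = n"


subsection \<open>\<open>K\<close>-algebras\<close>

abbreviation K_algebra :: "('k::field, 'a, 'c) module_scheme \<Rightarrow> bool" where
  "K_algebra A \<equiv> algebra (ring_of_type_algebra :: 'k ring) A"

definition alg_hom ::
  "('k, 'a, 'c) module_scheme \<Rightarrow> ('k, 'b, 'd) module_scheme \<Rightarrow> ('a \<Rightarrow> 'b) set" where
  "alg_hom A B = {h \<in> ring_hom A B. \<forall>c. \<forall>a\<in>carrier A. h (c \<odot>\<^bsub>A\<^esub> a) = c \<odot>\<^bsub>B\<^esub> h a}"

definition alg_iso ::
  "('k, 'a, 'c) module_scheme \<Rightarrow> ('k, 'b, 'd) module_scheme \<Rightarrow> bool" where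
  "alg_iso A B \<longleftrightarrow> (\<exists>h\<in>alg_hom A B. bij_betw h (carrier A) (carrier B))"

text \<open>\<^const>\<open>FactRing\<close> forgets the scalars, so they are put back: \<open>c \<odot> (I + x) = I + c \<odot> x\<close>.\<close>

definition quot_alg :: "('k, 'a, 'c) module_scheme \<Rightarrow> 'a set \<Rightarrow> ('k, 'a set) module" where
  "quot_alg A I = ring.extend (A Quot I)
     \<lparr> module.smult = (\<lambda>c C. \<Union>x\<in>C. I +>\<^bsub>A\<^esub> (c \<odot>\<^bsub>A\<^esub> x)) \<rparr>"

definition A_F :: "nat \<Rightarrow> 'k::field mpoly \<Rightarrow> ('k, 'k pseries set) module" where
  "A_F m F = quot_alg (pseries_ring m) (Ann m F)"

definition pseries_quotient :: "('k::field, 'a, 'c) module_scheme \<Rightarrow> bool" where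
  "pseries_quotient A \<longleftrightarrow>
     (\<exists>N. \<exists>h\<in>alg_hom (pseries_ring N) A. h ` carrier (pseries_ring N) = carrier A)"


subsection \<open>Artinian local rings, Hilbert function, Gorenstein\<close>

definition artinian :: "('a, 'c) ring_scheme \<Rightarrow> bool" where
  "artinian A \<longleftrightarrow> (\<forall>I. (\<forall>k. ideal (I k) A) \<and> (\<forall>k. I (Suc k) \<subseteq> I k) \<longrightarrow>
     (\<exists>n::nat. \<forall>k\<ge>n. I k = I n))"

definition local_ring :: "('a, 'c) ring_scheme \<Rightarrow> bool" where
  "local_ring A \<longleftrightarrow> cring A \<and> (\<exists>!M. maximalideal M A)"

definition max_ideal :: "('a, 'c) ring_scheme \<Rightarrow> 'a set" where
  "max_ideal A = (THE M. maximalideal M A)"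

fun ideal_pow :: "('a, 'c) ring_scheme \<Rightarrow> 'a set \<Rightarrow> nat \<Rightarrow> 'a set" where
  "ideal_pow A I 0 = carrier A"
| "ideal_pow A I (Suc i) = ideal_prod A (ideal_pow A I i) I"

text \<open>The copy \<open>K \<cdot> 1\<close> of the ground field inside an algebra; it plays the role of the subfield in
  \<^const>\<open>ring.dimension\<close>.\<close>

definition scalars :: "('k, 'a, 'c) module_scheme \<Rightarrow> 'a set" where
  "scalars A = {c \<odot>\<^bsub>A\<^esub> \<one>\<^bsub>A\<^esub> | c. True}"

text \<open>\<open>quotient_dim A I J d\<close> says \<open>dim\<^sub>K (I / J) = d\<close> for ideals \<open>J \<subseteq> I\<close>, with \<open>I / J\<close> viewed as a
  subspace of the algebra \<open>A / J\<close>. It holds for no \<open>d\<close> if \<open>I / J\<close> is infinite-dimensional.\<close>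

definition quotient_dim ::
  "('k, 'a, 'c) module_scheme \<Rightarrow> 'a set \<Rightarrow> 'a set \<Rightarrow> nat \<Rightarrow> bool" where
  "quotient_dim A I J d \<longleftrightarrow>
     ring.dimension (quot_alg A J) d (scalars (quot_alg A J)) ((\<lambda>a. J +>\<^bsub>A\<^esub> a) ` I)"

definition has_hilbert_function ::
  "('k, 'a, 'c) module_scheme \<Rightarrow> (nat \<Rightarrow> nat) \<Rightarrow> bool" where
  "has_hilbert_function A H \<longleftrightarrow>
     (\<forall>i. quotient_dim A (ideal_pow A (max_ideal A) i) (ideal_pow A (max_ideal A) (Suc i)) (H i))"

definition socle :: "('a, 'c) ring_scheme \<Rightarrow> 'a set" where
  "socle A = {a \<in> carrier A. \<forall>x\<in>max_ideal A. a \<otimes>\<^bsub>A\<^esub> x = \<zero>\<^bsub>A\<^esub>}"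

definition gorenstein :: "('k, 'a, 'c) module_scheme \<Rightarrow> bool" where
  "gorenstein A \<longleftrightarrow> ring.dimension A 1 (scalars A) (socle A)"

end

theory Submission
  imports Defs
begin

text \<open>
  For the forward direction, let \<open>\<phi> : A \<rightarrow> K\<close> be a linear form that does not vanish on the socle
  \<open>M\<^sup>3\<close>. Then \<open>(a, b) \<mapsto> \<phi> (a b)\<close> is nondegenerate, the annihilator of \<open>M\<^sup>2\<close> contains \<open>M\<^sup>2\<close> with
  codimension \<open>m - n\<close>, and the form is nondegenerate on the quotient. An orthogonal basis of a
  complement gives \<open>x\<^bsub>n+1\<^esub>, \<dots>, x\<^sub>m\<close> with \<open>\<phi> (x\<^sub>i x\<^sub>j) = 2 \<delta>\<^sub>i\<^sub>j\<close>. The remaining generators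
  \<open>x\<^sub>1, \<dots>, x\<^sub>n\<close> are first made orthogonal to these and then corrected by elements of \<open>M\<^sup>2\<close>, which
  pairs perfectly with them modulo \<open>M\<^sup>3\<close>, so that \<open>\<phi> (x\<^sub>i x\<^sub>j) = 0\<close> for \<open>i, j \<le> n\<close>. Finally \<open>\<phi>\<close> is
  changed on a complement of \<open>M\<^sup>2\<close> to vanish at \<open>1\<close> and at all \<open>x\<^sub>i\<close>. The polynomial
  \<open>F = \<Sum>\<^sub>e \<phi> (x\<^sup>e) / e! y\<^sup>e\<close> then has the required shape, and \<open>Ann F\<close> is the kernel of
  \<open>K[[x]] \<rightarrow> A\<close> because \<open>f \<circ> F = 0\<close> says that \<open>\<phi> (f b) = 0\<close> for all \<open>b\<close>. Conversely,
  \<open>f \<mapsto> (f \<circ> F) (0)\<close> is such a \<open>\<phi>\<close> on \<open>A\<^sub>F\<close>, and the Hilbert function can be read off from it.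

  All of the linear algebra takes place in a commutative ring given by a type which maps onto \<open>A\<close>,
  with the preimages of the powers of \<open>M\<close> in place of these powers.
\<close>

section \<open>Linear algebra modulo a subspace\<close>

text \<open>Both directions meet in the predicate \<open>normal_form\<close>: (a) and (b) are each
  equivalent to its holding for some generators \<open>x\<close>, some \<open>b\<close> and some
  linear form. It records the form on monomials in the generators, that is, the coefficients of F
  multiplied by e!, and contains no dimension count; the Hilbert function is recovered from
  orthogonality. The obstacle in the forward direction is that the pairing is not defined on M/M^2,
  because M pairs nontrivially with M^2. A basis \<open>b\<close> of M^2 modulo M^3 is therefore
  fixed at the start and the generators are made dual to it. Generators from index n on are then
  orthogonal to M^2, and every later change of the generators preserves this duality. The constant 2
  is the second derivative of y^2. Algebraic closure enters through the square roots that normalise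
  vectors, characteristic zero through division by 2 and by e!. The covering ring turns ideals into
  subspaces of one vector space, so that dimensions of quotients become statements about finite
  families modulo a subspace.\<close>

locale lin_space = vector_space scale
  for scale :: "'a::field \<Rightarrow> 'b::ab_group_add \<Rightarrow> 'b"
begin

abbreviation comb :: "(nat \<Rightarrow> 'a) \<Rightarrow> (nat \<Rightarrow> 'b) \<Rightarrow> nat \<Rightarrow> 'b" where
  "comb c b d \<equiv> \<Sum>i<d. scale (c i) (b i)"

text \<open>For subspaces J of I, the classes of \<open>b 0\<close>, ..., \<open>b (d - 1)\<close>
  form a basis of I/J. Families rather than sets let a basis be altered at one index.\<close>

definition basis_mod :: "'b set \<Rightarrow> 'b set \<Rightarrow> (nat \<Rightarrow> 'b) \<Rightarrow> nat \<Rightarrow> bool" where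
  "basis_mod I J b d \<longleftrightarrow> (\<forall>i<d. b i \<in> I) \<and> (\<forall>p\<in>I. \<exists>c. p - comb c b d \<in> J) \<and>
     (\<forall>c. comb c b d \<in> J \<longrightarrow> (\<forall>i<d. c i = 0))"

definition spanned_mod :: "'b set \<Rightarrow> (nat \<Rightarrow> 'b) \<Rightarrow> nat \<Rightarrow> 'b set" where
  "spanned_mod J b d = {p. \<exists>c. p - comb c b d \<in> J}"

definition linear_form :: "('b \<Rightarrow> 'a) \<Rightarrow> bool" where
  "linear_form \<phi> \<longleftrightarrow> (\<forall>p q. \<phi> (p + q) = \<phi> p + \<phi> q) \<and> (\<forall>c p. \<phi> (scale c p) = c * \<phi> p)"

lemma comb_delta: "k < d \<Longrightarrow> comb (\<lambda>i. if i = k then c else 0) b d = scale c (b k)"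
  by (simp add: if_distrib[of "\<lambda>x. scale x _"] cong: if_cong)

lemma comb_add: "comb (\<lambda>i. c i + c' i) b d = comb c b d + comb c' b d"
  by (simp add: scale_left_distrib sum.distrib)

lemma comb_scale: "comb (\<lambda>i. a * c i) b d = scale a (comb c b d)"
  by (simp add: scale_sum_right)

lemma comb_mem: "subspace S \<Longrightarrow> (\<And>i. i < d \<Longrightarrow> b i \<in> S) \<Longrightarrow> comb c b d \<in> S"
  by (intro subspace_sum subspace_scale) auto

lemma subspace_spanned_mod:
  assumes J: "subspace J"
  shows "subspace (spanned_mod J b d)"
proof (rule subspaceI)
  show "0 \<in> spanned_mod J b d"
    using subspace_0[OF J] by (auto simp: spanned_mod_def intro!: exI[of _ "\<lambda>_. 0"])
next
  fix x y assume "x \<in> spanned_mod J b d" "y \<in> spanned_mod J b d"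
  then obtain c c' where "x - comb c b d \<in> J" "y - comb c' b d \<in> J"
    by (auto simp: spanned_mod_def)
  then have "(x - comb c b d) + (y - comb c' b d) \<in> J"
    by (rule subspace_add[OF J])
  moreover have "(x - comb c b d) + (y - comb c' b d) = (x + y) - comb (\<lambda>i. c i + c' i) b d"
    unfolding comb_add by simp
  ultimately show "x + y \<in> spanned_mod J b d"
    unfolding spanned_mod_def by auto
next
  fix a x assume "x \<in> spanned_mod J b d"
  then obtain c where "x - comb c b d \<in> J"
    by (auto simp: spanned_mod_def)
  then have "scale a (x - comb c b d) \<in> J"
    by (rule subspace_scale[OF J])
  moreover have "scale a (x - comb c b d) = scale a x - comb (\<lambda>i. a * c i) b d"
    unfolding comb_scale by (rule scale_right_diff_distrib)
  ultimately show "scale a x \<in> spanned_mod J b d"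
    unfolding spanned_mod_def by auto
qed

lemma spanned_mod_base:
  assumes "subspace J" "k < d"
  shows "b k \<in> spanned_mod J b d"
proof -
  have "b k - comb (\<lambda>i. if i = k then 1 else 0) b d = 0"
    using comb_delta[OF assms(2), of 1 b] by simp
  then show ?thesis
    unfolding spanned_mod_def using subspace_0[OF assms(1)]
    by (intro CollectI exI[of _ "\<lambda>i. if i = k then 1 else 0"]) (simp only:)
qed

lemma spanned_mod_superset: "J \<subseteq> spanned_mod J b d"
  by (auto simp: spanned_mod_def intro!: exI[of _ "\<lambda>_. 0"])

lemma spanned_mod_subset:
  assumes S: "subspace S" "J \<subseteq> S" "\<And>i. i < d \<Longrightarrow> b i \<in> S"
  shows "spanned_mod J b d \<subseteq> S"
proof
  fix p assume "p \<in> spanned_mod J b d"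
  then obtain c where "p - comb c b d \<in> S"
    using S(2) by (auto simp: spanned_mod_def)
  moreover have "comb c b d \<in> S"
    by (rule comb_mem[OF S(1)]) (rule S(3))
  ultimately show "p \<in> S"
    using subspace_add[OF S(1)] by fastforce
qed

lemma basis_modD:
  assumes "basis_mod I J b d"
  shows "\<And>i. i < d \<Longrightarrow> b i \<in> I" "I \<subseteq> spanned_mod J b d"
    "\<And>c i. comb c b d \<in> J \<Longrightarrow> i < d \<Longrightarrow> c i = 0"
  using assms by (auto simp: basis_mod_def spanned_mod_def)

text \<open>Exchange argument: a relation with a nonzero coefficient would let d - 1 vectors span a
  space that contains d independent ones. Every later change of basis relies on this, so that only
  spanning has to be checked there.\<close>

lemma spanning_basis_mod:
  assumes J: "subspace J" and a: "basis_mod I J a d" and y: "\<And>i. i < d \<Longrightarrow> y i \<in> I"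
    and span: "\<And>i. i < d \<Longrightarrow> a i \<in> spanned_mod J y d"
  shows "basis_mod I J y d"
proof -
  have "spanned_mod J a d \<subseteq> spanned_mod J y d"
    by (rule spanned_mod_subset[OF subspace_spanned_mod[OF J] spanned_mod_superset]) (rule span)
  then have "I \<subseteq> spanned_mod J y d"
    using basis_modD(2)[OF a] by (rule subset_trans[rotated])
  moreover have "c k = 0" if c: "comb c y d \<in> J" and k: "k < d" for c k
  proof (rule ccontr)
    assume ck: "c k \<noteq> 0"
    have "\<forall>i. \<exists>p. i < d \<longrightarrow> y i - comb p a d \<in> J"
      using y basis_modD(2)[OF a] by (auto simp: spanned_mod_def)
    then obtain P where P: "\<And>i. i < d \<Longrightarrow> y i - comb (P i) a d \<in> J"
      by metis
    \<comment> \<open>The span \<open>U\<close> of the known basis meets J in 0, and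
      \<open>y'\<close> is the projection of \<open>y\<close> to \<open>U\<close> along J. The
      counting argument then takes place in \<open>U\<close>, however large J is.\<close>
    define y' where "y' i = comb (P i) a d" for i
    define U where "U = span (a ` {..<d})"
    have y'U: "y' i \<in> U" for i
      unfolding y'_def U_def by (intro comb_mem) (auto intro: span_base)
    have UJ: "u = 0" if "u \<in> U" "u \<in> J" for u
    proof -
      have "u \<in> spanned_mod {0} a d"
      proof -
        have "U \<subseteq> spanned_mod {0} a d"
          unfolding U_def by (rule span_minimal) (auto intro: spanned_mod_base subspace_spanned_mod)
        then show ?thesis using that by auto
      qed
      then obtain e where e: "u = comb e a d"
        by (auto simp: spanned_mod_def)
      then have "\<And>i. i < d \<Longrightarrow> e i = 0"
        using that basis_modD(3)[OF a] by auto
      then show ?thesis unfolding e by simp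
    qed
    have inj: "inj_on a {..<d}"
    proof (rule inj_onI)
      fix i j assume ij: "i \<in> {..<d}" "j \<in> {..<d}" "a i = a j"
      have "comb (\<lambda>l. (if l = i then 1 else 0) + (if l = j then -1 else 0)) a d = 0"
        unfolding comb_add using ij comb_delta[of i d 1 a] comb_delta[of j d "-1" a] by simp
      then have "(if i = i then 1 else 0) + (if i = j then -1 else 0) = (0::'a)"
        using basis_modD(3)[OF a, of "\<lambda>l. (if l = i then 1 else 0) + (if l = j then -1 else 0)" i] subspace_0[OF J] ij
        by simp
      then show "i = j" by (auto split: if_splits)
    qed
    have ind: "independent (a ` {..<d})"
    proof (rule independent_if_scalars_zero)
      fix f x assume f: "(\<Sum>x\<in>a ` {..<d}. scale (f x) x) = 0" and x: "x \<in> a ` {..<d}"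
      from f have "comb (\<lambda>i. f (a i)) a d = 0"
        by (simp add: sum.reindex[OF inj])
      then show "f x = 0"
        using basis_modD(3)[OF a, of "\<lambda>i. f (a i)"] x subspace_0[OF J] by auto
    qed simp
    \<comment> \<open>The relation expresses \<open>y' k\<close> by the other vectors, so these d -
      1 vectors still span every \<open>a i\<close>.\<close>
    define T where "T = y' ` ({..<d} - {k})"
    have y'T: "y' i \<in> span T" if "i < d" "i \<noteq> k" for i
      unfolding T_def using that by (auto intro: span_base)
    have diff: "comb e y d - comb e y' d \<in> J" for e
    proof -
      have "comb e y d - comb e y' d = (\<Sum>i<d. scale (e i) (y i - y' i))"
        by (simp add: sum_subtractf scale_right_diff_distrib)
      also have "\<dots> \<in> J"
        unfolding y'_def by (intro subspace_sum[OF J] subspace_scale[OF J] P) simp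
      finally show ?thesis .
    qed
    have U: "subspace U" by (simp add: U_def)
    have "comb c y' d \<in> J"
      using subspace_diff[OF J c diff[of c]] by simp
    moreover have "comb c y' d \<in> U"
      by (rule comb_mem[OF U]) (rule y'U)
    ultimately have "comb c y' d = 0"
      using UJ by blast
    then have "scale (c k) (y' k) + (\<Sum>i\<in>{..<d} - {k}. scale (c i) (y' i)) = 0"
      using k by (subst (asm) sum.remove[of _ k]) auto
    then have "scale (c k) (y' k) = - (\<Sum>i\<in>{..<d} - {k}. scale (c i) (y' i))"
      by (simp add: eq_neg_iff_add_eq_0)
    moreover have "- (\<Sum>i\<in>{..<d} - {k}. scale (c i) (y' i)) \<in> span T"
      by (intro span_neg span_sum span_scale y'T) auto
    ultimately have "scale (c k) (y' k) \<in> span T"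
      by simp
    then have "scale (inverse (c k)) (scale (c k) (y' k)) \<in> span T"
      by (rule span_scale)
    then have y'k: "y' k \<in> span T" using ck by simp
    have "a i \<in> span T" if i: "i < d" for i
    proof -
      from span[OF i] obtain e where e: "a i - comb e y d \<in> J"
        by (auto simp: spanned_mod_def)
      have "a i - comb e y' d \<in> J"
        using subspace_add[OF J e diff[of e]] by simp
      moreover have "a i - comb e y' d \<in> U"
        by (intro subspace_diff[OF U] comb_mem[OF U] y'U) (auto simp: U_def i intro: span_base)
      ultimately have "a i = comb e y' d" using UJ by fastforce
      also have "\<dots> \<in> span T" by (rule comb_mem) (use y'T y'k in auto)
      finally show ?thesis .
    qed
    then have "a ` {..<d} \<subseteq> span T" by auto
    from independent_span_bound[OF _ ind this] have "card (a ` {..<d}) \<le> card T"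
      by (auto simp: T_def)
    also have "card T \<le> card ({..<d} - {k})"
      unfolding T_def by (rule card_image_le) simp
    also have "\<dots> < d" using k by simp
    finally show False using card_image[OF inj] by simp
  qed
  ultimately show ?thesis
    using y by (auto simp: basis_mod_def spanned_mod_def)
qed

lemma linear_form_simps:
  assumes "linear_form \<phi>"
  shows "\<phi> (p + q) = \<phi> p + \<phi> q" "\<phi> (scale c p) = c * \<phi> p" "\<phi> 0 = 0" "\<phi> (- p) = - \<phi> p"
    "\<phi> (p - q) = \<phi> p - \<phi> q" "\<phi> (sum f S) = (\<Sum>i\<in>S. \<phi> (f i))"
proof -
  show add: "\<phi> (p + q) = \<phi> p + \<phi> q" and sc: "\<phi> (scale c p) = c * \<phi> p" for p q c
    using assms by (auto simp: linear_form_def)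
  show zero: "\<phi> 0 = 0" using sc[of 0 0] by simp
  show neg: "\<phi> (- p) = - \<phi> p" for p using sc[of "-1" p] by simp
  show "\<phi> (p - q) = \<phi> p - \<phi> q" using add[of p "- q"] neg[of q] by simp
  show "\<phi> (sum f S) = (\<Sum>i\<in>S. \<phi> (f i))"
    by (induction S rule: infinite_finite_induct) (auto simp: zero add)
qed

lemma linear_form_lincomb:
  "linear_form \<phi> \<Longrightarrow> linear_form \<psi> \<Longrightarrow> linear_form (\<lambda>p. c * \<phi> p + d * \<psi> p)"
  by (simp add: linear_form_def algebra_simps)

text \<open>A basis of S stays independent when s is added, so a linear map may be prescribed as 0
  on that basis and 1 at s.\<close>

lemma exists_linear_form:
  assumes S: "subspace S" and s: "s \<notin> S"
  obtains \<phi> where "linear_form \<phi>" "\<And>p. p \<in> S \<Longrightarrow> \<phi> p = 0" "\<phi> s = 1"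
proof -
  obtain B where B: "B \<subseteq> S" "independent B" "S \<subseteq> span B"
    using basis_exists[of S] by metis
  have sB: "span B = S"
    using B span_minimal[OF B(1) S] by auto
  have ind: "independent (insert s B)"
    using s sB B(2) by (auto simp: independent_insert)
  interpret f: vector_space "(*) :: 'a \<Rightarrow> 'a \<Rightarrow> 'a"
    by unfold_locales (auto simp: algebra_simps)
  interpret pair: vector_space_pair scale "(*) :: 'a \<Rightarrow> 'a \<Rightarrow> 'a" ..
  obtain g where g: "Vector_Spaces.linear scale (*) g" "\<And>x. x \<in> insert s B \<Longrightarrow> g x = (if x = s then 1 else 0)"
    using pair.linear_independent_extend[OF ind, of "\<lambda>x. if x = s then 1 else 0"] by blast
  interpret g: Vector_Spaces.linear scale "(*)" g by (rule g(1))
  show ?thesis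
  proof
    show "linear_form g" by (simp add: linear_form_def g.add g.scale)
    have "s \<notin> B" using s B(1) by auto
    then have "\<And>x. x \<in> B \<Longrightarrow> g x = 0" using g(2) by auto
    then show "g p = 0" if "p \<in> S" for p
      using that pair.linear_eq_0_on_span[OF g(1), of B p] sB by auto
    show "g s = 1" using g(2) by simp
  qed
qed

lemma exists_linear_form_values:
  assumes J: "subspace J" and ind: "\<And>c i. comb c b d \<in> J \<Longrightarrow> i < d \<Longrightarrow> c i = 0"
  shows "\<exists>\<phi>. linear_form \<phi> \<and> (\<forall>p\<in>J. \<phi> p = 0) \<and> (\<forall>i<d. \<phi> (b i) = w i)"
  using ind
proof (induction d)
  case 0
  show ?case by (rule exI[of _ "\<lambda>_. 0"]) (simp add: linear_form_def)
next
  case (Suc d)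
  have "\<exists>\<phi>. linear_form \<phi> \<and> (\<forall>p\<in>J. \<phi> p = 0) \<and> (\<forall>i<d. \<phi> (b i) = w i)"
  proof (rule Suc.IH)
    fix c i assume "comb c b d \<in> J" "i < d"
    then show "c i = 0"
      using Suc.prems[of "c(d := 0)" i] by (auto cong: sum.cong_simp)
  qed
  then obtain \<phi> where \<phi>: "linear_form \<phi>" "\<And>p. p \<in> J \<Longrightarrow> \<phi> p = 0" "\<And>i. i < d \<Longrightarrow> \<phi> (b i) = w i"
    by auto
  have "b d \<notin> spanned_mod J b d"
  proof
    assume "b d \<in> spanned_mod J b d"
    then obtain c where c: "b d - comb c b d \<in> J" by (auto simp: spanned_mod_def)
    have "comb (\<lambda>i. if i = d then 1 else - c i) b (Suc d) = b d - comb c b d"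
      by (simp add: sum_negf cong: sum.cong_simp)
    then show False using Suc.prems[of "\<lambda>i. if i = d then 1 else - c i" d] c by simp
  qed
  then obtain \<chi> where \<chi>: "linear_form \<chi>" "\<And>p. p \<in> spanned_mod J b d \<Longrightarrow> \<chi> p = 0" "\<chi> (b d) = 1"
    using exists_linear_form[OF subspace_spanned_mod[OF J]] by metis
  \<comment> \<open>\<open>\<chi>\<close> vanishes on J and on the earlier vectors, so a multiple of
    it corrects the value at \<open>b d\<close> without disturbing the values already
    attained.\<close>
  let ?\<phi> = "\<lambda>p. 1 * \<phi> p + (w d - \<phi> (b d)) * \<chi> p"
  have "linear_form ?\<phi>" by (intro linear_form_lincomb \<phi> \<chi>)
  moreover have "\<forall>p\<in>J. ?\<phi> p = 0"
    using \<phi>(2) \<chi>(2) spanned_mod_superset[of J b d] by auto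
  moreover have "\<forall>i<Suc d. ?\<phi> (b i) = w i"
    using \<phi>(3) \<chi>(2,3) spanned_mod_base[OF J, of _ d b] by (auto simp: less_Suc_eq)
  ultimately show ?case by blast
qed

end

section \<open>Covering an algebra by a polynomial ring\<close>

locale typed_algebra = lin_space sc
  for sc :: "'k::field \<Rightarrow> 'q::comm_ring_1 \<Rightarrow> 'q" +
  assumes sc_mult: "sc c p * q = sc c (p * q)"
begin

lemma mult_sc: "p * sc c q = sc c (p * q)"
  by (metis mult.commute sc_mult)

lemma sc_one: "sc c 1 * p = sc c p"
  by (simp add: sc_mult)

end

text \<open>The ring \<open>'q\<close> is a whole type, so preimages of ideals are subspaces of one
  vector space. Preservation of zero and one is not among the axioms: the first follows from scaling
  by 0, the second from surjectivity.\<close>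

locale cover = typed_algebra sc
  for sc :: "'k::field \<Rightarrow> 'q::comm_ring_1 \<Rightarrow> 'q" +
  fixes A :: "('k, 'a) module" and ev :: "'q \<Rightarrow> 'a"
  assumes K_algebra: "K_algebra A"
    and ev_add: "ev (p + q) = ev p \<oplus>\<^bsub>A\<^esub> ev q"
    and ev_mult: "ev (p * q) = ev p \<otimes>\<^bsub>A\<^esub> ev q"
    and ev_sc: "ev (sc c p) = c \<odot>\<^bsub>A\<^esub> ev p"
    and ev_range: "range ev = carrier A"

lemma typed_algebra_poly_mapping:
  "typed_algebra (\<lambda>c p. Poly_Mapping.single 0 c * p :: 'b::comm_monoid_add \<Rightarrow>\<^sub>0 'k::field)"
  by unfold_locales
    (simp_all add: distrib_left distrib_right single_add mult_single mult.assoc flip: mult.assoc)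

lemma poly_mapping_single_induct:
  fixes p :: "'b \<Rightarrow>\<^sub>0 'k::comm_monoid_add"
  assumes "\<And>e c. P (Poly_Mapping.single e c)" and "\<And>p q. P p \<Longrightarrow> P q \<Longrightarrow> P (p + q)"
  shows "P p"
proof (induction p rule: update_induct)
  case const
  then show ?case using assms(1)[of undefined 0] by simp
next
  case (update p a b)
  have "Poly_Mapping.update a b p = p + Poly_Mapping.single a b"
    using update by (intro poly_mapping_eqI)
      (auto simp: lookup_update lookup_add lookup_single when_def in_keys_iff)
  then show ?case using update assms by simp
qed

section \<open>Evaluation of polynomials in the elements of an algebra\<close>

lemma ring_of_type_algebra_sel [simp]:
  "carrier ring_of_type_algebra = UNIV"
  "a \<otimes>\<^bsub>ring_of_type_algebra\<^esub> b = a * b"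
  "a \<oplus>\<^bsub>ring_of_type_algebra\<^esub> b = a + b"
  "\<one>\<^bsub>ring_of_type_algebra\<^esub> = 1"
  "\<zero>\<^bsub>ring_of_type_algebra\<^esub> = 0"
  by (simp_all add: ring_of_type_algebra_def)

locale K_alg =
  fixes A :: "('k::field, 'a) module" (structure)
  assumes K_algebra: "K_algebra A"

sublocale K_alg \<subseteq> algebra "ring_of_type_algebra :: 'k ring" A
  by (rule K_algebra)

context K_alg
begin

lemma smult_mem [simp, intro]: "a \<in> carrier A \<Longrightarrow> c \<odot> a \<in> carrier A"
  using smult_closed by simp

lemma smult_add_scalar: "a \<in> carrier A \<Longrightarrow> (c + d) \<odot> a = c \<odot> a \<oplus> d \<odot> a"
  using smult_l_distr[of c d a] by simp

lemma smult_add: "a \<in> carrier A \<Longrightarrow> b \<in> carrier A \<Longrightarrow> c \<odot> (a \<oplus> b) = c \<odot> a \<oplus> c \<odot> b"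
  using smult_r_distr[of c a b] by simp

lemma smult_smult: "a \<in> carrier A \<Longrightarrow> c \<odot> (d \<odot> a) = (c * d) \<odot> a"
  using smult_assoc1[of c d a] by simp

lemma smult_mult_left: "a \<in> carrier A \<Longrightarrow> b \<in> carrier A \<Longrightarrow> (c \<odot> a) \<otimes> b = c \<odot> (a \<otimes> b)"
  using smult_assoc2[of c a b] by simp

lemma smult_mult_right: "a \<in> carrier A \<Longrightarrow> b \<in> carrier A \<Longrightarrow> a \<otimes> (c \<odot> b) = c \<odot> (a \<otimes> b)"
  by (metis m_comm smult_mult_left smult_mem)

lemma one_smult [simp]: "a \<in> carrier A \<Longrightarrow> 1 \<odot> a = a"
  using smult_one[of a] by simp

lemma zero_smult [simp]: "a \<in> carrier A \<Longrightarrow> 0 \<odot> a = \<zero>"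
  using smult_l_null[of a] by simp

text \<open>The test makes \<open>mon_step\<close> commute with itself on the whole type, as \<open>fold_mset\<close> requires.\<close>

definition mon_step :: "'a \<Rightarrow> 'a \<Rightarrow> 'a" where
  "mon_step x a = (if a \<in> carrier A \<and> x \<in> carrier A then x \<otimes> a else a)"

definition mon :: "'a multiset \<Rightarrow> 'a" where
  "mon = fold_mset mon_step \<one>"

lemma comp_fun_commute_mon_step: "comp_fun_commute mon_step"
  by unfold_locales (auto simp: mon_step_def fun_eq_iff m_lcomm)

lemma mon_empty [simp]: "mon {#} = \<one>"
  by (simp add: mon_def)

lemma mon_add_mset: "mon (add_mset x M) = mon_step x (mon M)"
  by (simp add: mon_def comp_fun_commute.fold_mset_add_mset[OF comp_fun_commute_mon_step])

lemma mon_closed [simp]: "mon M \<in> carrier A"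
  by (induction M) (auto simp: mon_add_mset mon_step_def)

lemma mon_single: "x \<in> carrier A \<Longrightarrow> mon {#x#} = x"
  by (simp add: mon_add_mset mon_step_def)

lemma mon_plus: "mon (M + N) = mon M \<otimes> mon N"
  by (induction M) (auto simp: mon_add_mset mon_step_def m_assoc)

text \<open>Finitely supported functions on multisets are polynomials with one variable for each
  element of the type, a multiset being a monomial. Variables outside the carrier are read as 1, so
  evaluation is total and lands in A.\<close>

definition multiset_ev :: "('a multiset \<Rightarrow>\<^sub>0 'k) \<Rightarrow> 'a" where
  "multiset_ev p = (\<Oplus>e\<in>Poly_Mapping.keys p. Poly_Mapping.lookup p e \<odot> mon e)"

lemma multiset_ev_superset:
  assumes "finite S" "Poly_Mapping.keys p \<subseteq> S"
  shows "multiset_ev p = (\<Oplus>e\<in>S. Poly_Mapping.lookup p e \<odot> mon e)"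
  unfolding multiset_ev_def
  by (rule add.finprod_mono_neutral_cong_left) (use assms in \<open>auto simp: in_keys_iff\<close>)

lemma multiset_ev_closed: "multiset_ev p \<in> carrier A"
  unfolding multiset_ev_def by (rule finsum_closed) auto

lemma multiset_ev_add: "multiset_ev (p + q) = multiset_ev p \<oplus> multiset_ev q"
proof -
  let ?S = "Poly_Mapping.keys p \<union> Poly_Mapping.keys q"
  have "multiset_ev (p + q) = (\<Oplus>e\<in>?S. Poly_Mapping.lookup (p + q) e \<odot> mon e)"
    by (rule multiset_ev_superset) (auto simp: keys_add)
  also have "\<dots> = (\<Oplus>e\<in>?S. Poly_Mapping.lookup p e \<odot> mon e \<oplus> Poly_Mapping.lookup q e \<odot> mon e)"
    by (rule finsum_cong') (auto simp: lookup_add smult_add_scalar)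
  also have "\<dots> = multiset_ev p \<oplus> multiset_ev q"
    by (subst finsum_addf) (auto simp: multiset_ev_superset[of ?S])
  finally show ?thesis .
qed

lemma multiset_ev_single: "multiset_ev (Poly_Mapping.single e c) = c \<odot> mon e"
  by (subst multiset_ev_superset[of "{e}"]) auto

lemma multiset_ev_mult: "multiset_ev (p * q) = multiset_ev p \<otimes> multiset_ev q"
proof (induction p rule: poly_mapping_single_induct)
  case (1 e c)
  show ?case
  proof (induction q rule: poly_mapping_single_induct)
    case (1 e' c')
    then show ?case
      by (simp add: mult_single multiset_ev_single mon_plus smult_mult_left smult_mult_right smult_smult mult.commute[of c c'])
  qed (simp add: multiset_ev_add distrib_left r_distr multiset_ev_closed)
qed (simp add: multiset_ev_add distrib_right l_distr multiset_ev_closed)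

lemma cover_multiset_ev:
  "cover (\<lambda>c p. Poly_Mapping.single 0 c * p) A multiset_ev"
proof (intro cover.intro cover_axioms.intro)
  show "typed_algebra (\<lambda>c p. Poly_Mapping.single 0 c * p :: 'a multiset \<Rightarrow>\<^sub>0 'k)"
    by (rule typed_algebra_poly_mapping)
  have "a \<in> range multiset_ev" if "a \<in> carrier A" for a
    using that by (intro range_eqI[of _ _ "Poly_Mapping.single {#a#} 1"])
      (simp add: multiset_ev_single mon_single)
  then show "range multiset_ev = carrier A"
    using multiset_ev_closed by blast
qed (use K_algebra in \<open>auto simp: multiset_ev_add multiset_ev_mult multiset_ev_single
        multiset_ev_closed smult_mult_left\<close>)

end

section \<open>Diagonalising the pairing\<close>

declare One_nat_def [simp del]

lemma sum_mult_delta: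
  fixes f :: "nat \<Rightarrow> 'a::semiring_1"
  shows "(\<Sum>j<k. f j * (if i = j then 1 else 0)) = (if i < k then f i else 0)"
proof -
  have "(\<Sum>j<k. f j * (if i = j then 1 else 0)) = (\<Sum>j<k. if i = j then f j else 0)"
    by (rule sum.cong) auto
  then show ?thesis by simp
qed

text \<open>\<open>Z\<close> stands for the kernel of a cover and \<open>N i\<close> for the
  preimage of the i-th power of the maximal ideal. \<open>N_least\<close> describes the next power
  by minimality: a claim about it is proved by checking a subspace that contains \<open>Z\<close>
  and all products.\<close>

locale filtered_algebra = typed_algebra sc
  for sc :: "'k::field \<Rightarrow> 'q::comm_ring_1 \<Rightarrow> 'q" +
  fixes Z :: "'q set" and N :: "nat \<Rightarrow> 'q set"
  assumes Z_subspace: "subspace Z" and N_subspace: "subspace (N i)"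
    and Z_ideal: "p \<in> Z \<Longrightarrow> q * p \<in> Z" and N_ideal: "p \<in> N i \<Longrightarrow> q * p \<in> N i"
    and Z_subset: "Z \<subseteq> N i" and N_0: "N 0 = UNIV"
    and N_Suc: "p \<in> N i \<Longrightarrow> q \<in> N 1 \<Longrightarrow> p * q \<in> N (Suc i)"
    and N_least: "subspace S \<Longrightarrow> Z \<subseteq> S \<Longrightarrow> (\<And>p q. p \<in> N i \<Longrightarrow> q \<in> N 1 \<Longrightarrow> p * q \<in> S) \<Longrightarrow> N (Suc i) \<subseteq> S"
begin

lemma N_Suc_subset: "N (Suc i) \<subseteq> N i"
  by (rule N_least[OF N_subspace Z_subset]) (metis N_ideal mult.commute)

lemma N_antimono: "i \<le> j \<Longrightarrow> N j \<subseteq> N i"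
  by (rule lift_Suc_antimono_le[of N]) (rule N_Suc_subset)

lemma N_mult: "p \<in> N i \<Longrightarrow> q \<in> N j \<Longrightarrow> p * q \<in> N (i + j)"
proof (induction j arbitrary: q)
  case 0
  then show ?case using N_ideal[of p i q] by (simp add: mult.commute)
next
  case (Suc j)
  have "subspace {q. p * q \<in> N (i + Suc j)}"
    by (rule subspaceI)
      (auto simp: distrib_left mult_sc subspace_0 subspace_add subspace_scale N_subspace)
  moreover have "Z \<subseteq> {q. p * q \<in> N (i + Suc j)}"
    using Z_ideal Z_subset by blast
  moreover have "r * s \<in> {q. p * q \<in> N (i + Suc j)}" if "r \<in> N j" "s \<in> N 1" for r s
    using N_Suc[OF Suc.IH[OF Suc.prems(1) that(1)] that(2)] by (simp add: mult.assoc)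
  ultimately show ?case
    using N_least Suc.prems(2) by blast
qed

lemma form_comb:
  "linear_form \<phi> \<Longrightarrow> \<phi> (comb c b d * p) = (\<Sum>i<d. c i * \<phi> (b i * p))"
  by (simp add: sum_distrib_right sc_mult linear_form_simps)

lemma form_comb': "linear_form \<phi> \<Longrightarrow> \<phi> (p * comb c b d) = (\<Sum>i<d. c i * \<phi> (p * b i))"
  using form_comb[of \<phi> c b d p] by (simp add: mult.commute)

lemma subspace_form_kernel: "linear_form \<phi> \<Longrightarrow> subspace {q. \<phi> (p * q) = 0}"
  by (rule subspaceI) (auto simp: distrib_left mult_sc linear_form_simps)

text \<open>Up to the factors e!, the clauses on \<open>x\<close> are the coefficients of F: nothing
  in degrees 0, 1 and from 4 on, a sum of squares in degree 2, and no cubic term that involves a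
  variable of index at least n. The vectors \<open>b\<close> dual to the generators express that F_3
  is non degenerate. Independence of \<open>x\<close> and \<open>b\<close> is left out because it
  follows from these pairings.\<close>

definition normal_form ::
  "nat \<Rightarrow> nat \<Rightarrow> (nat \<Rightarrow> 'q) \<Rightarrow> (nat \<Rightarrow> 'q) \<Rightarrow> ('q \<Rightarrow> 'k) \<Rightarrow> bool" where
  "normal_form m n x b \<phi> \<longleftrightarrow>
     linear_form \<phi> \<and> (\<forall>p\<in>Z. \<phi> p = 0) \<and> (\<forall>p. (\<forall>q. \<phi> (p * q) = 0) \<longrightarrow> p \<in> Z) \<and>
     (\<forall>p\<in>N 4. \<phi> p = 0) \<and>
     UNIV \<subseteq> spanned_mod (N 1) (\<lambda>_. 1) 1 \<and>
     (\<forall>i<m. x i \<in> N 1) \<and> N 1 \<subseteq> spanned_mod (N 2) x m \<and> (\<forall>j<n. b j \<in> N 2) \<and>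
     \<phi> 1 = 0 \<and> (\<forall>i<m. \<phi> (x i) = 0) \<and>
     (\<forall>i<m. \<forall>j<m. \<phi> (x i * x j) = (if i = j \<and> n \<le> i then 2 else 0)) \<and>
     (\<forall>i<m. \<forall>j<m. \<forall>k<m. n \<le> k \<longrightarrow> \<phi> (x i * x j * x k) = 0) \<and>
     (\<forall>j<n. \<forall>k<m. \<phi> (b j * x k) = (if j = k then 1 else 0))"

end

text \<open>The situation once a form that is nonzero on the socle has been chosen: M^4 = 0, the
  socle lies in M^3, and \<open>b\<close> is a basis of M^2 modulo M^3. Form and \<open>b\<close>
  stay fixed while the generators vary.\<close>

locale dual_algebra = filtered_algebra sc Z N
  for sc :: "'k::{alg_closed_field, field_char_0} \<Rightarrow> 'q::comm_ring_1 \<Rightarrow> 'q" and Z N +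
  fixes \<phi> :: "'q \<Rightarrow> 'k" and b :: "nat \<Rightarrow> 'q" and m n :: nat
  assumes form: "linear_form \<phi>" and form_Z: "p \<in> Z \<Longrightarrow> \<phi> p = 0"
    and nondeg: "(\<And>q. \<phi> (p * q) = 0) \<Longrightarrow> p \<in> Z"
    and N_4: "N 4 \<subseteq> Z"
    and socle: "(\<And>x. x \<in> N 1 \<Longrightarrow> p * x \<in> Z) \<Longrightarrow> p \<in> N 3"
    and basis_b: "basis_mod (N 2) (N 3) b n"
begin

lemmas form_simps = linear_form_simps[OF form] form_comb[OF form] form_comb'[OF form]

lemma b_mem: "j < n \<Longrightarrow> b j \<in> N 2"
  using basis_modD(1)[OF basis_b] .

lemma form_N_mult: "p \<in> N i \<Longrightarrow> q \<in> N j \<Longrightarrow> 4 \<le> i + j \<Longrightarrow> \<phi> (p * q) = 0"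
  using N_mult N_antimono N_4 form_Z by blast

text \<open>The hypotheses make \<open>p\<close> orthogonal to all of \<open>N 1\<close>. As
  \<open>N 1\<close> is an ideal, the products of \<open>p\<close> with its elements are then
  orthogonal to the whole ring, hence in \<open>Z\<close>, so \<open>p\<close> lies in the
  socle.\<close>

lemma mem_N_3:
  assumes x: "basis_mod (N 1) (N 2) x m" and px: "\<And>i. i < m \<Longrightarrow> \<phi> (p * x i) = 0"
    and p2: "\<And>y. y \<in> N 2 \<Longrightarrow> \<phi> (p * y) = 0"
  shows "p \<in> N 3"
proof -
  have "spanned_mod (N 2) x m \<subseteq> {q. \<phi> (p * q) = 0}"
    by (rule spanned_mod_subset[OF subspace_form_kernel[OF form]]) (use px p2 in auto)
  then have 1: "\<phi> (p * y) = 0" if "y \<in> N 1" for y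
    using basis_modD(2)[OF x] that by blast
  show ?thesis
  proof (rule socle)
    fix y assume "y \<in> N 1"
    then have "\<phi> (p * (q * y)) = 0" for q
      using 1 N_ideal by blast
    then show "p * y \<in> Z"
      by (intro nondeg) (metis mult.assoc mult.commute)
  qed
qed

text \<open>Solving \<open>\<phi> (b j * x i) = \<delta>\<close> one \<open>j\<close> at a time, as in Gaussian elimination.\<close>

lemma dual_basis_step:
  assumes x: "basis_mod (N 1) (N 2) x m" and k: "k < n"
    and dual: "\<And>j i. j < k \<Longrightarrow> i < m \<Longrightarrow> \<phi> (b j * x i) = (if i = j then 1 else 0)"
  shows "\<exists>y. basis_mod (N 1) (N 2) y m \<and>
    (\<forall>j<Suc k. \<forall>i<m. \<phi> (b j * y i) = (if i = j then 1 else 0))"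
proof -
  have "\<exists>i. k \<le> i \<and> i < m \<and> \<phi> (b k * x i) \<noteq> 0"
  proof (rule ccontr)
    assume "\<not> ?thesis"
    then have z: "\<And>i. k \<le> i \<Longrightarrow> i < m \<Longrightarrow> \<phi> (b k * x i) = 0" by blast
    \<comment> \<open>Without a pivot, removing from \<open>b k\<close> what the first k generators
      see leaves an element orthogonal to \<open>N 1\<close>. It lies in \<open>N 3\<close>, against
      the independence of \<open>b\<close>.\<close>
    define r where "r = b k - comb (\<lambda>j. \<phi> (b k * x j)) b k"
    have rN: "r \<in> N 2"
      unfolding r_def using k b_mem by (intro subspace_diff[OF N_subspace] comb_mem[OF N_subspace]) auto
    have "r \<in> N 3"
    proof (rule mem_N_3[OF x])
      fix i assume i: "i < m"
      have "\<phi> (r * x i) = \<phi> (b k * x i) - (\<Sum>j<k. \<phi> (b k * x j) * (if i = j then 1 else 0))"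
        unfolding r_def using dual i by (simp add: left_diff_distrib form_simps)
      also have "\<dots> = 0" using z[of i] i unfolding sum_mult_delta by auto
      finally show "\<phi> (r * x i) = 0" .
    next
      fix y assume "y \<in> N 2"
      then show "\<phi> (r * y) = 0" using form_N_mult[OF rN] by simp
    qed
    moreover have "r = comb (\<lambda>j. if j = k then 1 else if j < k then - \<phi> (b k * x j) else 0) b n"
    proof -
      have "comb (\<lambda>j. if j = k then 1 else if j < k then - \<phi> (b k * x j) else 0) b n
        = comb (\<lambda>j. if j = k then 1 else if j < k then - \<phi> (b k * x j) else 0) b (Suc k)"
        using k by (intro sum.mono_neutral_right) auto
      also have "\<dots> = r"
        unfolding r_def by (simp add: sum_negf)
      finally show ?thesis by simp
    qed
    ultimately show False
      using basis_modD(3)[OF basis_b, of "\<lambda>j. if j = k then 1 else if j < k then - \<phi> (b k * x j) else 0" k] k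
      by simp
  qed
  then obtain i where i: "k \<le> i" "i < m" "\<phi> (b k * x i) \<noteq> 0" by blast
  \<comment> \<open>\<open>t\<close> is the pivot scaled to pair to 1 with \<open>b k\<close>,
    \<open>w\<close> puts \<open>x k\<close> into its former place, and \<open>y\<close> clears the
    pairing with \<open>b k\<close> everywhere else. The earlier duality relations survive because
    \<open>b j\<close> vanishes on \<open>t\<close> for j below k.\<close>
  define t where "t = sc (inverse (\<phi> (b k * x i))) (x i)"
  define w where "w l = (if l = i then x k else x l)" for l
  define y where "y l = (if l = k then t else w l - sc (\<phi> (b k * w l)) t)" for l
  have xN: "\<And>l. l < m \<Longrightarrow> x l \<in> N 1" using basis_modD(1)[OF x] .
  have km: "k < m" using i by simp
  have bt: "\<phi> (b j * t) = (if j = k then 1 else 0)" if "j \<le> k" for j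
    unfolding t_def using that i dual[of j i] by (auto simp: mult_sc form_simps)
  have dual': "\<phi> (b j * y l) = (if l = j then 1 else 0)" if "j < Suc k" "l < m" for j l
    using that i dual[of j k] dual[of j l] bt[of j]
    by (auto simp: y_def w_def right_diff_distrib mult_sc form_simps less_Suc_eq)
  have tN: "t \<in> N 1" unfolding t_def by (intro subspace_scale[OF N_subspace] xN i)
  have yN: "y l \<in> N 1" if "l < m" for l
    unfolding y_def w_def using that km
    by (auto intro!: subspace_diff[OF N_subspace] subspace_scale[OF N_subspace] tN xN)
  let ?S = "spanned_mod (N 2) y m"
  note S = subspace_spanned_mod[OF N_subspace, of 2 y m]
  have yS: "\<And>l. l < m \<Longrightarrow> y l \<in> ?S" by (rule spanned_mod_base[OF N_subspace])
  have tS: "t \<in> ?S" using yS[OF km] by (simp add: y_def)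
  have wS: "w l \<in> ?S" if "l < m" "l \<noteq> k" for l
    using subspace_add[OF S yS[OF that(1)] subspace_scale[OF S tS, of "\<phi> (b k * w l)"]] that
    by (simp add: y_def)
  have xiS: "x i \<in> ?S"
    using subspace_scale[OF S tS, of "\<phi> (b k * x i)"] i by (simp add: t_def)
  have "x l \<in> ?S" if "l < m" for l
    using wS[of l] wS[of i] xiS that i by (cases "l = i"; cases "l = k") (auto simp: w_def)
  then have "basis_mod (N 1) (N 2) y m"
    by (intro spanning_basis_mod[OF N_subspace x]) (blast intro: yN)+
  then show ?thesis using dual' by blast
qed

lemma exists_dual_basis:
  assumes x: "basis_mod (N 1) (N 2) x m"
  shows "k \<le> n \<Longrightarrow> \<exists>y. basis_mod (N 1) (N 2) y m \<and>
    (\<forall>j<k. \<forall>i<m. \<phi> (b j * y i) = (if i = j then 1 else 0))"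
proof (induction k)
  case 0
  then show ?case using x by auto
next
  case (Suc k)
  then show ?case using dual_basis_step[of _ k] by (metis Suc_le_eq less_imp_le)
qed

text \<open>Gram-Schmidt invariant. The second index runs up to m, not k: a vector already treated
  is orthogonal to the untreated ones as well. Pairings that involve the first n vectors are left
  free.\<close>

definition diagonal_to :: "nat \<Rightarrow> (nat \<Rightarrow> 'q) \<Rightarrow> bool" where
  "diagonal_to k x \<longleftrightarrow> basis_mod (N 1) (N 2) x m \<and>
     (\<forall>j<n. \<forall>i<m. \<phi> (b j * x i) = (if i = j then 1 else 0)) \<and>
     (\<forall>i j. n \<le> i \<longrightarrow> i < k \<longrightarrow> n \<le> j \<longrightarrow> j < m \<longrightarrow> \<phi> (x i * x j) = (if i = j then 2 else 0))"

text \<open>Duality kills the pairing with \<open>b\<close>, products with \<open>N 3\<close> lie in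
  \<open>N 4\<close>, and these two span \<open>N 2\<close>.\<close>

lemma form_N_2_mult:
  assumes x: "diagonal_to k x" and i: "n \<le> i" "i < m" and y: "y \<in> N 2"
  shows "\<phi> (x i * y) = 0"
proof -
  have "spanned_mod (N 3) b n \<subseteq> {q. \<phi> (x i * q) = 0}"
  proof (rule spanned_mod_subset[OF subspace_form_kernel[OF form]])
    show "N 3 \<subseteq> {q. \<phi> (x i * q) = 0}"
      using form_N_mult[of "x i" 1 _ 3] x i by (auto simp: diagonal_to_def basis_mod_def)
    show "b j \<in> {q. \<phi> (x i * q) = 0}" if "j < n" for j
      using x i that by (auto simp: diagonal_to_def mult.commute)
  qed
  then show ?thesis using y basis_modD(2)[OF basis_b] by blast
qed

text \<open>A vector orthogonal to all \<open>x j\<close> with \<open>n \<le> j\<close> could be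
  corrected by an element of \<open>N 2\<close> until it is orthogonal to \<open>N 1\<close>. It
  would then lie in \<open>N 2\<close> itself, against independence.\<close>

lemma diagonal_not_radical:
  assumes x: "diagonal_to k x" and i: "n \<le> i" "i < m"
  shows "\<exists>j. n \<le> j \<and> j < m \<and> \<phi> (x i * x j) \<noteq> 0"
proof (rule ccontr)
  assume "\<not> ?thesis"
  then have z: "\<And>j. n \<le> j \<Longrightarrow> j < m \<Longrightarrow> \<phi> (x i * x j) = 0" by blast
  have B: "basis_mod (N 1) (N 2) x m" using x by (simp add: diagonal_to_def)
  \<comment> \<open>By duality \<open>q\<close> has the same pairing as \<open>x i\<close> with
    every \<open>x l\<close>: for l below n by the choice of coefficients, for the others because
    both vanish.\<close>
  define q where "q = comb (\<lambda>j. \<phi> (x i * x j)) b n"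
  have q: "q \<in> N 2" unfolding q_def by (intro comb_mem[OF N_subspace] b_mem)
  have "x i - q \<in> N 3"
  proof (rule mem_N_3[OF B])
    fix l assume l: "l < m"
    have "\<phi> (q * x l) = (\<Sum>j<n. \<phi> (x i * x j) * (if l = j then 1 else 0))"
      unfolding q_def using x l by (simp add: form_simps diagonal_to_def)
    also have "\<dots> = \<phi> (x i * x l)" using z[of l] l unfolding sum_mult_delta by auto
    finally show "\<phi> ((x i - q) * x l) = 0" by (simp add: left_diff_distrib form_simps)
  next
    fix y assume y: "y \<in> N 2"
    then show "\<phi> ((x i - q) * y) = 0"
      using form_N_2_mult[OF x i y] form_N_mult[OF q y] by (simp add: left_diff_distrib form_simps)
  qed
  then have "x i - q \<in> N 2" using N_antimono[of 2 3] by auto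
  from subspace_add[OF N_subspace this q] have "x i \<in> N 2" by simp
  then have "comb (\<lambda>j. if j = i then 1 else 0) x m \<in> N 2"
    using comb_delta[OF i(2), of 1 x] by simp
  from basis_modD(3)[OF B this i(2)] show False by simp
qed

text \<open>A Gram-Schmidt step whose pivot has nonzero square; algebraic closure provides the
  square root that normalises the pivot. Vectors of index below k, among them those dual to
  \<open>b\<close>, are not touched.\<close>

lemma diagonal_step_square:
  assumes x: "diagonal_to k x" and k: "n \<le> k" and i: "k \<le> i" "i < m" and xi: "\<phi> (x i * x i) \<noteq> 0"
  shows "\<exists>y. diagonal_to (Suc k) y"
proof -
  note X = x[unfolded diagonal_to_def]
  have B: "basis_mod (N 1) (N 2) x m" using X by simp
  obtain r :: 'k where r: "r ^ 2 = 2 / \<phi> (x i * x i)"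
    using nth_root_exists[of 2 "2 / \<phi> (x i * x i)"] by auto
  have r0: "r \<noteq> 0" using r xi by auto
  define t where "t = sc r (x i)"
  define w where "w l = (if l = i then x k else x l)" for l
  \<comment> \<open>Later vectors are projected away from \<open>t\<close>; the denominator is the
    square of \<open>t\<close>, which is 2.\<close>
  define y where "y l = (if l = k then t else if l < k then x l else w l - sc (\<phi> (w l * t) / 2) t)" for l
  have xN: "\<And>l. l < m \<Longrightarrow> x l \<in> N 1" using basis_modD(1)[OF B] .
  have km: "k < m" using i by simp
  have tt: "\<phi> (t * t) = 2"
  proof -
    have "\<phi> (t * t) = r ^ 2 * \<phi> (x i * x i)"
      unfolding t_def by (simp add: mult_sc sc_mult form_simps power2_eq_square)
    then show ?thesis unfolding r using xi by simp
  qed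
  have bt: "\<phi> (b j * t) = 0" if "j < n" for j
    unfolding t_def using that i k X by (auto simp: mult_sc form_simps)
  have xt: "\<phi> (x j * t) = 0" if "n \<le> j" "j < k" for j
    unfolding t_def using that i k X by (auto simp: mult_sc form_simps)
  have bx: "\<phi> (b j * x l) = (if l = j then 1 else 0)" if "j < n" "l < m" for j l
    using X that by auto
  have xx: "\<phi> (x j * x l) = (if j = l then 2 else 0)" if "n \<le> j" "j < k" "n \<le> l" "l < m" for j l
    using X that by auto
  have bw: "\<phi> (b j * w l) = 0" if "j < n" "k < l" "l < m" for j l
    using bx[of j k] bx[of j l] that k km by (auto simp: w_def)
  have xw: "\<phi> (x j * w l) = 0" if "n \<le> j" "j < k" "k < l" "l < m" for j l
    using xx[of j k] xx[of j l] that k km by (auto simp: w_def)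
  have dual: "\<phi> (b j * y l) = (if l = j then 1 else 0)" if "j < n" "l < m" for j l
    using that bt[of j] bx[of j l] bw[of j l] k
    by (auto simp: y_def right_diff_distrib mult_sc form_simps)
  have diag: "\<phi> (y j * y l) = (if j = l then 2 else 0)" if "n \<le> j" "j < Suc k" "n \<le> l" "l < m" for j l
  proof (cases "j = k")
    case True
    show ?thesis
      using True that tt xt[of l]
      by (auto simp: y_def right_diff_distrib mult_sc form_simps mult.commute[of t "x l"] mult.commute[of t "w l"])
  next
    case False
    then show ?thesis
      using that xt[of j] xx[of j l] xw[of j l]
      by (auto simp: y_def right_diff_distrib mult_sc form_simps)
  qed
  have tN: "t \<in> N 1" unfolding t_def by (intro subspace_scale[OF N_subspace] xN i)
  have yN: "y l \<in> N 1" if "l < m" for l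
    unfolding y_def w_def using that km
    by (auto intro!: subspace_diff[OF N_subspace] subspace_scale[OF N_subspace] tN xN)
  let ?S = "spanned_mod (N 2) y m"
  note S = subspace_spanned_mod[OF N_subspace, of 2 y m]
  have yS: "\<And>l. l < m \<Longrightarrow> y l \<in> ?S" by (rule spanned_mod_base[OF N_subspace])
  have tS: "t \<in> ?S" using yS[OF km] by (simp add: y_def)
  have wS: "w l \<in> ?S" if "l < m" "k < l" for l
    using subspace_add[OF S yS[OF that(1)] subspace_scale[OF S tS, of "\<phi> (w l * t) / 2"]] that
    by (simp add: y_def)
  have xiS: "x i \<in> ?S"
    using subspace_scale[OF S tS, of "inverse r"] r0 by (simp add: t_def)
  have "x l \<in> ?S" if "l < m" for l
  proof (cases "l < k")
    case True
    then show ?thesis using yS[OF that] by (simp add: y_def)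
  next
    case False
    then show ?thesis
      using wS[of l] wS[of i] xiS that i by (cases "l = i"; cases "l = k") (auto simp: w_def)
  qed
  then have "basis_mod (N 1) (N 2) y m"
    by (intro spanning_basis_mod[OF N_subspace B]) (blast intro: yN)+
  then show ?thesis unfolding diagonal_to_def using dual diag by blast
qed

text \<open>If all remaining squares vanish, a nonzero pairing of x_k with some x_j makes the square
  of x_k + x_j twice that pairing, which is nonzero in characteristic zero.\<close>

lemma diagonal_step:
  assumes x: "diagonal_to k x" and k: "n \<le> k" "k < m"
  shows "\<exists>y. diagonal_to (Suc k) y"
proof (cases "\<exists>i. k \<le> i \<and> i < m \<and> \<phi> (x i * x i) \<noteq> 0")
  case True
  then show ?thesis using diagonal_step_square[OF x k(1)] by blast
next
  case False
  then have sq: "\<And>i. k \<le> i \<Longrightarrow> i < m \<Longrightarrow> \<phi> (x i * x i) = 0" by blast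
  note X = x[unfolded diagonal_to_def]
  have B: "basis_mod (N 1) (N 2) x m" using X by simp
  obtain j where j: "n \<le> j" "j < m" "\<phi> (x k * x j) \<noteq> 0"
    using diagonal_not_radical[OF x k] by blast
  \<comment> \<open>Vectors already diagonalised are orthogonal to \<open>x k\<close>, so its
    partner comes later, and adding the partner keeps the invariant.\<close>
  have kj: "k < j"
  proof (cases j k rule: linorder_cases)
    case less
    then have "\<phi> (x j * x k) = 0" using X j(1) k by force
    then show ?thesis using j(3) by (simp add: mult.commute)
  next
    case equal
    then show ?thesis using j sq[of k] k by simp
  qed
  define y where "y l = (if l = k then x k + x j else x l)" for l
  have xN: "\<And>l. l < m \<Longrightarrow> x l \<in> N 1" using basis_modD(1)[OF B] .
  have yN: "y l \<in> N 1" if "l < m" for l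
    unfolding y_def using that j k by (auto intro!: subspace_add[OF N_subspace] xN)
  let ?S = "spanned_mod (N 2) y m"
  note S = subspace_spanned_mod[OF N_subspace, of 2 y m]
  have yS: "\<And>l. l < m \<Longrightarrow> y l \<in> ?S" by (rule spanned_mod_base[OF N_subspace])
  have "x l \<in> ?S" if "l < m" for l
    using yS[OF that] subspace_diff[OF S yS[OF k(2)] yS[OF j(2)]] kj by (cases "l = k") (auto simp: y_def)
  then have "basis_mod (N 1) (N 2) y m"
    by (intro spanning_basis_mod[OF N_subspace B]) (blast intro: yN)+
  moreover have "\<phi> (b i * y l) = (if l = i then 1 else 0)" if "i < n" "l < m" for i l
  proof -
    have bx: "\<phi> (b i * x l) = (if l = i then 1 else 0)" if "l < m" for l
      using X that \<open>i < n\<close> by blast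
    show ?thesis
      using bx[of l] bx[of j] that k j by (auto simp: y_def distrib_left form_simps)
  qed
  moreover have "\<phi> (y i * y l) = (if i = l then 2 else 0)" if "n \<le> i" "i < k" "n \<le> l" "l < m" for i l
  proof -
    have xx: "\<phi> (x i * x l) = (if i = l then 2 else 0)" if "n \<le> l" "l < m" for l
      using X that \<open>n \<le> i\<close> \<open>i < k\<close> by blast
    show ?thesis
      using xx[of l] xx[of j] that k j kj by (auto simp: y_def distrib_left form_simps)
  qed
  ultimately have "diagonal_to k y"
    unfolding diagonal_to_def by blast
  moreover have "\<phi> (y k * y k) \<noteq> 0"
  proof -
    have "y k * y k = x k * x k + x j * x j + (x k * x j + x k * x j)"
      by (simp add: y_def algebra_simps)
    then have "\<phi> (y k * y k) = 2 * \<phi> (x k * x j)"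
      using sq[of k] sq[of j] j kj k by (simp only: form_simps) simp
    then show ?thesis using j by simp
  qed
  ultimately show ?thesis
    using diagonal_step_square[of k y k] k by blast
qed

lemma exists_diagonal:
  assumes x: "basis_mod (N 1) (N 2) x m"
  shows "n \<le> k \<Longrightarrow> k \<le> m \<Longrightarrow> \<exists>y. diagonal_to k y"
proof (induction k rule: dec_induct)
  case base
  then show ?case using exists_dual_basis[OF x, of n] by (auto simp: diagonal_to_def)
next
  case (step k)
  then show ?case using diagonal_step by auto
qed

end

lemma (in lin_space) basis_mod_singleton:
  assumes "s \<in> I" "\<And>p. p \<in> I \<Longrightarrow> \<exists>c. p - scale c s \<in> J" "\<And>c. scale c s \<in> J \<Longrightarrow> c = 0"
  shows "basis_mod I J (\<lambda>_. s) 1"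
proof -
  have "\<exists>c. p - comb c (\<lambda>_. s) 1 \<in> J" if p: "p \<in> I" for p
  proof -
    obtain c where "p - scale c s \<in> J" using assms(2)[OF p] by blast
    then show ?thesis by (intro exI[of _ "\<lambda>_. c"]) (simp add: One_nat_def)
  qed
  moreover have "c 0 = 0" if "comb c (\<lambda>_. s) 1 \<in> J" for c
    using that by (intro assms(3)) (simp add: One_nat_def)
  ultimately show ?thesis using assms(1) unfolding basis_mod_def by auto
qed

context dual_algebra
begin

text \<open>The orthogonal projection to the vectors of index at least n is subtracted from the
  first n; those vectors have square 2, whence the denominator. They pair to zero with
  \<open>b\<close>, so duality is kept.\<close>

lemma exists_split_basis:
  assumes x: "diagonal_to m x"
  shows "\<exists>y. diagonal_to m y \<and> (\<forall>i<n. \<forall>k<m. n \<le> k \<longrightarrow> \<phi> (y i * y k) = 0)"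
proof -
  note X = x[unfolded diagonal_to_def]
  have B: "basis_mod (N 1) (N 2) x m" using X by simp
  define u where "u i = comb (\<lambda>j. if n \<le> j then \<phi> (x i * x j) / 2 else 0) x m" for i
  define y where "y i = (if i < n then x i - u i else x i)" for i
  have xN: "\<And>l. l < m \<Longrightarrow> x l \<in> N 1" using basis_modD(1)[OF B] .
  have yN: "y l \<in> N 1" if "l < m" for l
    unfolding y_def u_def using that
    by (auto intro!: subspace_diff[OF N_subspace] comb_mem[OF N_subspace] xN)
  have bx: "\<phi> (b j * x i) = (if i = j then 1 else 0)" if "j < n" "i < m" for i j
    using X that by blast
  have xx: "\<phi> (x i * x j) = (if i = j then 2 else 0)" if "n \<le> i" "i < m" "n \<le> j" "j < m" for i j
    using X that by blast
  have bu: "\<phi> (b j * u i) = 0" if "j < n" for i j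
    unfolding u_def using that bx by (auto simp: form_simps intro!: sum.neutral)
  have ux: "\<phi> (u i * x k) = \<phi> (x i * x k)" if "n \<le> k" "k < m" for i k
  proof -
    have "\<phi> (u i * x k) = (\<Sum>j<m. if j = k then \<phi> (x i * x k) else 0)"
      unfolding u_def form_simps using that xx by (intro sum.cong) auto
    then show ?thesis using that by simp
  qed
  let ?S = "spanned_mod (N 2) y m"
  note S = subspace_spanned_mod[OF N_subspace, of 2 y m]
  have yS: "\<And>l. l < m \<Longrightarrow> y l \<in> ?S" by (rule spanned_mod_base[OF N_subspace])
  have uS: "u i \<in> ?S" for i
    unfolding u_def
  proof (rule subspace_sum[OF S])
    fix j assume "j \<in> {..<m}"
    then show "sc (if n \<le> j then \<phi> (x i * x j) / 2 else 0) (x j) \<in> ?S"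
      using yS[of j] subspace_scale[OF S] subspace_0[OF S] by (auto simp: y_def)
  qed
  have "x l \<in> ?S" if "l < m" for l
    using yS[OF that] subspace_add[OF S yS[OF that] uS[of l]] by (auto simp: y_def split: if_splits)
  then have "basis_mod (N 1) (N 2) y m"
    by (intro spanning_basis_mod[OF N_subspace B]) (blast intro: yN)+
  moreover have "\<phi> (b j * y i) = (if i = j then 1 else 0)" if "j < n" "i < m" for i j
    using that bx[of j i] bu[of j i] by (auto simp: y_def right_diff_distrib form_simps)
  moreover have "\<phi> (y i * y j) = (if i = j then 2 else 0)" if "n \<le> i" "i < m" "n \<le> j" "j < m" for i j
    using that xx[of i j] by (auto simp: y_def)
  moreover have "\<phi> (y i * y k) = 0" if "i < n" "n \<le> k" "k < m" for i k
    using that ux[of k i] by (simp add: y_def left_diff_distrib form_simps)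
  ultimately show ?thesis
    unfolding diagonal_to_def by blast
qed

text \<open>Elements of \<open>N 2\<close> pair perfectly with the first \<open>n\<close> basis elements, and products of two of
  them vanish, so adding such elements removes the quadratic part on these variables.\<close>

lemma exists_adapted_basis:
  assumes y: "diagonal_to m y" and split: "\<And>i k. i < n \<Longrightarrow> n \<le> k \<Longrightarrow> k < m \<Longrightarrow> \<phi> (y i * y k) = 0"
    and nm: "n \<le> m"
  shows "\<exists>z. diagonal_to m z \<and>
    (\<forall>i<m. \<forall>j<m. \<phi> (z i * z j) = (if i = j \<and> n \<le> i then 2 else 0))"
proof -
  note Y = y[unfolded diagonal_to_def]
  have B: "basis_mod (N 1) (N 2) y m" using Y by simp
  \<comment> \<open>The factor 1/2 is there because the correction enters the pairing of two such
    vectors twice, once from each side, while the product of two corrections lies in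
    \<open>N 4\<close>.\<close>
  define q where "q i = comb (\<lambda>j. \<phi> (y i * y j) / 2) b n" for i
  define z where "z i = (if i < n then y i - q i else y i)" for i
  have qN: "q i \<in> N 2" for i unfolding q_def by (intro comb_mem[OF N_subspace] b_mem)
  have qN1: "q i \<in> N 1" for i using qN N_antimono[of 1 2] by auto
  have yN: "\<And>l. l < m \<Longrightarrow> y l \<in> N 1" using basis_modD(1)[OF B] .
  have zN: "z l \<in> N 1" if "l < m" for l
    unfolding z_def using that by (auto intro!: subspace_diff[OF N_subspace] qN1 yN)
  have byd: "\<phi> (b j * y i) = (if i = j then 1 else 0)" if "j < n" "i < m" for i j
    using Y that by blast
  have yy: "\<phi> (y i * y j) = (if i = j then 2 else 0)" if "n \<le> i" "i < m" "n \<le> j" "j < m" for i j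
    using Y that by blast
  have bq: "\<phi> (b j * q i) = 0" if "j < n" for i j
    using form_N_mult[OF b_mem[OF that] qN] by simp
  have qq: "\<phi> (q i * q j) = 0" for i j
    using form_N_mult[OF qN qN] by simp
  have qy: "\<phi> (q i * y k) = (if k < n then \<phi> (y i * y k) / 2 else 0)" if "k < m" for i k
  proof -
    have "\<phi> (q i * y k) = (\<Sum>j<n. (\<phi> (y i * y j) / 2) * (if k = j then 1 else 0))"
      unfolding q_def form_simps using that byd by (intro sum.cong) auto
    then show ?thesis unfolding sum_mult_delta .
  qed
  have yq: "\<phi> (y k * q i) = (if k < n then \<phi> (y i * y k) / 2 else 0)" if "k < m" for i k
    using qy[OF that] by (simp add: mult.commute)
  have yc: "\<phi> (y i * y k) = \<phi> (y k * y i)" for i k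
    by (simp add: mult.commute)
  let ?S = "spanned_mod (N 2) z m"
  note S = subspace_spanned_mod[OF N_subspace, of 2 z m]
  have zS: "\<And>l. l < m \<Longrightarrow> z l \<in> ?S" by (rule spanned_mod_base[OF N_subspace])
  have qS: "q i \<in> ?S" for i using qN spanned_mod_superset by blast
  have "y l \<in> ?S" if "l < m" for l
    using zS[OF that] subspace_add[OF S zS[OF that] qS[of l]] by (auto simp: z_def split: if_splits)
  then have "basis_mod (N 1) (N 2) z m"
    by (intro spanning_basis_mod[OF N_subspace B]) (blast intro: zN)+
  moreover have "\<phi> (b j * z i) = (if i = j then 1 else 0)" if "j < n" "i < m" for i j
    using that byd[of j i] bq[of j i] by (auto simp: z_def right_diff_distrib form_simps)
  moreover have zz: "\<phi> (z i * z j) = (if i = j \<and> n \<le> i then 2 else 0)" if ij: "i < m" "j < m" for i j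
  proof (cases "i < n"; cases "j < n")
    assume "i < n" "j < n"
    then have h: "\<phi> (q i * y j) + \<phi> (y i * q j) = \<phi> (y i * y j)"
      unfolding qy[OF ij(2)] yq[OF ij(1)] yc[of j i] by simp
    have "\<phi> (z i * z j) = \<phi> (y i * y j) - (\<phi> (q i * y j) + \<phi> (y i * q j))"
      using \<open>i < n\<close> \<open>j < n\<close> qq[of i j]
      by (simp add: z_def left_diff_distrib right_diff_distrib form_simps)
    then show ?thesis using h \<open>i < n\<close> by simp
  next
    assume "i < n" "\<not> j < n"
    then show ?thesis
      using ij qy[of j i] split[of i j]
      by (simp add: z_def left_diff_distrib right_diff_distrib form_simps)
  next
    assume "\<not> i < n" "j < n"
    then show ?thesis
      using ij yq[of i j] split[of j i] yc[of i j]
      by (simp add: z_def left_diff_distrib right_diff_distrib form_simps)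
  next
    assume "\<not> i < n" "\<not> j < n"
    then show ?thesis using ij yy[of i j] by (simp add: z_def)
  qed
  moreover have "\<phi> (z i * z j) = (if i = j then 2 else 0)" if "n \<le> i" "i < m" "n \<le> j" "j < m" for i j
    using zz[OF that(2,4)] that by simp
  ultimately show ?thesis
    unfolding diagonal_to_def by (intro exI[of _ z]) blast
qed

text \<open>The pairings of generators with each other and with \<open>b\<close> only involve values
  on \<open>N 2\<close>, so the form may be changed by one that vanishes there. The change removes
  the constant and the linear terms of F.\<close>

lemma exists_normal_form:
  assumes x: "basis_mod (N 1) (N 2) x m" and nm: "n \<le> m"
    and one: "UNIV \<subseteq> spanned_mod (N 1) (\<lambda>_. 1) 1" "1 \<notin> N 1"
  shows "\<exists>x b \<psi>. normal_form m n x b \<psi>"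
proof -
  obtain w where w: "diagonal_to m w"
    using exists_diagonal[OF x nm] by auto
  obtain y where y: "diagonal_to m y" "\<forall>i<n. \<forall>k<m. n \<le> k \<longrightarrow> \<phi> (y i * y k) = 0"
    using exists_split_basis[OF w] by auto
  have "\<exists>z. diagonal_to m z \<and> (\<forall>i<m. \<forall>j<m. \<phi> (z i * z j) = (if i = j \<and> n \<le> i then 2 else 0))"
    by (rule exists_adapted_basis[OF y(1) _ nm]) (use y(2) in blast)
  then obtain z where z: "diagonal_to m z"
    "\<forall>i<m. \<forall>j<m. \<phi> (z i * z j) = (if i = j \<and> n \<le> i then 2 else 0)"
    by blast
  have B: "basis_mod (N 1) (N 2) z m" using z by (simp add: diagonal_to_def)
  have zN: "\<And>l. l < m \<Longrightarrow> z l \<in> N 1" using basis_modD(1)[OF B] .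
  \<comment> \<open>The element 1 and the generators as one family, with 1 at index 0; it is
    independent modulo \<open>N 2\<close>, so the values of \<open>\<chi>\<close> on it can be
    prescribed.\<close>
  define f where "f i = (case i of 0 \<Rightarrow> 1 | Suc i \<Rightarrow> z i)" for i
  have f: "comb c f (Suc m) = sc (c 0) 1 + comb (\<lambda>i. c (Suc i)) z m" for c
    by (simp add: sum.lessThan_Suc_shift f_def del: sum.lessThan_Suc)
  have ind: "c i = 0" if c: "comb c f (Suc m) \<in> N 2" and i: "i < Suc m" for c i
  proof -
    have "comb (\<lambda>i. c (Suc i)) z m \<in> N 1" by (rule comb_mem[OF N_subspace]) (rule zN)
    moreover have "comb c f (Suc m) \<in> N 1" using c N_antimono[of 1 2] by auto
    ultimately have "sc (c 0) 1 \<in> N 1"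
      using subspace_diff[OF N_subspace] unfolding f by fastforce
    then have "sc (inverse (c 0)) (sc (c 0) 1) \<in> N 1"
      by (rule subspace_scale[OF N_subspace])
    then have c0: "c 0 = 0" using one(2) by (cases "c 0 = 0") auto
    then have "comb (\<lambda>i. c (Suc i)) z m \<in> N 2" using c unfolding f by simp
    then show ?thesis using basis_modD(3)[OF B, of "\<lambda>i. c (Suc i)"] c0 i by (cases i) auto
  qed
  have "\<exists>\<chi>. linear_form \<chi> \<and> (\<forall>p\<in>N 2. \<chi> p = 0) \<and> (\<forall>i<Suc m. \<chi> (f i) = \<phi> (f i))"
    by (rule exists_linear_form_values[OF N_subspace]) (rule ind)
  then obtain \<chi> where \<chi>: "linear_form \<chi>" "\<And>p. p \<in> N 2 \<Longrightarrow> \<chi> p = 0" "\<And>i. i < Suc m \<Longrightarrow> \<chi> (f i) = \<phi> (f i)"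
    by blast
  define \<psi> where "\<psi> p = \<phi> p - \<chi> p" for p
  have \<psi>: "linear_form \<psi>"
    using linear_form_lincomb[OF form \<chi>(1), of 1 "-1"] unfolding \<psi>_def by simp
  have \<psi>2: "\<psi> p = \<phi> p" if "p \<in> N 2" for p using \<chi>(2)[OF that] by (simp add: \<psi>_def)
  \<comment> \<open>Old and new form are only known to agree on \<open>N 2\<close>, so nondegeneracy
    is regained in stages: products of \<open>p\<close> with two elements of \<open>N 1\<close> lie
    in \<open>N 2\<close>, hence in \<open>Z\<close>; this puts products with one element into
    \<open>N 3\<close>, hence into \<open>Z\<close>; then \<open>p\<close> itself is in
    \<open>N 3\<close>.\<close>
  have nondeg': "p \<in> Z" if p: "\<And>q. \<psi> (p * q) = 0" for p
  proof -
    have 2: "r \<in> Z" if "r \<in> N 2" "\<And>q. \<psi> (r * q) = 0" for r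
    proof (rule nondeg)
      fix q
      have "r * q \<in> N 2" using N_ideal[OF that(1), of q] by (simp add: mult.commute)
      then show "\<phi> (r * q) = 0" using \<psi>2 that(2) by metis
    qed
    have sub: "\<psi> (p * x * q) = 0" for x q using p[of "x * q"] by (simp add: mult.assoc)
    have p3: "p * x \<in> N 3" if x: "x \<in> N 1" for x
    proof (rule socle)
      fix x' assume "x' \<in> N 1"
      then have "x * x' \<in> N 2" using N_mult[OF x, of x' 1] by (simp add: numeral_2_eq_2 One_nat_def)
      then have "p * (x * x') \<in> N 2" by (rule N_ideal)
      moreover have "\<psi> (p * (x * x') * q) = 0" for q by (rule sub)
      ultimately have "p * (x * x') \<in> Z" by (rule 2)
      then show "p * x * x' \<in> Z" by (simp add: mult.assoc)
    qed
    have "p \<in> N 3"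
    proof (rule socle)
      fix x assume "x \<in> N 1"
      then have "p * x \<in> N 2" using p3 N_antimono[of 2 3] by auto
      then show "p * x \<in> Z" using sub by (rule 2)
    qed
    then show ?thesis using 2[of p] p N_antimono[of 2 3] by auto
  qed
  have bz: "\<phi> (b j * z i) = (if i = j then 1 else 0)" if "j < n" "i < m" for i j
    using z(1)[unfolded diagonal_to_def] that by blast
  have zz: "z i * z j \<in> N 2" if "i < m" "j < m" for i j
    using N_mult[OF zN[OF that(1)] zN[OF that(2)]] by (simp add: numeral_2_eq_2 One_nat_def)
  have N2: "p * q \<in> N 2" if "p \<in> N 2" for p q
    using N_ideal[OF that, of q] by (simp add: mult.commute)
  have zzz: "\<psi> (z i * z j * z k) = 0" if "i < m" "j < m" "k < m" "n \<le> k" for i j k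
    using form_N_2_mult[OF z(1) that(4,3) zz[OF that(1,2)]] \<psi>2[OF N2[OF zz[OF that(1,2)], of "z k"]]
    by (simp add: mult.commute)
  have "normal_form m n z b \<psi>"
    unfolding normal_form_def
  proof (intro conjI)
    show \<psi>Z: "\<forall>p\<in>Z. \<psi> p = 0"
    proof
      fix p assume p: "p \<in> Z"
      then have "p \<in> N 2" using Z_subset by blast
      then show "\<psi> p = 0" using \<psi>2 form_Z[OF p] by simp
    qed
    show "\<forall>p\<in>N 4. \<psi> p = 0" using \<psi>Z N_4 by blast
    show "linear_form \<psi>" by (rule \<psi>)
    show "\<forall>p. (\<forall>q. \<psi> (p * q) = 0) \<longrightarrow> p \<in> Z" using nondeg' by blast
    show "UNIV \<subseteq> spanned_mod (N 1) (\<lambda>_. 1) 1" by (rule one(1))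
    show "\<forall>i<m. z i \<in> N 1" "\<forall>j<n. b j \<in> N 2" using zN b_mem by blast+
    show "N 1 \<subseteq> spanned_mod (N 2) z m" by (rule basis_modD(2)[OF B])
    show "\<psi> 1 = 0" using \<chi>(3)[of 0] by (simp add: \<psi>_def f_def)
    show "\<forall>i<m. \<psi> (z i) = 0"
    proof (intro allI impI)
      fix i assume "i < m"
      then show "\<psi> (z i) = 0" using \<chi>(3)[of "Suc i"] by (simp add: \<psi>_def f_def)
    qed
    show "\<forall>i<m. \<forall>j<m. \<psi> (z i * z j) = (if i = j \<and> n \<le> i then 2 else 0)"
      using z(2) \<psi>2[OF zz] by simp
    show "\<forall>j<n. \<forall>k<m. \<psi> (b j * z k) = (if j = k then 1 else 0)"
      using bz \<psi>2[OF N2[OF b_mem]] by auto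
    show "\<forall>i<m. \<forall>j<m. \<forall>k<m. n \<le> k \<longrightarrow> \<psi> (z i * z j * z k) = 0"
      using zzz by blast
  qed
  then show ?thesis by blast
qed

end

section \<open>Normal forms and the Hilbert function\<close>

context filtered_algebra
begin

text \<open>For the filtration that comes from a local algebra, this is the preimage of the
  socle.\<close>

definition annihilator :: "'q set" where
  "annihilator = {p. \<forall>x\<in>N 1. p * x \<in> Z}"

end

locale ac_filtered_algebra = filtered_algebra sc Z N
  for sc :: "'k::{alg_closed_field, field_char_0} \<Rightarrow> 'q::comm_ring_1 \<Rightarrow> 'q" and Z N
begin

text \<open>M^3 is a nonzero subspace of the one-dimensional socle, hence equal to it. A linear form
  with value 1 at a generator of M^3 is therefore nondegenerate, which brings the diagonalisation
  into play.\<close>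

lemma basis_imp_normal_form:
  assumes nm: "n \<le> m" and N4: "N 4 \<subseteq> Z"
    and b0: "basis_mod (N 0) (N 1) b0 1" and b1: "basis_mod (N 1) (N 2) b1 m"
    and b2: "basis_mod (N 2) (N 3) b2 n" and b3: "basis_mod (N 3) (N 4) b3 1"
    and t: "basis_mod annihilator Z t 1"
  shows "\<exists>x b \<psi>. normal_form m n x b \<psi>"
proof -
  have N4Z: "N 4 = Z" using N4 Z_subset by blast
  have one1: "1 \<notin> N 1"
  proof
    assume "1 \<in> N 1"
    then have "q \<in> N 1" for q using N_ideal[of 1 1 q] by simp
    then have "N 1 = UNIV" by blast
    then show False using basis_modD(3)[OF b0, of "\<lambda>_. 1" 0] by simp
  qed
  have one: "UNIV \<subseteq> spanned_mod (N 1) (\<lambda>_. 1) 1"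
  proof
    have b0s: "UNIV \<subseteq> spanned_mod (N 1) b0 1"
      using basis_modD(2)[OF b0] by (simp add: N_0)
    \<comment> \<open>The given basis vector of the residue field need not be 1, but 1 is a nonzero
      multiple of it modulo \<open>N 1\<close> and so spans as well.\<close>
    obtain e where e: "1 - sc e (b0 0) \<in> N 1"
      using subsetD[OF b0s, of 1] by (auto simp: spanned_mod_def One_nat_def)
    have e0: "e \<noteq> 0" using e one1 by auto
    fix p :: 'q
    obtain c where c: "p - sc c (b0 0) \<in> N 1"
      using subsetD[OF b0s, of p] by (auto simp: spanned_mod_def One_nat_def)
    have "(p - sc c (b0 0)) - sc (c / e) (1 - sc e (b0 0)) \<in> N 1"
      by (intro subspace_diff[OF N_subspace] subspace_scale[OF N_subspace] c e)
    then have "p - sc (c / e) 1 \<in> N 1"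
      using e0 by (simp add: scale_right_diff_distrib)
    then show "p \<in> spanned_mod (N 1) (\<lambda>_. 1) 1"
      by (auto simp: spanned_mod_def One_nat_def intro!: exI[of _ "\<lambda>_. c / e"])
  qed
  define s where "s = b3 0"
  have sN: "s \<in> N 3" using basis_modD(1)[OF b3] by (simp add: s_def)
  have sZ: "s \<notin> Z"
    using basis_modD(3)[OF b3, of "\<lambda>_. 1" 0] N4Z by (auto simp: s_def One_nat_def)
  have N3s: "\<exists>c. p - sc c s \<in> Z" if "p \<in> N 3" for p
    using that basis_modD(2)[OF b3] N4Z by (auto simp: spanned_mod_def s_def One_nat_def)
  have soct: "\<exists>c. p - sc c (t 0) \<in> Z" if "p \<in> annihilator" for p
    using that basis_modD(2)[OF t] by (auto simp: spanned_mod_def One_nat_def)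
  have N3soc: "N 3 \<subseteq> annihilator"
  proof
    fix p assume p: "p \<in> N 3"
    have "p * x \<in> Z" if "x \<in> N 1" for x
      using N_mult[OF p that] N4 by auto
    then show "p \<in> annihilator" by (simp add: annihilator_def)
  qed
  obtain d where d: "s - sc d (t 0) \<in> Z" using soct sN N3soc by blast
  have d0: "d \<noteq> 0" using d sZ by auto
  have soc3: "p \<in> N 3" if p: "p \<in> annihilator" for p
  proof -
    obtain c where c: "p - sc c (t 0) \<in> Z" using soct[OF p] by blast
    have "(p - sc c (t 0)) - sc (c / d) (s - sc d (t 0)) \<in> Z"
      by (intro subspace_diff[OF Z_subspace] subspace_scale[OF Z_subspace] c d)
    then have "p - sc (c / d) s \<in> Z"
      using d0 by (simp add: scale_right_diff_distrib)
    then have "p - sc (c / d) s \<in> N 3" using Z_subset by blast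
    from subspace_add[OF N_subspace this subspace_scale[OF N_subspace sN, of "c / d"]] show ?thesis
      by simp
  qed
  obtain \<phi> where \<phi>: "linear_form \<phi>" "\<And>p. p \<in> Z \<Longrightarrow> \<phi> p = 0" "\<phi> s = 1"
    using exists_linear_form[OF Z_subspace sZ] by blast
  \<comment> \<open>Descending induction along the filtration: k = 0 is \<open>N 4\<close>, k = 4 is
    the whole ring. Once the products with \<open>N 1\<close> are in \<open>Z\<close>,
    \<open>p\<close> is a multiple of \<open>s\<close> modulo \<open>Z\<close>, and the form reads
    off its coefficient.\<close>
  have nondeg: "p \<in> N (4 - k) \<Longrightarrow> (\<And>q. \<phi> (p * q) = 0) \<Longrightarrow> k \<le> 4 \<Longrightarrow> p \<in> Z" for k p
  proof (induction k arbitrary: p)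
    case 0
    then show ?case using N4 by auto
  next
    case (Suc k)
    have "p * x \<in> Z" if x: "x \<in> N 1" for x
    proof (rule Suc.IH)
      show "p * x \<in> N (4 - k)"
      proof -
        have "Suc (4 - Suc k) = 4 - k" using Suc.prems(3) by simp
        then show ?thesis using N_Suc[OF Suc.prems(1) x] by metis
      qed
      show "\<phi> (p * x * q) = 0" for q
        using Suc.prems(2)[of "x * q"] by (simp add: mult.assoc)
    qed (use Suc.prems in simp)
    then have "p \<in> N 3" using soc3 by (simp add: annihilator_def)
    then obtain c where c: "p - sc c s \<in> Z" using N3s by blast
    have "c = 0"
      using \<phi>(2)[OF c] Suc.prems(2)[of 1] \<phi>(3) by (simp add: linear_form_simps[OF \<phi>(1)])
    then show ?case using c by simp
  qed
  interpret dual_algebra sc Z N \<phi> b2 m n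
  proof
    show "p \<in> Z" if "\<And>q. \<phi> (p * q) = 0" for p
      by (rule nondeg[of p 4]) (use that in \<open>simp_all add: N_0\<close>)
    show "p \<in> N 3" if "\<And>x. x \<in> N 1 \<Longrightarrow> p * x \<in> Z" for p
      using soc3 that unfolding annihilator_def by blast
  qed (fact \<phi>(1) \<phi>(2) N4 b2)+
  show ?thesis
    by (rule exists_normal_form[OF b1 nm one one1])
qed

text \<open>Orthogonality gives the independence: \<open>b\<close> and the generators of index at
  least n are test vectors for the generators, and the first n generators are test vectors for
  \<open>b\<close>. The product \<open>b 0 * x 0\<close>, where the form is 1, generates the
  socle.\<close>

lemma normal_form_imp_basis:
  assumes nf: "normal_form m n x b \<phi>" and n: "1 \<le> n" "n < m"
  shows "basis_mod (N 0) (N 1) (\<lambda>_. 1) 1" "basis_mod (N 1) (N 2) x m"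
    "basis_mod (N 2) (N 3) b n" "basis_mod (N 3) (N 4) (\<lambda>_. b 0 * x 0) 1"
    "N (4 + i) = Z" "basis_mod annihilator Z (\<lambda>_. b 0 * x 0) 1"
proof -
  have form: "linear_form \<phi>" and form_Z: "\<And>p. p \<in> Z \<Longrightarrow> \<phi> p = 0"
    and nondeg: "\<And>p. (\<And>q. \<phi> (p * q) = 0) \<Longrightarrow> p \<in> Z" and \<phi>4: "\<And>p. p \<in> N 4 \<Longrightarrow> \<phi> p = 0"
    and one: "UNIV \<subseteq> spanned_mod (N 1) (\<lambda>_. 1) 1"
    and xN: "\<And>i. i < m \<Longrightarrow> x i \<in> N 1" and x_span: "N 1 \<subseteq> spanned_mod (N 2) x m"
    and bN: "\<And>j. j < n \<Longrightarrow> b j \<in> N 2"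
    and xx: "\<And>i j. i < m \<Longrightarrow> j < m \<Longrightarrow> \<phi> (x i * x j) = (if i = j \<and> n \<le> i then 2 else 0)"
    and xxx: "\<And>i j k. i < m \<Longrightarrow> j < m \<Longrightarrow> k < m \<Longrightarrow> n \<le> k \<Longrightarrow> \<phi> (x i * x j * x k) = 0"
    and bx: "\<And>j k. j < n \<Longrightarrow> k < m \<Longrightarrow> \<phi> (b j * x k) = (if j = k then 1 else 0)"
    using nf unfolding normal_form_def by simp_all
  note form_simps = linear_form_simps[OF form] form_comb[OF form] form_comb'[OF form]
  define s where "s = b 0 * x 0"
  have s1: "\<phi> s = 1" using bx[of 0 0] n by (simp add: s_def)
  have mem4: "\<phi> (p * q) = 0" if "p \<in> N i" "q \<in> N j" "4 \<le> i + j" for p q i j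
    using N_mult[OF that(1,2)] N_antimono[OF that(3)] \<phi>4 by blast
  \<comment> \<open>\<open>N 4\<close> is an ideal on which the form vanishes, so nondegeneracy puts
    it into \<open>Z\<close>.\<close>
  have N4: "N 4 = Z"
    using nondeg \<phi>4 N_ideal[of _ 4] Z_subset[of 4] by (metis mult.commute subsetI subset_antisym)
  show N4i: "N (4 + i) = Z" for i
    using N_antimono[of 4 "4 + i"] Z_subset[of "4 + i"] N4 by auto
  have one1: "1 \<notin> N 1"
  proof
    assume 1: "1 \<in> N 1"
    have "N i = UNIV" for i
    proof (induction i)
      case (Suc i)
      then show ?case using N_Suc[of _ i 1] 1 by fastforce
    qed (simp add: N_0)
    then show False using \<phi>4[of s] s1 by simp
  qed
  have scal: "c = 0" if "sc c 1 \<in> N 1" for c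
  proof (rule ccontr)
    assume "c \<noteq> 0"
    then show False
      using subspace_scale[OF N_subspace that, of "inverse c"] one1 by simp
  qed
  show "basis_mod (N 0) (N 1) (\<lambda>_. 1) 1"
    using one scal by (auto simp: basis_mod_def spanned_mod_def N_0 One_nat_def)
  have bN2: "\<phi> (b j * y) = 0" if "j < n" "y \<in> N 2" for j y
    using mem4[OF bN[OF that(1)] that(2)] by simp
  \<comment> \<open>\<open>N 2\<close> is generated by products of two elements of
    \<open>N 1\<close>. Each factor is a combination of generators up to \<open>N 2\<close>; after
    multiplication by \<open>x k\<close> the errors lie in \<open>N 4\<close>, and the triple
    products with \<open>x k\<close> vanish under the form.\<close>
  have zN2: "\<phi> (x k * y) = 0" if k: "n \<le> k" "k < m" and y: "y \<in> N 2" for k y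
  proof -
    have "N (Suc 1) \<subseteq> {y. \<phi> (x k * y) = 0}"
    proof (rule N_least[OF subspace_form_kernel[OF form]])
      show "Z \<subseteq> {y. \<phi> (x k * y) = 0}" using form_Z Z_ideal by blast
      fix p q assume p: "p \<in> N 1" and q: "q \<in> N 1"
      have "spanned_mod (N 2) x m \<subseteq> {q. \<phi> (x k * x i * q) = 0}" if i: "i < m" for i
      proof (rule spanned_mod_subset[OF subspace_form_kernel[OF form]])
        show "N 2 \<subseteq> {q. \<phi> (x k * x i * q) = 0}"
          using mem4[OF N_mult[OF xN[OF k(2)] xN[OF i]], of _ 2] by auto
        show "x j \<in> {q. \<phi> (x k * x i * q) = 0}" if "j < m" for j
          using xxx[OF i that k(2,1)] by (simp add: ac_simps)
      qed
      then have 1: "\<phi> (x k * q * x i) = 0" if "i < m" for i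
        using q x_span that by (auto simp: ac_simps)
      have "spanned_mod (N 2) x m \<subseteq> {p. \<phi> (x k * q * p) = 0}"
        by (rule spanned_mod_subset[OF subspace_form_kernel[OF form]])
          (use 1 mem4[OF N_mult[OF xN[OF k(2)] q], of _ 2] in auto)
      then show "p * q \<in> {y. \<phi> (x k * y) = 0}"
        using p x_span by (auto simp: ac_simps)
    qed
    then show ?thesis using y by (auto simp: numeral_2_eq_2 One_nat_def)
  qed
  have ind1: "c i = 0" if c: "comb c x m \<in> N 2" and i: "i < m" for c i
  proof (cases "i < n")
    case True
    have "\<phi> (b i * comb c x m) = (\<Sum>k<m. c k * (if i = k then 1 else 0))"
      unfolding form_simps using bx[OF True] by (intro sum.cong) auto
    then show ?thesis using bN2[OF True c] i unfolding sum_mult_delta by simp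
  next
    case False
    have "\<phi> (x i * comb c x m) = (\<Sum>k<m. (2 * c k) * (if i = k then 1 else 0))"
      unfolding form_simps using xx[OF i] False by (intro sum.cong) auto
    then show ?thesis using zN2[OF _ i c] False i unfolding sum_mult_delta by simp
  qed
  show "basis_mod (N 1) (N 2) x m"
    using xN x_span ind1 unfolding basis_mod_def spanned_mod_def by blast
  have ann: "p \<in> annihilator" if "\<And>y. y \<in> N 1 \<Longrightarrow> \<phi> (p * y) = 0" for p
    unfolding annihilator_def
  proof (intro CollectI ballI nondeg)
    fix y q assume "y \<in> N 1"
    then have "\<phi> (p * (q * y)) = 0" using that N_ideal by blast
    then show "\<phi> (p * y * q) = 0" by (simp add: ac_simps)
  qed
  \<comment> \<open>Modulo \<open>N 1\<close> every \<open>q\<close> is a scalar, and the difference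
    is killed by \<open>p\<close> up to \<open>Z\<close>; the pairing with \<open>q\<close> is thus
    a multiple of the value at \<open>p\<close>.\<close>
  have annZ: "p \<in> Z" if p: "p \<in> annihilator" and p0: "\<phi> p = 0" for p
  proof (rule nondeg)
    fix q :: 'q
    obtain c where c: "q - sc c 1 \<in> N 1"
      using one by (auto simp: spanned_mod_def One_nat_def)
    have "p * (q - sc c 1) \<in> Z" using p c by (auto simp: annihilator_def)
    then have "\<phi> (p * (q - sc c 1)) = 0" by (rule form_Z)
    then show "\<phi> (p * q) = 0" using p0 by (simp add: right_diff_distrib mult_sc form_simps)
  qed
  have sN: "s \<in> N 3"
    unfolding s_def using N_mult[OF bN[of 0] xN[of 0]] n by (simp add: numeral_3_eq_3 numeral_2_eq_2 One_nat_def)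
  have N3ann: "N 3 \<subseteq> annihilator"
    using mem4[of _ 3 _ 1] ann by auto
  have annsub: "subspace annihilator"
    unfolding annihilator_def
    by (rule subspaceI) (auto simp: distrib_right sc_mult subspace_0 subspace_add subspace_scale Z_subspace)
  have anns: "p - sc (\<phi> p) s \<in> Z" if "p \<in> annihilator" for p
    using annZ[of "p - sc (\<phi> p) s"] that sN N3ann s1
      subspace_diff[OF annsub that subspace_scale[OF annsub, of s "\<phi> p"]]
    by (auto simp: form_simps)
  have sZ: "c = 0" if "sc c s \<in> Z" for c
    using form_Z[OF that] s1 by (simp add: form_simps)
  show b_ann: "basis_mod annihilator Z (\<lambda>_. b 0 * x 0) 1"
    unfolding s_def[symmetric] by (rule basis_mod_singleton) (use sN N3ann anns sZ in blast)+
  show "basis_mod (N 3) (N 4) (\<lambda>_. b 0 * x 0) 1"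
    unfolding s_def[symmetric] by (rule basis_mod_singleton) (use sN N3ann anns sZ N4 in blast)+
  have ann3: "annihilator \<subseteq> N 3"
  proof
    fix p assume "p \<in> annihilator"
    from anns[OF this] have "p - sc (\<phi> p) s \<in> N 3" using Z_subset by blast
    from subspace_add[OF N_subspace this subspace_scale[OF N_subspace sN, of "\<phi> p"]] show "p \<in> N 3" by simp
  qed
  show "basis_mod (N 2) (N 3) b n"
    unfolding basis_mod_def
  proof (intro conjI allI impI ballI)
    fix p assume p: "p \<in> N 2"
    \<comment> \<open>Duality forces the coefficients. What remains is orthogonal to all generators,
      hence in the socle, which is \<open>N 3\<close>.\<close>
    define r where "r = p - comb (\<lambda>j. \<phi> (p * x j)) b n"
    have rN: "r \<in> N 2" unfolding r_def by (intro subspace_diff[OF N_subspace] p comb_mem[OF N_subspace] bN)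
    have rx: "\<phi> (r * x k) = 0" if k: "k < m" for k
    proof -
      have "\<phi> (r * x k) = \<phi> (p * x k) - (\<Sum>j<n. \<phi> (p * x j) * (if k = j then 1 else 0))"
        unfolding r_def using bx[OF _ k] by (simp add: left_diff_distrib form_simps eq_commute[of k])
      also have "\<dots> = 0"
        using zN2[OF _ k p] k unfolding sum_mult_delta by (auto simp: mult.commute)
      finally show ?thesis .
    qed
    have "spanned_mod (N 2) x m \<subseteq> {q. \<phi> (r * q) = 0}"
      by (rule spanned_mod_subset[OF subspace_form_kernel[OF form]]) (use rx mem4[OF rN, of _ 2] in auto)
    then have "r \<in> annihilator" using ann x_span by blast
    then show "\<exists>c. p - comb c b n \<in> N 3" 
      unfolding r_def using ann3 by (intro exI[of _ "\<lambda>j. \<phi> (p * x j)"]) blast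
  next
    fix c i assume c: "comb c b n \<in> N 3" and i: "i < n"
    have "\<phi> (comb c b n * x i) = (\<Sum>j<n. c j * (if i = j then 1 else 0))"
      unfolding form_simps using bx i n by (intro sum.cong) auto
    moreover have "\<phi> (comb c b n * x i) = 0"
      using mem4[OF c xN[of i]] i n by simp
    ultimately show "c i = 0" using i unfolding sum_mult_delta by simp
  qed (rule bN)
qed

end

section \<open>Power series and the contraction action\<close>

definition mono_fact :: "mono \<Rightarrow> 'k::field_char_0" where
  "mono_fact e = (\<Prod>i\<in>Poly_Mapping.keys e. fact (Poly_Mapping.lookup e i))"

text \<open>Partial derivatives shift the numbers \<open>e! p\<^sub>e\<close> without introducing factors.\<close>

definition divided_coeff :: "'k::field_char_0 mpoly \<Rightarrow> mono \<Rightarrow> 'k" where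
  "divided_coeff p e = mono_fact e * Poly_Mapping.lookup p e"

lemma mono_fact_nonzero: "mono_fact e \<noteq> 0"
  by (simp add: mono_fact_def)

lemma mono_fact_superset:
  "finite S \<Longrightarrow> Poly_Mapping.keys e \<subseteq> S \<Longrightarrow> mono_fact e = (\<Prod>i\<in>S. fact (Poly_Mapping.lookup e i))"
  unfolding mono_fact_def by (rule prod.mono_neutral_left) (auto simp: in_keys_iff)

lemma mono_fact_plus_single:
  "mono_fact (e + Poly_Mapping.single i 1) = of_nat (Poly_Mapping.lookup e i + 1) * mono_fact e"
proof -
  let ?S = "insert i (Poly_Mapping.keys e)"
  have k: "Poly_Mapping.keys (e + Poly_Mapping.single i 1) \<subseteq> ?S"
    using keys_add[of e "Poly_Mapping.single i 1"] by (auto split: if_splits)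
  have "mono_fact (e + Poly_Mapping.single i 1)
      = (\<Prod>j\<in>?S. fact (Poly_Mapping.lookup (e + Poly_Mapping.single i 1) j) :: 'a)"
    by (rule mono_fact_superset) (use k in auto)
  also have "\<dots> = fact (Poly_Mapping.lookup e i + 1) *
      (\<Prod>j\<in>?S - {i}. fact (Poly_Mapping.lookup e j))"
    by (subst prod.remove[of _ i]) (auto simp: lookup_add lookup_single intro!: prod.cong)
  also have "\<dots> = of_nat (Poly_Mapping.lookup e i + 1) *
      (fact (Poly_Mapping.lookup e i) * (\<Prod>j\<in>?S - {i}. fact (Poly_Mapping.lookup e j)))"
    unfolding Suc_eq_plus1[symmetric] fact_Suc by (simp only: mult.assoc)
  also have "fact (Poly_Mapping.lookup e i) * (\<Prod>j\<in>?S - {i}. fact (Poly_Mapping.lookup e j))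
      = (mono_fact e :: 'a)"
    by (subst mono_fact_superset[of ?S]) (auto simp: prod.remove[of ?S i])
  finally show ?thesis .
qed

lemma lookup_sum_mono: "Poly_Mapping.lookup (sum f S) e = (\<Sum>i\<in>S. Poly_Mapping.lookup (f i) e)"
  by (induction S rule: infinite_finite_induct) (auto simp: lookup_add)

lemma lookup_pdiff:
  fixes p :: "'k::field_char_0 mpoly"
  shows "Poly_Mapping.lookup (pdiff i p) e =
    of_nat (Poly_Mapping.lookup e i + 1) * Poly_Mapping.lookup p (e + Poly_Mapping.single i 1)"
proof -
  let ?u = "Poly_Mapping.single i 1 :: mono"
  \<comment> \<open>If \<open>d\<close> does not contain the variable, truncated subtraction returns
    \<open>d\<close>, which may be \<open>e\<close>; the factor 0 removes this case.\<close>
  have eq: "of_nat (Poly_Mapping.lookup d i) * Poly_Mapping.lookup p d * (if d - ?u = e then 1 else 0)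
      = (if d = e + ?u then of_nat (Poly_Mapping.lookup e i + 1) * Poly_Mapping.lookup p (e + ?u) else 0)"
    for d
  proof (cases "d = e + ?u")
    case True
    then show ?thesis by (simp add: lookup_add)
  next
    case False
    show ?thesis
    proof (cases "Poly_Mapping.lookup d i = 0")
      case 0: False
      have "d = (d - ?u) + ?u"
        using 0 by (intro poly_mapping_eqI) (auto simp: lookup_add lookup_minus lookup_single when_def)
      then have "d - ?u \<noteq> e" using False by metis
      then show ?thesis using False by simp
    qed (use False in simp)
  qed
  have "Poly_Mapping.lookup (pdiff i p) e = (\<Sum>d\<in>Poly_Mapping.keys p.
      of_nat (Poly_Mapping.lookup d i) * Poly_Mapping.lookup p d * (if d - ?u = e then 1 else 0))"
    unfolding pdiff_def lookup_sum_mono by (intro sum.cong) (auto simp: lookup_single when_def)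
  also have "\<dots> = of_nat (Poly_Mapping.lookup e i + 1) * Poly_Mapping.lookup p (e + ?u)"
    unfolding eq by (auto simp: in_keys_iff)
  finally show ?thesis .
qed

lemma divided_coeff_pdiff: "divided_coeff (pdiff i p) e = divided_coeff p (e + Poly_Mapping.single i 1)"
  by (simp add: divided_coeff_def lookup_pdiff mono_fact_plus_single)

lemma divided_coeff_pdiff_power:
  "divided_coeff ((pdiff i ^^ k) p) e = divided_coeff p (e + Poly_Mapping.single i k)"
proof (induction k arbitrary: e)
  case (Suc k)
  have "Poly_Mapping.single i (Suc k) = Poly_Mapping.single i 1 + Poly_Mapping.single i k"
    by (metis single_add plus_1_eq_Suc)
  then show ?case using Suc by (simp add: divided_coeff_pdiff add.assoc)
qed simp

lemma divided_coeff_foldr: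
  "divided_coeff (foldr (\<lambda>i. pdiff i ^^ k i) L p) e = divided_coeff p (e + (\<Sum>i\<leftarrow>L. Poly_Mapping.single i (k i)))"
  by (induction L arbitrary: e) (simp_all add: divided_coeff_pdiff_power add.assoc)

lemma mono_eq_sum: "(e :: mono) = (\<Sum>i\<in>Poly_Mapping.keys e. Poly_Mapping.single i (Poly_Mapping.lookup e i))"
proof (rule poly_mapping_eqI)
  fix j
  have "(\<Sum>i\<in>Poly_Mapping.keys e. Poly_Mapping.lookup (Poly_Mapping.single i (Poly_Mapping.lookup e i)) j)
      = (\<Sum>i\<in>Poly_Mapping.keys e. if i = j then Poly_Mapping.lookup e j else 0)"
    by (intro sum.cong) (auto simp: lookup_single when_def)
  also have "\<dots> = Poly_Mapping.lookup e j" by (auto simp: in_keys_iff)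
  finally show "Poly_Mapping.lookup e j = Poly_Mapping.lookup
      (\<Sum>i\<in>Poly_Mapping.keys e. Poly_Mapping.single i (Poly_Mapping.lookup e i)) j"
    by (simp add: lookup_sum_mono)
qed

lemma divided_coeff_mono_diff: "divided_coeff (mono_diff a p) e = divided_coeff p (a + e)"
proof -
  have "(\<Sum>i\<leftarrow>sorted_list_of_set (Poly_Mapping.keys a). Poly_Mapping.single i (Poly_Mapping.lookup a i)) = a"
    by (subst sum_list_distinct_conv_sum_set) (auto simp flip: mono_eq_sum)
  then show ?thesis
    unfolding mono_diff_def divided_coeff_foldr by (simp add: add.commute)
qed

lemma divided_coeff_eq_0_iff: "p = 0 \<longleftrightarrow> (\<forall>e. divided_coeff p e = 0)"
  by (auto simp: divided_coeff_def mono_fact_nonzero intro: poly_mapping_eqI)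

lemma divided_coeff_add: "divided_coeff (p + q) e = divided_coeff p e + divided_coeff q e"
  by (simp add: divided_coeff_def lookup_add distrib_left)

lemma lookup_mscale: "Poly_Mapping.lookup (mscale c p) e = c * Poly_Mapping.lookup p e"
proof (induction p rule: poly_mapping_single_induct)
  case (1 e' c')
  then show ?case by (simp add: mscale_def mult_single lookup_single when_def)
next
  case (2 p q)
  then show ?case by (simp add: mpoly.scale_right_distrib lookup_add distrib_left)
qed

lemma divided_coeff_mscale: "divided_coeff (mscale c p) e = c * divided_coeff p e"
  by (simp add: divided_coeff_def lookup_mscale)

text \<open>The exponents that divide an exponent in the support of \<open>G\<close>; a derivative
  along any other exponent vanishes.\<close>

definition divisors :: "(mono \<Rightarrow> 'k::zero) \<Rightarrow> mono set" where
  "divisors G = {a. \<exists>b. G (a + b) \<noteq> 0}"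

text \<open>The action of \<open>f\<close> on the polynomial with coefficients
  \<open>G e / e!\<close>, the result again multiplied by factorials. For finitely supported
  \<open>G\<close>, summing over its divisors gives a finite sum and loses no nonzero term.\<close>

definition contract :: "(mono \<Rightarrow> 'k::comm_semiring_0) \<Rightarrow> 'k pseries \<Rightarrow> mono \<Rightarrow> 'k" where
  "contract G f b = (\<Sum>a\<in>divisors G. f a * G (a + b))"

lemma finite_divisors:
  assumes "finite {e. G e \<noteq> 0}"
  shows "finite (divisors G)"
proof -
  have "divisors G \<subseteq> (\<Union>e\<in>{e. G e \<noteq> 0}. fst ` {(a, b). a + b = e})"
    by (force simp: divisors_def)
  moreover have "finite \<dots>" using assms by (intro finite_UN_I finite_imageI finite_mono_splits) auto
  ultimately show ?thesis by (rule finite_subset)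
qed

lemma finite_divided_coeff: "finite {e. divided_coeff F e \<noteq> 0}"
  by (rule finite_subset[of _ "Poly_Mapping.keys F"]) (auto simp: divided_coeff_def in_keys_iff)

lemma mono_diff_nonzero: "{a. mono_diff a F \<noteq> 0} = divisors (divided_coeff F)"
  by (auto simp: divisors_def divided_coeff_eq_0_iff[of "mono_diff _ F"] divided_coeff_mono_diff)

lemma divided_coeff_sum: "divided_coeff (sum f S) e = (\<Sum>i\<in>S. divided_coeff (f i) e)"
  by (simp add: divided_coeff_def lookup_sum_mono sum_distrib_left)

lemma divided_coeff_ps_act: "divided_coeff (ps_act f F) b = contract (divided_coeff F) f b"
  unfolding ps_act_def contract_def mono_diff_nonzero divided_coeff_sum
  by (simp add: divided_coeff_mscale divided_coeff_mono_diff)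

lemma Ann_iff: "f \<in> Ann m F \<longleftrightarrow> f \<in> carrier (pseries_ring m) \<and> (\<forall>b. contract (divided_coeff F) f b = 0)"
  by (simp add: Ann_def divided_coeff_eq_0_iff[of "ps_act f F"] divided_coeff_ps_act)

section \<open>The ring of power series\<close>

definition ps_mult :: "'k::comm_semiring_0 pseries \<Rightarrow> 'k pseries \<Rightarrow> 'k pseries" where
  "ps_mult f g e = (\<Sum>(a, b) | a + b = e. f a * g b)"

lemma pseries_ring_sel:
  "carrier (pseries_ring m) = {f. \<forall>e. f e \<noteq> 0 \<longrightarrow> Poly_Mapping.keys e \<subseteq> {..<m}}"
  "f \<otimes>\<^bsub>pseries_ring m\<^esub> g = ps_mult f g"
  "\<one>\<^bsub>pseries_ring m\<^esub> = (\<lambda>e. if e = 0 then 1 else 0)"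
  "\<zero>\<^bsub>pseries_ring m\<^esub> = (\<lambda>e. 0)"
  "f \<oplus>\<^bsub>pseries_ring m\<^esub> g = (\<lambda>e. f e + g e)"
  "c \<odot>\<^bsub>pseries_ring m\<^esub> f = (\<lambda>e. c * f e)"
  by (simp_all add: pseries_ring_def ps_mult_def fun_eq_iff)

lemma keys_mono_add: "Poly_Mapping.keys (a + b :: mono) = Poly_Mapping.keys a \<union> Poly_Mapping.keys b"
  by (auto simp: in_keys_iff lookup_add)

lemma ps_mult_comm: "ps_mult f g = ps_mult g f"
proof
  fix e
  show "ps_mult f g e = ps_mult g f e"
    unfolding ps_mult_def
    by (rule sum.reindex_bij_witness[of _ prod.swap prod.swap]) (auto simp: ac_simps)
qed

lemma ps_mult_add: "ps_mult f (\<lambda>e. g e + h e) = (\<lambda>e. ps_mult f g e + ps_mult f h e)"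
  by (auto simp: ps_mult_def fun_eq_iff distrib_left sum.distrib split_beta)

lemma ps_mult_scale: "ps_mult (\<lambda>e. c * f e) g = (\<lambda>e. c * ps_mult f g e)"
  by (auto simp: ps_mult_def fun_eq_iff sum_distrib_left split_beta mult.assoc)

lemma finite_mono_splits_fst_snd: "finite {p. fst p + snd p = (e :: mono)}"
  by (rule finite_subset[OF _ finite_mono_splits[of e]]) auto

text \<open>Both sides sum over the ordered decompositions of an exponent into three, bracketed
  differently.\<close>

lemma ps_mult_assoc: "ps_mult (ps_mult f g) h = ps_mult f (ps_mult g h)"
proof
  fix e
  have "ps_mult (ps_mult f g) h e =
      (\<Sum>(x, y)\<in>Sigma {(a, b). a + b = e} (\<lambda>x. {(c, d). c + d = fst x}). f (fst y) * g (snd y) * h (snd x))"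
    unfolding ps_mult_def split_beta sum_distrib_right
    by (subst sum.Sigma) (auto simp: finite_mono_splits_fst_snd split_beta)
  also have "\<dots> = (\<Sum>(x, y)\<in>Sigma {(a, b). a + b = e} (\<lambda>x. {(c, d). c + d = snd x}). f (fst x) * (g (fst y) * h (snd y)))"
    by (rule sum.reindex_bij_witness[of _ "\<lambda>((a, b), (c, d)). ((a + c, d), (a, c))" "\<lambda>((a, b), (c, d)). ((c, d + b), (d, b))"])
      (auto simp: ac_simps)
  also have "\<dots> = ps_mult f (ps_mult g h) e"
    unfolding ps_mult_def split_beta sum_distrib_left
    by (subst sum.Sigma) (auto simp: finite_mono_splits_fst_snd split_beta)
  finally show "ps_mult (ps_mult f g) h e = ps_mult f (ps_mult g h) e" .
qed

lemma ps_mult_single: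
  "ps_mult (\<lambda>e. if e = b then c else 0) g (b + e) = c * g e"
proof -
  have "ps_mult (\<lambda>e. if e = b then c else 0) g (b + e) = (\<Sum>(x, y)\<in>{(b, e)}. c * g y)"
    unfolding ps_mult_def by (rule sum.mono_neutral_cong_right) (auto simp: finite_mono_splits split: if_splits)
  then show ?thesis by simp
qed

lemma ps_mult_nonzeroE:
  assumes "ps_mult f g e \<noteq> 0"
  obtains a b where "a + b = e" "f a \<noteq> 0" "g b \<noteq> 0"
proof -
  obtain p where p: "p \<in> {(a, b). a + b = e}" "(case p of (a, b) \<Rightarrow> f a * g b) \<noteq> 0"
    by (rule sum.not_neutral_contains_not_neutral[OF assms[unfolded ps_mult_def]])
  obtain a b where ab: "a + b = e" "f a * g b \<noteq> 0"
    using p by (cases p) auto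
  from ab(2) have "f a \<noteq> 0" "g b \<noteq> 0" by auto
  then show ?thesis by (rule that[OF ab(1)])
qed

lemma ps_mult_closed:
  assumes "f \<in> carrier (pseries_ring m)" "g \<in> carrier (pseries_ring m)"
  shows "ps_mult f g \<in> carrier (pseries_ring m)"
  unfolding pseries_ring_sel(1)
proof (intro CollectI allI impI)
  fix e assume "ps_mult f g e \<noteq> 0"
  then obtain a b where ab: "a + b = e" "f a \<noteq> 0" "g b \<noteq> 0" by (rule ps_mult_nonzeroE)
  then have "Poly_Mapping.keys a \<subseteq> {..<m}" "Poly_Mapping.keys b \<subseteq> {..<m}"
    using assms unfolding pseries_ring_sel(1) by blast+
  then show "Poly_Mapping.keys e \<subseteq> {..<m}"
    unfolding ab(1)[symmetric] keys_mono_add by blast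
qed

lemma pseries_K_algebra: "K_algebra (pseries_ring m :: ('k::field, 'k pseries) module)"
proof -
  let ?R = "pseries_ring m :: ('k, 'k pseries) module"
  have one: "ps_mult (\<lambda>e. if e = 0 then 1 else 0) f = f" for f :: "'k pseries"
    using ps_mult_single[of 0 1 f] by (simp add: fun_eq_iff)
  have add_closed: "(\<lambda>e. f e + g e) \<in> carrier ?R" if "f \<in> carrier ?R" "g \<in> carrier ?R" for f g
    unfolding pseries_ring_sel(1)
  proof (intro CollectI allI impI)
    fix e assume "f e + g e \<noteq> 0"
    then have "f e \<noteq> 0 \<or> g e \<noteq> 0" by auto
    then show "Poly_Mapping.keys e \<subseteq> {..<m}"
      using that unfolding pseries_ring_sel(1) by blast
  qed
  have sc_closed: "(\<lambda>e. c * f e) \<in> carrier ?R" if "f \<in> carrier ?R" for f c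
    using that unfolding pseries_ring_sel(1) by simp
  have one_closed: "(\<lambda>e. if e = 0 then 1 else 0) \<in> carrier ?R" "(\<lambda>e. 0) \<in> carrier ?R"
    unfolding pseries_ring_sel(1) by simp_all
  have ab: "abelian_group ?R"
  proof (rule abelian_groupI)
    fix f assume "f \<in> carrier ?R"
    then show "\<exists>g\<in>carrier ?R. g \<oplus>\<^bsub>?R\<^esub> f = \<zero>\<^bsub>?R\<^esub>"
      using sc_closed[of f "-1"] by (intro bexI[of _ "\<lambda>e. -1 * f e"]) (simp_all add: pseries_ring_sel(4,5))
  qed (simp_all add: pseries_ring_sel(4,5) add_closed one_closed ac_simps)
  have cr: "cring ?R"
  proof (rule cringI[OF ab])
    show "comm_monoid ?R"
    proof (rule comm_monoidI)
      show "x \<otimes>\<^bsub>?R\<^esub> y = y \<otimes>\<^bsub>?R\<^esub> x" for x y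
        unfolding pseries_ring_sel(2) by (rule ps_mult_comm)
    qed (simp_all add: pseries_ring_sel(2,3) ps_mult_closed ps_mult_assoc one one_closed)
    show "(x \<oplus>\<^bsub>?R\<^esub> y) \<otimes>\<^bsub>?R\<^esub> z = x \<otimes>\<^bsub>?R\<^esub> z \<oplus>\<^bsub>?R\<^esub> y \<otimes>\<^bsub>?R\<^esub> z" for x y z
      using ps_mult_add[of z x y] by (simp add: pseries_ring_sel(2,5) ps_mult_comm[of _ z])
  qed
  show ?thesis
    by (rule algebraI)
      (simp_all add: cr cring_from_type_algebra pseries_ring_sel(2,5,6) sc_closed ps_mult_scale
        distrib_left distrib_right mult.assoc)
qed

text \<open>If a + c divides an exponent of the support, so do a and c; pairs of divisors whose sum
  is not a divisor contribute zero. Splittings may hence be replaced by all pairs of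
  divisors.\<close>

lemma sum_divisors_swap:
  fixes G :: "mono \<Rightarrow> 'k::comm_semiring_0"
  assumes "finite {e. G e \<noteq> 0}"
  shows "(\<Sum>e\<in>divisors G. \<Sum>(a, c) | a + c = e. h a c * G (e + b)) =
    (\<Sum>c\<in>divisors G. \<Sum>a\<in>divisors G. h a c * G (a + c + b))"
proof -
  let ?D = "divisors G"
  have fin: "finite ?D" by (rule finite_divisors[OF assms])
  let ?T = "?D \<union> (\<lambda>p. fst p + snd p) ` (?D \<times> ?D)"
  have zero: "G (e + b) = 0" if "e \<notin> ?D" for e using that by (auto simp: divisors_def)
  have pairs: "{(a, c). a + c = e} = {x \<in> ?D \<times> ?D. fst x + snd x = e}" if e: "e \<in> ?D" for e
  proof -
    obtain d where "G (e + d) \<noteq> 0" using e by (auto simp: divisors_def)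
    then have "G (a + (c + d)) \<noteq> 0 \<and> G (c + (a + d)) \<noteq> 0" if "a + c = e" for a c
      unfolding that[symmetric] by (simp add: ac_simps)
    then have "a \<in> ?D \<and> c \<in> ?D" if "a + c = e" for a c
      unfolding divisors_def using that by blast
    then show ?thesis by auto
  qed
  have "(\<Sum>e\<in>?D. \<Sum>(a, c) | a + c = e. h a c * G (e + b))
      = (\<Sum>e\<in>?D. \<Sum>x | x \<in> ?D \<times> ?D \<and> fst x + snd x = e. h (fst x) (snd x) * G (fst x + snd x + b))"
    by (rule sum.cong) (auto simp: pairs split_beta intro!: sum.cong)
  also have "\<dots> = (\<Sum>e\<in>?T. \<Sum>x | x \<in> ?D \<times> ?D \<and> fst x + snd x = e. h (fst x) (snd x) * G (fst x + snd x + b))"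
    using fin zero by (intro sum.mono_neutral_left) (auto intro!: sum.neutral)
  also have "\<dots> = (\<Sum>x\<in>?D \<times> ?D. h (fst x) (snd x) * G (fst x + snd x + b))"
    using fin by (intro sum.group) auto
  also have "\<dots> = (\<Sum>a\<in>?D. \<Sum>c\<in>?D. h a c * G (a + c + b))"
    by (simp add: sum.cartesian_product split_beta)
  also have "\<dots> = (\<Sum>c\<in>?D. \<Sum>a\<in>?D. h a c * G (a + c + b))"
    by (rule sum.swap)
  finally show ?thesis .
qed

text \<open>The module law (fg) \<circ> F = g \<circ> (f \<circ> F) in coefficients. The divisors of
  \<open>G\<close> include those of the contracted function, so they serve for the outer action too.
  In particular, annihilators are ideals.\<close>

lemma contract_ps_mult:
  assumes "finite {e. G e \<noteq> 0}"
  shows "contract G (ps_mult f g) b = (\<Sum>c\<in>divisors G. g c * contract G f (c + b))"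
proof -
  have "contract G (ps_mult f g) b = (\<Sum>e\<in>divisors G. \<Sum>(a, c) | a + c = e. (f a * g c) * G (e + b))"
    by (simp add: contract_def ps_mult_def sum_distrib_right split_beta)
  also have "\<dots> = (\<Sum>c\<in>divisors G. \<Sum>a\<in>divisors G. (f a * g c) * G (a + c + b))"
    by (rule sum_divisors_swap[OF assms])
  finally show ?thesis
    by (simp add: contract_def sum_distrib_left ac_simps)
qed

lemma contract_add: "contract G (\<lambda>e. f e + g e) b = contract G f b + contract G g b"
  by (simp add: contract_def distrib_right sum.distrib)

lemma contract_scale: "contract G (\<lambda>e. c * f e) b = c * contract G f b"
  by (simp add: contract_def sum_distrib_left mult.assoc)

lemma contract_single:
  assumes "finite {e. G e \<noteq> 0}"
  shows "contract G (\<lambda>e. if e = a then c else 0) b = c * G (a + b)"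
proof -
  have "contract G (\<lambda>e. if e = a then c else 0) b = (\<Sum>e\<in>divisors G. if e = a then c * G (a + b) else 0)"
    unfolding contract_def by (intro sum.cong) auto
  also have "\<dots> = c * G (a + b)"
    using finite_divisors[OF assms] by (auto simp: divisors_def)
  finally show ?thesis .
qed

lemma Ann_ideal:
  fixes F :: "'k::field_char_0 mpoly"
  shows "ideal (Ann m F) (pseries_ring m)"
proof -
  interpret R: K_alg "pseries_ring m" by (rule K_alg.intro) (rule pseries_K_algebra)
  note c = contract_add contract_scale
  have mult: "ps_mult f g \<in> Ann m F" if f: "f \<in> Ann m F" and g: "g \<in> carrier (pseries_ring m)" for f g
    using f g unfolding Ann_iff contract_ps_mult[OF finite_divided_coeff] by (simp add: ps_mult_closed)
  show ?thesis
  proof (rule idealI)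
    show "subgroup (Ann m F) (add_monoid (pseries_ring m))"
    proof (rule R.add.subgroupI)
      fix f assume f: "f \<in> Ann m F"
      have "\<ominus>\<^bsub>pseries_ring m\<^esub> f = (-1) \<odot>\<^bsub>pseries_ring m\<^esub> f"
      proof (rule R.add.inv_equality)
        show "(-1) \<odot>\<^bsub>pseries_ring m\<^esub> f \<oplus>\<^bsub>pseries_ring m\<^esub> f = \<zero>\<^bsub>pseries_ring m\<^esub>"
          by (simp add: pseries_ring_sel(4,5,6))
      qed (use f in \<open>simp_all add: Ann_iff\<close>)
      moreover have "(-1) \<odot>\<^bsub>pseries_ring m\<^esub> f \<in> Ann m F"
        using f R.smult_mem[of f "-1"] contract_scale[of _ "-1" f]
        unfolding Ann_iff by (simp add: pseries_ring_sel(6))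
      ultimately show "\<ominus>\<^bsub>pseries_ring m\<^esub> f \<in> Ann m F"
        by simp
    next
      show "f \<oplus>\<^bsub>pseries_ring m\<^esub> g \<in> Ann m F" if "f \<in> Ann m F" "g \<in> Ann m F" for f g
        using that R.a_closed[of f g] unfolding Ann_iff by (simp add: pseries_ring_sel(5) contract_add)
      show "Ann m F \<noteq> {}"
        using R.zero_closed unfolding Ann_iff ex_in_conv[symmetric]
        by (auto simp: pseries_ring_sel(4) contract_def)
    qed (simp add: subset_iff Ann_iff)
  qed (use mult in \<open>auto simp: pseries_ring_sel(2) ps_mult_comm[of _ "_ :: 'k pseries"] R.ring_axioms intro: mult\<close>)
qed

section \<open>Images, quotients and isomorphisms of algebras\<close>

lemma alg_hom_simps:
  assumes "h \<in> alg_hom A B"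
  shows "a \<in> carrier A \<Longrightarrow> h a \<in> carrier B"
    "a \<in> carrier A \<Longrightarrow> b \<in> carrier A \<Longrightarrow> h (a \<oplus>\<^bsub>A\<^esub> b) = h a \<oplus>\<^bsub>B\<^esub> h b"
    "a \<in> carrier A \<Longrightarrow> b \<in> carrier A \<Longrightarrow> h (a \<otimes>\<^bsub>A\<^esub> b) = h a \<otimes>\<^bsub>B\<^esub> h b"
    "h \<one>\<^bsub>A\<^esub> = \<one>\<^bsub>B\<^esub>"
    "a \<in> carrier A \<Longrightarrow> h (c \<odot>\<^bsub>A\<^esub> a) = c \<odot>\<^bsub>B\<^esub> h a"
  using assms by (auto simp: alg_hom_def ring_hom_def)

lemma alg_homI:
  assumes "\<And>a. a \<in> carrier A \<Longrightarrow> h a \<in> carrier B"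
    "\<And>a b. a \<in> carrier A \<Longrightarrow> b \<in> carrier A \<Longrightarrow> h (a \<oplus>\<^bsub>A\<^esub> b) = h a \<oplus>\<^bsub>B\<^esub> h b"
    "\<And>a b. a \<in> carrier A \<Longrightarrow> b \<in> carrier A \<Longrightarrow> h (a \<otimes>\<^bsub>A\<^esub> b) = h a \<otimes>\<^bsub>B\<^esub> h b"
    "h \<one>\<^bsub>A\<^esub> = \<one>\<^bsub>B\<^esub>"
    "\<And>a c. a \<in> carrier A \<Longrightarrow> h (c \<odot>\<^bsub>A\<^esub> a) = c \<odot>\<^bsub>B\<^esub> h a"
  shows "h \<in> alg_hom A B"
  using assms by (auto simp: alg_hom_def intro!: ring_hom_memI)

text \<open>An isomorphism with a quotient of R is traded for a surjection from R with the same
  fibres, so that maps can be given on power series instead of cosets.\<close>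

lemma alg_iso_iff_same_fibres:
  fixes R :: "('k::field, 'r) module" and A :: "('k, 'a) module" and B :: "('k, 'b) module"
  assumes R: "K_algebra R" and A: "K_algebra A"
    and q: "q \<in> alg_hom R B" "q ` carrier R = carrier B"
  shows "alg_iso A B \<longleftrightarrow> (\<exists>\<pi>\<in>alg_hom R A. \<pi> ` carrier R = carrier A \<and>
    (\<forall>f\<in>carrier R. \<forall>g\<in>carrier R. \<pi> f = \<pi> g \<longleftrightarrow> q f = q g))"
proof -
  interpret R: K_alg R by (rule K_alg.intro) (rule R)
  interpret A: K_alg A by (rule K_alg.intro) (rule A)
  note Q = alg_hom_simps[OF q(1)]
  show ?thesis
  proof (rule iffI)
    assume "alg_iso A B"
    then obtain h where h: "h \<in> alg_hom A B" and bij: "bij_betw h (carrier A) (carrier B)"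
      by (auto simp: alg_iso_def)
    note H = alg_hom_simps[OF h]
    define \<pi> where "\<pi> f = inv_into (carrier A) h (q f)" for f
    have \<pi>c: "\<pi> f \<in> carrier A" and h\<pi>: "h (\<pi> f) = q f" if "f \<in> carrier R" for f
    proof -
      have "q f \<in> h ` carrier A"
        using Q(1)[OF that] bij by (simp add: bij_betw_def)
      then show "\<pi> f \<in> carrier A" "h (\<pi> f) = q f"
        unfolding \<pi>_def by (rule inv_into_into, rule f_inv_into_f)
    qed
    have inj: "a = b" if "a \<in> carrier A" "b \<in> carrier A" "h a = h b" for a b
      using bij that by (auto simp: bij_betw_def inj_on_def)
    have "\<pi> \<in> alg_hom R A"
    proof (rule alg_homI)
      fix f assume f: "f \<in> carrier R"
      show "\<pi> f \<in> carrier A" by (rule \<pi>c[OF f])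
      show "\<pi> (c \<odot>\<^bsub>R\<^esub> f) = c \<odot>\<^bsub>A\<^esub> \<pi> f" for c
        by (rule inj) (simp_all add: f \<pi>c h\<pi> H(5) Q(5))
      fix g assume g: "g \<in> carrier R"
      show "\<pi> (f \<oplus>\<^bsub>R\<^esub> g) = \<pi> f \<oplus>\<^bsub>A\<^esub> \<pi> g"
        by (rule inj) (simp_all add: f g \<pi>c h\<pi> H(2) Q(2))
      show "\<pi> (f \<otimes>\<^bsub>R\<^esub> g) = \<pi> f \<otimes>\<^bsub>A\<^esub> \<pi> g"
        by (rule inj) (simp_all add: f g \<pi>c h\<pi> H(3) Q(3))
    next
      show "\<pi> \<one>\<^bsub>R\<^esub> = \<one>\<^bsub>A\<^esub>"
        by (rule inj) (simp_all add: \<pi>c h\<pi> H(4) Q(4))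
    qed
    moreover have "a \<in> \<pi> ` carrier R" if a: "a \<in> carrier A" for a
    proof -
      have "h a \<in> q ` carrier R" using H(1)[OF a] q(2) by simp
      then obtain f where f: "f \<in> carrier R" "h a = q f" by blast
      have "a = \<pi> f" by (rule inj[OF a \<pi>c[OF f(1)]]) (simp add: f h\<pi>)
      then show ?thesis using f(1) by (rule image_eqI)
    qed
    then have "\<pi> ` carrier R = carrier A"
      by (intro subset_antisym image_subsetI \<pi>c subsetI)
    moreover have "\<pi> f = \<pi> g \<longleftrightarrow> q f = q g" if "f \<in> carrier R" "g \<in> carrier R" for f g
    proof
      assume "\<pi> f = \<pi> g"
      then show "q f = q g" using h\<pi>[OF that(1)] h\<pi>[OF that(2)] by metis
    qed (simp add: \<pi>_def)
    ultimately show "\<exists>\<pi>\<in>alg_hom R A. \<pi> ` carrier R = carrier A \<and>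
      (\<forall>f\<in>carrier R. \<forall>g\<in>carrier R. \<pi> f = \<pi> g \<longleftrightarrow> q f = q g)" by blast
  next
    assume "\<exists>\<pi>\<in>alg_hom R A. \<pi> ` carrier R = carrier A \<and>
      (\<forall>f\<in>carrier R. \<forall>g\<in>carrier R. \<pi> f = \<pi> g \<longleftrightarrow> q f = q g)"
    then obtain \<pi> where \<pi>: "\<pi> \<in> alg_hom R A" "\<pi> ` carrier R = carrier A"
      and fib': "\<forall>f\<in>carrier R. \<forall>g\<in>carrier R. \<pi> f = \<pi> g \<longleftrightarrow> q f = q g"
      by blast
    have fib: "\<pi> f = \<pi> g \<longleftrightarrow> q f = q g" if "f \<in> carrier R" "g \<in> carrier R" for f g
      using fib' that by simp
    note P = alg_hom_simps[OF \<pi>(1)]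
    define h where "h a = q (inv_into (carrier R) \<pi> a)" for a
    have h\<pi>: "h (\<pi> f) = q f" if "f \<in> carrier R" for f
    proof -
      have f: "\<pi> f \<in> \<pi> ` carrier R" using that by blast
      show ?thesis
        unfolding h_def using fib[OF inv_into_into[OF f] that] f_inv_into_f[OF f] by simp
    qed
    have rep: "\<exists>f\<in>carrier R. a = \<pi> f" if "a \<in> carrier A" for a
      using \<pi>(2) that by blast
    have "h \<in> alg_hom A B"
    proof (rule alg_homI)
      fix a assume "a \<in> carrier A"
      then obtain f where f: "f \<in> carrier R" "a = \<pi> f" using rep by blast
      then show "h a \<in> carrier B" using h\<pi> Q by simp
      show "h (c \<odot>\<^bsub>A\<^esub> a) = c \<odot>\<^bsub>B\<^esub> h a" for c
        using f h\<pi>[OF R.smult_mem[OF f(1), of c]] h\<pi>[OF f(1)] P(5)[OF f(1), of c] Q(5)[OF f(1), of c] by simp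
      fix b assume "b \<in> carrier A"
      then obtain g where g: "g \<in> carrier R" "b = \<pi> g" using rep by blast
      show "h (a \<oplus>\<^bsub>A\<^esub> b) = h a \<oplus>\<^bsub>B\<^esub> h b"
        using f g h\<pi>[OF R.a_closed[OF f(1) g(1)]] h\<pi>[OF f(1)] h\<pi>[OF g(1)] P(2)[OF f(1) g(1)] Q(2)[OF f(1) g(1)]
        by simp
      show "h (a \<otimes>\<^bsub>A\<^esub> b) = h a \<otimes>\<^bsub>B\<^esub> h b"
        using f g h\<pi>[OF R.m_closed[OF f(1) g(1)]] h\<pi>[OF f(1)] h\<pi>[OF g(1)] P(3)[OF f(1) g(1)] Q(3)[OF f(1) g(1)]
        by simp
    next
      show "h \<one>\<^bsub>A\<^esub> = \<one>\<^bsub>B\<^esub>" using h\<pi>[OF R.one_closed] P(4) Q(4) by simp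
    qed
    moreover have "inj_on h (carrier A)"
    proof (rule inj_onI)
      fix a b assume "a \<in> carrier A" "b \<in> carrier A" and ab: "h a = h b"
      then obtain f g where fg: "f \<in> carrier R" "a = \<pi> f" "g \<in> carrier R" "b = \<pi> g" using rep by meson
      then show "a = b" using ab h\<pi>[OF fg(1)] h\<pi>[OF fg(3)] fib[OF fg(1,3)] by simp
    qed
    moreover have "h ` carrier A = carrier B"
      unfolding \<pi>(2)[symmetric] q(2)[symmetric] image_image using h\<pi> by (intro image_cong) auto
    ultimately show "alg_iso A B" by (auto simp: alg_iso_def bij_betw_def)
qed
qed

text \<open>Identities pass along a surjection. Zero has its own hypothesis because B is not yet
  known to be a group, so additivity alone does not determine the image of zero.\<close>

lemma K_algebra_image:
  fixes R :: "('k::field, 'r) module" and B :: "('k, 'b) module"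
  assumes R: "K_algebra R" and q: "q \<in> alg_hom R B" "q ` carrier R = carrier B"
    and zero: "q \<zero>\<^bsub>R\<^esub> = \<zero>\<^bsub>B\<^esub>"
  shows "K_algebra B"
proof -
  interpret R: K_alg R by (rule K_alg.intro) (rule R)
  note Q = alg_hom_simps[OF q(1)]
  have rep: "(\<forall>b\<in>carrier B. P b) \<longleftrightarrow> (\<forall>f\<in>carrier R. P (q f))" for P
    unfolding q(2)[symmetric] by blast
  note Q' = Q(2-5)[symmetric] zero[symmetric]
  have ax: "\<forall>x\<in>carrier B. \<forall>y\<in>carrier B. \<forall>z\<in>carrier B.
      x \<oplus>\<^bsub>B\<^esub> y \<in> carrier B \<and> x \<otimes>\<^bsub>B\<^esub> y \<in> carrier B \<and>
      x \<oplus>\<^bsub>B\<^esub> y \<oplus>\<^bsub>B\<^esub> z = x \<oplus>\<^bsub>B\<^esub> (y \<oplus>\<^bsub>B\<^esub> z) \<and> x \<oplus>\<^bsub>B\<^esub> y = y \<oplus>\<^bsub>B\<^esub> x \<and> \<zero>\<^bsub>B\<^esub> \<oplus>\<^bsub>B\<^esub> x = x \<and>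
      x \<otimes>\<^bsub>B\<^esub> y \<otimes>\<^bsub>B\<^esub> z = x \<otimes>\<^bsub>B\<^esub> (y \<otimes>\<^bsub>B\<^esub> z) \<and> x \<otimes>\<^bsub>B\<^esub> y = y \<otimes>\<^bsub>B\<^esub> x \<and> \<one>\<^bsub>B\<^esub> \<otimes>\<^bsub>B\<^esub> x = x \<and>
      (x \<oplus>\<^bsub>B\<^esub> y) \<otimes>\<^bsub>B\<^esub> z = x \<otimes>\<^bsub>B\<^esub> z \<oplus>\<^bsub>B\<^esub> y \<otimes>\<^bsub>B\<^esub> z"
    unfolding rep
  proof (intro ballI conjI)
    fix f g assume "f \<in> carrier R" "g \<in> carrier R"
    then show "q f \<oplus>\<^bsub>B\<^esub> q g = q g \<oplus>\<^bsub>B\<^esub> q f" "q f \<otimes>\<^bsub>B\<^esub> q g = q g \<otimes>\<^bsub>B\<^esub> q f"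
      by (simp_all add: Q' R.a_comm[of f] R.m_comm[of f])
  qed (simp_all add: Q' Q(1) R.a_assoc R.m_assoc R.l_distr)
  have ab: "abelian_group B"
  proof (rule abelian_groupI)
    show "\<exists>y\<in>carrier B. y \<oplus>\<^bsub>B\<^esub> x = \<zero>\<^bsub>B\<^esub>" if x: "x \<in> carrier B" for x
    proof -
      obtain f where f: "f \<in> carrier R" "x = q f" using x q(2) by blast
      then have "q (\<ominus>\<^bsub>R\<^esub> f) \<oplus>\<^bsub>B\<^esub> x = \<zero>\<^bsub>B\<^esub>"
        by (simp add: Q' R.l_neg)
      then show ?thesis using f Q(1) by blast
    qed
  qed (use ax in \<open>blast+ | simp add: Q' Q(1)\<close>)+
  have cr: "cring B"
  proof (rule cringI[OF ab])
    show "comm_monoid B"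
      by (rule comm_monoidI) (use ax in \<open>blast+ | simp add: Q' Q(1)\<close>)+
  qed (use ax in blast)
  have sc: "\<forall>x\<in>carrier B. \<forall>y\<in>carrier B. c \<odot>\<^bsub>B\<^esub> x \<in> carrier B \<and>
      (c + d) \<odot>\<^bsub>B\<^esub> x = c \<odot>\<^bsub>B\<^esub> x \<oplus>\<^bsub>B\<^esub> d \<odot>\<^bsub>B\<^esub> x \<and>
      c \<odot>\<^bsub>B\<^esub> (x \<oplus>\<^bsub>B\<^esub> y) = c \<odot>\<^bsub>B\<^esub> x \<oplus>\<^bsub>B\<^esub> c \<odot>\<^bsub>B\<^esub> y \<and>
      (c * d) \<odot>\<^bsub>B\<^esub> x = c \<odot>\<^bsub>B\<^esub> (d \<odot>\<^bsub>B\<^esub> x) \<and> 1 \<odot>\<^bsub>B\<^esub> x = x \<and>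
      (c \<odot>\<^bsub>B\<^esub> x) \<otimes>\<^bsub>B\<^esub> y = c \<odot>\<^bsub>B\<^esub> (x \<otimes>\<^bsub>B\<^esub> y)" for c d
    unfolding rep
    by (simp add: Q' Q(1) R.smult_add_scalar R.smult_add R.smult_smult R.smult_mult_left)
  show ?thesis
    by (rule algebraI) (use sc in \<open>simp_all add: cr cring_from_type_algebra\<close>)
qed

lemma quot_alg_hom:
  fixes R :: "('k::field, 'r) module"
  assumes R: "K_algebra R" and I: "ideal I R"
  shows "(\<lambda>f. I +>\<^bsub>R\<^esub> f) \<in> alg_hom R (quot_alg R I)"
    "(\<lambda>f. I +>\<^bsub>R\<^esub> f) ` carrier R = carrier (quot_alg R I)"
    "I +>\<^bsub>R\<^esub> \<zero>\<^bsub>R\<^esub> = \<zero>\<^bsub>quot_alg R I\<^esub>"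
proof -
  interpret R: K_alg R by (rule K_alg.intro) (rule R)
  interpret I: ideal I R by (rule I)
  have sel: "carrier (quot_alg R I) = carrier (R Quot I)" "\<one>\<^bsub>quot_alg R I\<^esub> = \<one>\<^bsub>R Quot I\<^esub>"
    "\<zero>\<^bsub>quot_alg R I\<^esub> = \<zero>\<^bsub>R Quot I\<^esub>" "C \<oplus>\<^bsub>quot_alg R I\<^esub> D = C \<oplus>\<^bsub>R Quot I\<^esub> D"
    "C \<otimes>\<^bsub>quot_alg R I\<^esub> D = C \<otimes>\<^bsub>R Quot I\<^esub> D"
    "c \<odot>\<^bsub>quot_alg R I\<^esub> C = (\<Union>x\<in>C. I +>\<^bsub>R\<^esub> (c \<odot>\<^bsub>R\<^esub> x))" for C D c
    by (simp_all add: quot_alg_def ring.defs)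
  note H = I.rcos_ring_hom[unfolded ring_hom_def]
  show "(\<lambda>f. I +>\<^bsub>R\<^esub> f) ` carrier R = carrier (quot_alg R I)"
    by (auto simp: sel FactRing_def A_RCOSETS_def')
  show "I +>\<^bsub>R\<^esub> \<zero>\<^bsub>R\<^esub> = \<zero>\<^bsub>quot_alg R I\<^esub>"
    by (simp add: sel FactRing_def R.a_coset_add_zero[OF I.a_subset])
  show "(\<lambda>f. I +>\<^bsub>R\<^esub> f) \<in> alg_hom R (quot_alg R I)"
  proof (rule alg_homI)
    fix f c assume f: "f \<in> carrier R"
    have "I +>\<^bsub>R\<^esub> (c \<odot>\<^bsub>R\<^esub> x) = I +>\<^bsub>R\<^esub> (c \<odot>\<^bsub>R\<^esub> f)" if x: "x \<in> I +>\<^bsub>R\<^esub> f" for x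
    proof -
      obtain i where i: "i \<in> I" "x = i \<oplus>\<^bsub>R\<^esub> f" using x by (auto simp: a_r_coset_def')
      have ic: "i \<in> carrier R" using i(1) by (rule I.Icarr)
      \<comment> \<open>Scaling is multiplication by a multiple of the unit, so an ideal is closed
        under it; this makes scaling of cosets well defined.\<close>
      have "c \<odot>\<^bsub>R\<^esub> i = (c \<odot>\<^bsub>R\<^esub> \<one>\<^bsub>R\<^esub>) \<otimes>\<^bsub>R\<^esub> i" using ic by (simp add: R.smult_mult_left)
      then have "c \<odot>\<^bsub>R\<^esub> i \<in> I" using I.I_l_closed[OF i(1)] by simp
      then have "c \<odot>\<^bsub>R\<^esub> x \<in> I +>\<^bsub>R\<^esub> (c \<odot>\<^bsub>R\<^esub> f)"
        using i ic f by (auto simp: a_r_coset_def' R.smult_add)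
      then show ?thesis
        using f by (intro R.a_repr_independence[symmetric] I.a_subgroup) auto
    qed
    moreover have "f \<in> I +>\<^bsub>R\<^esub> f" using f by (rule I.a_rcos_self)
    ultimately show "I +>\<^bsub>R\<^esub> (c \<odot>\<^bsub>R\<^esub> f) = c \<odot>\<^bsub>quot_alg R I\<^esub> (I +>\<^bsub>R\<^esub> f)"
      unfolding sel by blast
  qed (use H in \<open>auto simp: sel\<close>)
qed

lemma rcos_eq_iff:
  assumes "ring R" "ideal I R" "a \<in> carrier R" "b \<in> carrier R"
  shows "I +>\<^bsub>R\<^esub> a = I +>\<^bsub>R\<^esub> b \<longleftrightarrow> a \<ominus>\<^bsub>R\<^esub> b \<in> I"
proof -
  interpret ring R by fact
  show ?thesis using quotient_eq_iff_same_a_r_cos[OF assms(2-4)] by blast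
qed

section \<open>Local algebras through a cover\<close>

context cover
begin

sublocale A: K_alg A
  by (rule K_alg.intro) (rule K_algebra)

lemma ev_closed [simp]: "ev p \<in> carrier A"
  using ev_range by blast

lemma ev_surj:
  assumes "a \<in> carrier A"
  obtains p where "ev p = a"
  using assms ev_range by (metis imageE)

lemma ev_zero [simp]: "ev 0 = \<zero>\<^bsub>A\<^esub>"
  using ev_sc[of 0 0] by simp

lemma ev_one [simp]: "ev 1 = \<one>\<^bsub>A\<^esub>"
proof -
  obtain p where p: "ev p = \<one>\<^bsub>A\<^esub>" by (rule ev_surj[OF A.one_closed])
  have "ev 1 = ev 1 \<otimes>\<^bsub>A\<^esub> ev p" by (simp add: p)
  also have "\<dots> = ev p" by (simp flip: ev_mult)
  finally show ?thesis using p by simp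
qed

lemma ev_diff: "ev (p - q) = ev p \<ominus>\<^bsub>A\<^esub> ev q"
proof -
  have "ev (p - q) \<oplus>\<^bsub>A\<^esub> ev q = ev p" by (simp flip: ev_add)
  then have "ev p \<ominus>\<^bsub>A\<^esub> ev q = (ev (p - q) \<oplus>\<^bsub>A\<^esub> ev q) \<ominus>\<^bsub>A\<^esub> ev q" by simp
  then show ?thesis by (simp add: A.a_assoc A.minus_eq A.r_neg)
qed

lemma ev_eq_iff: "ev p = ev q \<longleftrightarrow> ev (p - q) = \<zero>\<^bsub>A\<^esub>"
  by (simp add: ev_diff)

definition kernel :: "'q set" where
  "kernel = {p. ev p = \<zero>\<^bsub>A\<^esub>}"

lemma subspace_preimage:
  assumes "ideal I A"
  shows "subspace {p. ev p \<in> I}"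
proof -
  interpret I: ideal I A by (rule assms)
  have "c \<odot>\<^bsub>A\<^esub> a \<in> I" if "a \<in> I" for a c
  proof -
    have a: "a \<in> carrier A" using that by (rule I.Icarr)
    have "c \<odot>\<^bsub>A\<^esub> a = (c \<odot>\<^bsub>A\<^esub> \<one>\<^bsub>A\<^esub>) \<otimes>\<^bsub>A\<^esub> a" using a by (simp add: A.smult_mult_left)
    then show ?thesis using I.I_l_closed[OF that] by simp
  qed
  then show ?thesis
    by (intro subspaceI) (simp_all add: ev_add ev_sc I.a_closed)
qed

lemma subspace_kernel: "subspace kernel"
  using subspace_preimage[OF A.zeroideal] by (simp add: kernel_def)

lemma ev_kernel: "ev ` kernel = {\<zero>\<^bsub>A\<^esub>}"
proof
  show "{\<zero>\<^bsub>A\<^esub>} \<subseteq> ev ` kernel"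
    using imageI[OF subspace_0[OF subspace_kernel], of ev] by simp
qed (auto simp: kernel_def)

lemma kernel_subset_preimage: "ideal I A \<Longrightarrow> kernel \<subseteq> {p. ev p \<in> I}"
  by (auto simp: kernel_def additive_subgroup.zero_closed ideal.axioms(1))

lemma preimage_mult: "ideal I A \<Longrightarrow> ev p \<in> I \<Longrightarrow> ev (q * p) \<in> I"
  by (simp add: ev_mult ideal.I_l_closed)

lemma scalars_eq: "scalars A = range (\<lambda>c. ev (sc c 1))"
  by (auto simp: scalars_def ev_sc)

lemma ev_image_eq:
  assumes "subspace I" "kernel \<subseteq> I" "subspace J" "kernel \<subseteq> J" "ev ` I = ev ` J"
  shows "I = J"
proof -
  have *: "I \<subseteq> J" if "subspace J" "kernel \<subseteq> J" "ev ` I \<subseteq> ev ` J" for I J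
  proof
    fix p assume "p \<in> I"
    then obtain q where q: "q \<in> J" "ev p = ev q" using \<open>ev ` I \<subseteq> ev ` J\<close> by blast
    then have "p - q \<in> J" using \<open>kernel \<subseteq> J\<close> by (auto simp: ev_eq_iff kernel_def)
    from subspace_add[OF \<open>subspace J\<close> this q(1)] show "p \<in> J" by simp
  qed
  show ?thesis using assms *[of J I] *[of I J] by auto
qed

text \<open>Dimension is defined inductively by adding one line at a time; in the covering ring this
  is one more vector at the end of the family.\<close>

lemma line_extension_image:
  "A.line_extension (scalars A) (ev v) (ev ` spanned_mod kernel b d) = ev ` spanned_mod kernel (b(d := v)) (Suc d)"
proof -
  have cb: "comb c (b(d := v)) (Suc d) = comb c b d + sc (c d) v" for c
    by simp
  show ?thesis
  proof (intro Set.set_eqI iffI)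
    fix a assume "a \<in> A.line_extension (scalars A) (ev v) (ev ` spanned_mod kernel b d)"
    then obtain c p where p: "p \<in> spanned_mod kernel b d" "a = ev (sc c 1) \<otimes>\<^bsub>A\<^esub> ev v \<oplus>\<^bsub>A\<^esub> ev p"
      by (auto simp: A.line_extension_mem_iff scalars_eq)
    obtain e where e: "p - comb e b d \<in> kernel" using p by (auto simp: spanned_mod_def)
    have a: "a = ev (sc c v + p)"
      unfolding p(2) ev_add ev_mult[symmetric] sc_one ..
    have "sc c v + p - comb (e(d := c)) (b(d := v)) (Suc d) = p - comb e b d"
      unfolding cb by simp
    then have "sc c v + p \<in> spanned_mod kernel (b(d := v)) (Suc d)"
      unfolding spanned_mod_def using e by (intro CollectI exI[of _ "e(d := c)"]) (simp only:)
    then show "a \<in> ev ` spanned_mod kernel (b(d := v)) (Suc d)" using a by blast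
  next
    fix a assume "a \<in> ev ` spanned_mod kernel (b(d := v)) (Suc d)"
    then obtain p e where p: "a = ev p" "p - comb e (b(d := v)) (Suc d) \<in> kernel"
      by (auto simp: spanned_mod_def)
    define q where "q = p - sc (e d) v"
    have "q - comb e b d = p - comb e (b(d := v)) (Suc d)"
      unfolding cb q_def by simp
    then have "q - comb e b d \<in> kernel" using p(2) by (simp only:)
    then have q: "q \<in> spanned_mod kernel b d" unfolding spanned_mod_def by blast
    have "p = sc (e d) 1 * v + q" by (simp add: q_def sc_one)
    then have "a = ev (sc (e d) 1) \<otimes>\<^bsub>A\<^esub> ev v \<oplus>\<^bsub>A\<^esub> ev q"
      using p(1) by (simp only: ev_add ev_mult)
    then show "a \<in> A.line_extension (scalars A) (ev v) (ev ` spanned_mod kernel b d)"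
      using q unfolding A.line_extension_mem_iff scalars_eq by blast
  qed
qed

lemma dimension_imp_basis:
  "A.dimension d (scalars A) E \<Longrightarrow> \<exists>b. E = ev ` spanned_mod kernel b d \<and>
    (\<forall>c. comb c b d \<in> kernel \<longrightarrow> (\<forall>i<d. c i = 0))"
proof (induct d "scalars A" E rule: A.dimension.induct)
  case zero_dim
  then show ?case using ev_kernel by (simp add: spanned_mod_def)
next
  case (Suc_dim v E d)
  from Suc_dim(4) obtain b where b0: "E = ev ` spanned_mod kernel b d \<and>
    (\<forall>c. comb c b d \<in> kernel \<longrightarrow> (\<forall>i<d. c i = 0))" by (rule exE)
  then have b: "E = ev ` spanned_mod kernel b d" by simp
  have b2: "c i = 0" if "comb c b d \<in> kernel" "i < d" for c i
    using b0 that by simp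
  obtain w where w: "ev w = v" by (rule ev_surj[OF Suc_dim(1)])
  have ind: "c i = 0" if c: "comb c (b(d := w)) (Suc d) \<in> kernel" and i: "i < Suc d" for c i
  proof -
    have c': "comb c b d + sc (c d) w \<in> kernel" using c by simp
    \<comment> \<open>Otherwise the new vector would lie in the span of the old ones modulo the
      kernel, although \<open>v\<close> is outside \<open>E\<close>.\<close>
    have "c d = 0"
    proof (rule ccontr)
      assume cd: "c d \<noteq> 0"
      have "sc (inverse (c d)) (comb c b d + sc (c d) w) \<in> kernel"
        by (rule subspace_scale[OF subspace_kernel c'])
      moreover have "sc (inverse (c d)) (comb c b d + sc (c d) w)
          = w - comb (\<lambda>i. - inverse (c d) * c i) b d"
        unfolding comb_scale using cd by (simp add: scale_right_distrib)
      ultimately have "w \<in> spanned_mod kernel b d"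
        unfolding spanned_mod_def by (intro CollectI exI[of _ "\<lambda>i. - inverse (c d) * c i"]) (simp only:)
      then have "v \<in> E" unfolding b w[symmetric] by (rule imageI)
      then show False using Suc_dim(2) by simp
    qed
    then show ?thesis using c' b2[of c i] i by (cases "i = d") auto
  qed
  show ?case
  proof (intro exI[of _ "b(d := w)"] conjI allI impI)
    show "A.line_extension (scalars A) v E = ev ` spanned_mod kernel (b(d := w)) (Suc d)"
      unfolding b w[symmetric] by (rule line_extension_image)
  qed (rule ind)
qed

lemma basis_imp_dimension:
  "(\<And>c i. comb c b d \<in> kernel \<Longrightarrow> i < d \<Longrightarrow> c i = 0) \<Longrightarrow>
    A.dimension d (scalars A) (ev ` spanned_mod kernel b d)"
proof (induction d)
  case 0
  then show ?case using ev_kernel by (simp add: spanned_mod_def)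
next
  case (Suc d)
  have IH: "A.dimension d (scalars A) (ev ` spanned_mod kernel b d)"
  proof (rule Suc.IH)
    fix c i assume "comb c b d \<in> kernel" "i < d"
    then show "c i = 0"
      using Suc.prems[of "c(d := 0)" i] by (auto cong: sum.cong_simp)
  qed
  have "ev (b d) \<notin> ev ` spanned_mod kernel b d"
  proof
    assume "ev (b d) \<in> ev ` spanned_mod kernel b d"
    then obtain p c where p: "ev (b d) = ev p" "p - comb c b d \<in> kernel" by (auto simp: spanned_mod_def)
    have "b d - p \<in> kernel" using p(1) by (simp add: ev_eq_iff kernel_def)
    from subspace_add[OF subspace_kernel this p(2)] have *: "b d - comb c b d \<in> kernel" by simp
    have "comb (\<lambda>i. if i = d then 1 else - c i) b (Suc d) = b d - comb c b d"
      by (simp add: sum_negf cong: sum.cong_simp)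
    then show False using Suc.prems[of "\<lambda>i. if i = d then 1 else - c i" d] * by simp
  qed
  from A.Suc_dim[OF ev_closed this IH] show ?case
    unfolding line_extension_image by simp
qed

lemma dimension_iff_basis:
  assumes I: "subspace I" "kernel \<subseteq> I"
  shows "A.dimension d (scalars A) (ev ` I) \<longleftrightarrow> (\<exists>b. basis_mod I kernel b d)"
proof
  assume "A.dimension d (scalars A) (ev ` I)"
  then obtain b where b: "ev ` I = ev ` spanned_mod kernel b d"
    "\<forall>c. comb c b d \<in> kernel \<longrightarrow> (\<forall>i<d. c i = 0)" using dimension_imp_basis by blast
  have "I = spanned_mod kernel b d"
    using I subspace_spanned_mod[OF subspace_kernel] spanned_mod_superset b(1) by (rule ev_image_eq)
  then show "\<exists>b. basis_mod I kernel b d"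
    using b(2) spanned_mod_base[OF subspace_kernel, of _ d b]
    by (intro exI[of _ b]) (auto simp: basis_mod_def spanned_mod_def)
next
  assume "\<exists>b. basis_mod I kernel b d"
  then obtain b where b: "basis_mod I kernel b d" by blast
  have "spanned_mod kernel b d \<subseteq> I"
    by (rule spanned_mod_subset[OF I]) (rule basis_modD(1)[OF b])
  then have "I = spanned_mod kernel b d" using basis_modD(2)[OF b] by blast
  moreover have "A.dimension d (scalars A) (ev ` spanned_mod kernel b d)"
    by (rule basis_imp_dimension) (rule basis_modD(3)[OF b])
  ultimately show "A.dimension d (scalars A) (ev ` I)" by simp
qed

text \<open>The same ring covers every quotient of A, with the preimage of the ideal as kernel.
  Dimensions in different quotients thus become statements about subspaces of one ring.\<close>

lemma cover_quot:
  assumes J: "ideal J A"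
  shows "cover sc (quot_alg A J) (\<lambda>p. J +>\<^bsub>A\<^esub> ev p)"
proof (intro cover.intro cover_axioms.intro)
  note q = quot_alg_hom[OF K_algebra J]
  note H = alg_hom_simps[OF q(1)]
  show "K_algebra (quot_alg A J)" by (rule K_algebra_image[OF K_algebra q])
  show "range (\<lambda>p. J +>\<^bsub>A\<^esub> ev p) = carrier (quot_alg A J)"
    unfolding q(2)[symmetric] ev_range[symmetric] by (simp add: image_image)
qed (simp_all add: typed_algebra_axioms ev_add ev_mult ev_sc alg_hom_simps[OF quot_alg_hom(1)[OF K_algebra J]])

lemma quotient_dim_iff:
  assumes I: "ideal I A" and J: "ideal J A" and JI: "J \<subseteq> I"
  shows "quotient_dim A I J d \<longleftrightarrow> (\<exists>b. basis_mod {p. ev p \<in> I} {p. ev p \<in> J} b d)"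
proof -
  interpret B: cover sc "quot_alg A J" "\<lambda>p. J +>\<^bsub>A\<^esub> ev p" by (rule cover_quot[OF J])
  have ker: "B.kernel = {p. ev p \<in> J}"
    unfolding B.kernel_def quot_alg_hom(3)[OF K_algebra J, symmetric]
    by (simp add: rcos_eq_iff[OF A.ring_axioms J] A.minus_eq)
  have im: "(\<lambda>a. J +>\<^bsub>A\<^esub> a) ` I = (\<lambda>p. J +>\<^bsub>A\<^esub> ev p) ` {p. ev p \<in> I}"
    using ev_surj ideal.Icarr[OF I] by (auto simp: image_iff)
  show ?thesis
    unfolding quotient_dim_def im ker[symmetric]
    by (rule B.dimension_iff_basis) (use subspace_preimage[OF I] JI ker in auto)
qed

end

section \<open>Powers of the maximal ideal in a local algebra\<close>

locale local_cover = cover sc A ev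
  for sc :: "'k::field \<Rightarrow> 'q::comm_ring_1 \<Rightarrow> 'q" and A :: "('k, 'a) module" and ev +
  assumes local_ring: "local_ring A"
begin

abbreviation "M \<equiv> max_ideal A"

lemma maximal_ideal: "maximalideal M A"
  using local_ring theI'[of "\<lambda>M. maximalideal M A"] by (simp add: local_ring_def max_ideal_def)

lemma maximal_ideal_unique: "maximalideal I A \<Longrightarrow> I = M"
  using local_ring maximal_ideal by (auto simp: local_ring_def)

lemma M_ideal: "ideal M A"
  using maximal_ideal by (rule maximalideal.axioms)

lemma ideal_pow_ideal: "ideal (ideal_pow A M i) A"
  by (induction i) (simp_all add: A.oneideal A.ideal_prod_is_ideal M_ideal)

lemma ideal_pow_1: "ideal_pow A M 1 = M"
proof
  show "ideal_pow A M 1 \<subseteq> M"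
    using A.ideal_prod_inter[OF A.oneideal M_ideal] by (simp add: One_nat_def)
  show "M \<subseteq> ideal_pow A M 1"
  proof
    fix a assume a: "a \<in> M"
    then have "\<one>\<^bsub>A\<^esub> \<otimes>\<^bsub>A\<^esub> a \<in> ideal_pow A M 1"
      unfolding One_nat_def ideal_pow.simps by (intro ideal_prod.prod) auto
    then show "a \<in> ideal_pow A M 1" using ideal.Icarr[OF M_ideal a] by simp
  qed
qed

definition pow :: "nat \<Rightarrow> 'q set" where
  "pow i = {p. ev p \<in> ideal_pow A M i}"

sublocale filtered_algebra sc kernel pow
proof
  show "p \<in> kernel \<Longrightarrow> q * p \<in> kernel" for p q by (simp add: kernel_def ev_mult)
  show "p \<in> pow i \<Longrightarrow> q * p \<in> pow i" for p q i
    using preimage_mult[OF ideal_pow_ideal] by (simp add: pow_def)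
  show "subspace (pow i)" for i unfolding pow_def by (rule subspace_preimage[OF ideal_pow_ideal])
  show "kernel \<subseteq> pow i" for i unfolding pow_def by (rule kernel_subset_preimage[OF ideal_pow_ideal])
  show "pow 0 = UNIV" by (simp add: pow_def)
  show "p \<in> pow i \<Longrightarrow> q \<in> pow 1 \<Longrightarrow> p * q \<in> pow (Suc i)" for p q i
    unfolding pow_def ideal_pow_1 by (simp add: ev_mult ideal_prod.prod)
  show "pow (Suc i) \<subseteq> S"
    if S: "subspace S" "kernel \<subseteq> S" and prod: "\<And>p q. p \<in> pow i \<Longrightarrow> q \<in> pow 1 \<Longrightarrow> p * q \<in> S" for S i
  proof -
    \<comment> \<open>As \<open>S\<close> contains the kernel, membership depends only on the image
      in A, and induction over the product ideal applies.\<close>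
    have eq: "q \<in> S" if "p \<in> S" "ev q = ev p" for p q
    proof -
      have "q - p \<in> S" using that(2) S(2) by (auto simp: ev_eq_iff kernel_def)
      from subspace_add[OF S(1) this that(1)] show ?thesis by simp
    qed
    have "\<exists>q\<in>S. ev q = a" if "a \<in> ideal_prod A (ideal_pow A M i) M" for a
      using that
    proof (induction rule: ideal_prod.induct)
      case (prod a b)
      obtain p q where "ev p = a" "ev q = b"
        using prod ideal.Icarr[OF ideal_pow_ideal] ideal.Icarr[OF M_ideal] ev_surj by metis
      then show ?case
        using prod \<open>\<And>p q. p \<in> pow i \<Longrightarrow> q \<in> pow 1 \<Longrightarrow> p * q \<in> S\<close>[of p q]
        unfolding pow_def ideal_pow_1 by (intro bexI[of _ "p * q"]) (auto simp: ev_mult)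
    next
      case (sum a b)
      then obtain p q where "p \<in> S" "q \<in> S" "ev p = a" "ev q = b" by blast
      then show ?case using subspace_add[OF S(1)] by (intro bexI[of _ "p + q"]) (auto simp: ev_add)
    qed
    then show ?thesis using eq by (fastforce simp: pow_def)
  qed
qed (rule subspace_kernel)

lemma hilbert_function_iff:
  "has_hilbert_function A H \<longleftrightarrow> (\<forall>i. \<exists>b. basis_mod (pow i) (pow (Suc i)) b (H i))"
proof -
  have "ideal_pow A M (Suc i) \<subseteq> ideal_pow A M i" for i
    using A.ideal_prod_inter[OF ideal_pow_ideal M_ideal] by auto
  from quotient_dim_iff[OF ideal_pow_ideal ideal_pow_ideal this] show ?thesis
    unfolding has_hilbert_function_def pow_def by (simp only:)
qed

lemma socle_eq: "Defs.socle A = ev ` annihilator"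
proof (intro Set.set_eqI iffI)
  fix a assume a: "a \<in> Defs.socle A"
  then obtain p where p: "ev p = a" using ev_surj by (auto simp: Defs.socle_def)
  have "p * x \<in> kernel" if "x \<in> pow 1" for x
    using a that unfolding pow_def ideal_pow_1 by (simp add: kernel_def ev_mult p Defs.socle_def)
  then show "a \<in> ev ` annihilator" using p by (auto simp: annihilator_def)
next
  fix a assume "a \<in> ev ` annihilator"
  then obtain p where p: "\<And>x. x \<in> pow 1 \<Longrightarrow> p * x \<in> kernel" "a = ev p"
    by (auto simp: annihilator_def)
  have "a \<otimes>\<^bsub>A\<^esub> b = \<zero>\<^bsub>A\<^esub>" if b: "b \<in> M" for b
  proof -
    obtain x where x: "ev x = b" using ev_surj ideal.Icarr[OF M_ideal b] by blast
    then have "x \<in> pow 1" using b unfolding pow_def ideal_pow_1 by simp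
    then show ?thesis using p x by (auto simp: kernel_def ev_mult)
  qed
  then show "a \<in> Defs.socle A" using p(2) by (simp add: Defs.socle_def)
qed

lemma gorenstein_iff: "gorenstein A \<longleftrightarrow> (\<exists>b. basis_mod annihilator kernel b 1)"
proof -
  have "subspace annihilator"
    unfolding annihilator_def
    by (rule subspaceI) (auto simp: distrib_right sc_mult subspace_0 subspace_add subspace_scale subspace_kernel)
  moreover have "kernel \<subseteq> annihilator"
    using Z_ideal by (auto simp: annihilator_def mult.commute)
  ultimately show ?thesis
    unfolding gorenstein_def socle_eq by (rule dimension_iff_basis)
qed

text \<open>The principal ideal of a non-unit is proper. Zorn's lemma enlarges it to a maximal
  ideal, which can only be M.\<close>

lemma unit_if_not_mem:
  assumes u: "u \<in> carrier A" "u \<notin> M"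
  shows "\<exists>r\<in>carrier A. r \<otimes>\<^bsub>A\<^esub> u = \<one>\<^bsub>A\<^esub>"
proof (rule ccontr)
  assume no: "\<not> ?thesis"
  define S where "S = {I. ideal I A \<and> u \<in> I \<and> \<one>\<^bsub>A\<^esub> \<notin> I}"
  have "PIdl\<^bsub>A\<^esub> u \<in> S"
    using no u A.cgenideal_ideal[OF u(1)] A.cgenideal_self[OF u(1)]
    by (auto simp: S_def cgenideal_def)
  then have ne: "S \<noteq> {}" by blast
  have "\<Union>C \<in> S" if C: "C \<noteq> {}" "subset.chain S C" for C
  proof -
    have "subset.chain {I. ideal I A} C" "\<forall>I\<in>C. u \<in> I \<and> \<one>\<^bsub>A\<^esub> \<notin> I"
      using C(2) by (auto simp: pred_on.chain_def S_def)
    then show ?thesis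
      using A.chain_Union_is_ideal[of C] C(1) by (auto simp: S_def)
  qed
  then obtain I where I: "I \<in> S" "\<And>J. J \<in> S \<Longrightarrow> I \<subseteq> J \<Longrightarrow> J = I"
    using subset_Zorn_nonempty[OF ne] by metis
  have "maximalideal I A"
  proof (rule maximalidealI)
    show "ideal I A" using I by (simp add: S_def)
    show "carrier A \<noteq> I" using I A.one_closed by (auto simp: S_def)
    show "J = I \<or> J = carrier A" if J: "ideal J A" "I \<subseteq> J" "J \<subseteq> carrier A" for J
      using I(2)[of J] J ideal.one_imp_carrier[OF J(1)] I(1) by (auto simp: S_def)
  qed
  then have "I = M" by (rule maximal_ideal_unique)
  then show False using I(1) u by (simp add: S_def)
qed

text \<open>Otherwise there are \<open>x\<^bsub>i+1\<^esub> = x\<^sub>i y\<^sub>i\<close> with \<open>y\<^sub>i \<in> M\<close> and \<open>x\<^sub>i M\<^sup>k \<noteq> 0\<close>. The descending chain of the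
  ideals \<open>(x\<^sub>i)\<close> stops, say \<open>x\<^sub>n = s x\<^sub>n y\<^sub>n\<close>, and \<open>1 - s y\<^sub>n\<close> is a unit.\<close>

lemma nilpotent:
  assumes art: "artinian A" and stable: "pow k \<subseteq> pow (Suc k)"
  shows "pow k \<subseteq> kernel"
proof (rule ccontr)
  assume "\<not> ?thesis"
  then have start: "\<not> (\<forall>p\<in>pow k. 1 * p \<in> kernel)" by auto
  have step: "\<exists>y\<in>pow 1. \<not> (\<forall>p\<in>pow k. x * y * p \<in> kernel)" if x: "\<not> (\<forall>p\<in>pow k. x * p \<in> kernel)" for x
  proof (rule ccontr)
    assume "\<not> ?thesis"
    then have xy: "\<And>y p. y \<in> pow 1 \<Longrightarrow> p \<in> pow k \<Longrightarrow> x * (p * y) \<in> kernel" by (auto simp: ac_simps)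
    \<comment> \<open>An \<open>x\<close> that kills all products of \<open>pow k\<close> with
      \<open>pow 1\<close> kills the next power, and by stability \<open>pow k\<close>
      itself.\<close>
    have "pow (Suc k) \<subseteq> {p. x * p \<in> kernel}"
    proof (rule N_least)
      show "subspace {p. x * p \<in> kernel}"
        by (rule subspaceI) (auto simp: distrib_left mult_sc subspace_0 subspace_add subspace_scale subspace_kernel)
    qed (use Z_ideal xy in auto)
    then show False using x stable by blast
  qed
  define P where "P x \<longleftrightarrow> \<not> (\<forall>p\<in>pow k. x * p \<in> kernel)" for x
  have "\<exists>f. \<forall>i. P (f i) \<and> (\<exists>y\<in>pow 1. f (Suc i) = f i * y)"
  proof (rule dependent_nat_choice)
    show "\<exists>x. P x" using start unfolding P_def by (rule exI)
    show "\<exists>y. P y \<and> (\<exists>z\<in>pow 1. y = x * z)" if "P x" for x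
      using step[of x] that unfolding P_def by blast
  qed
  then obtain f where f: "\<And>i. P (f i)" "\<And>i. \<exists>y\<in>pow 1. f (Suc i) = f i * y" by blast
  define I where "I i = PIdl\<^bsub>A\<^esub> (ev (f i))" for i
  have "I (Suc i) \<subseteq> I i" for i
  proof -
    obtain y where "f (Suc i) = f i * y" using f(2) by blast
    then have "ev (f (Suc i)) = ev y \<otimes>\<^bsub>A\<^esub> ev (f i)" by (simp add: mult.commute flip: ev_mult)
    then have "ev (f (Suc i)) \<in> I i" by (auto simp: I_def cgenideal_def)
    then show ?thesis
      unfolding I_def using A.cgenideal_ideal by (intro A.cgenideal_minimal) auto
  qed
  moreover have "ideal (I i) A" for i unfolding I_def by (rule A.cgenideal_ideal) simp
  ultimately obtain n where n: "\<And>k. k \<ge> n \<Longrightarrow> I k = I n"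
    using art unfolding artinian_def by metis
  obtain y where y: "y \<in> pow 1" "f (Suc n) = f n * y" using f(2) by blast
  have "ev (f n) \<in> I (Suc n)" using n[of "Suc n"] A.cgenideal_self by (simp add: I_def)
  then obtain r where r: "r \<in> carrier A" "ev (f n) = r \<otimes>\<^bsub>A\<^esub> ev (f (Suc n))"
    by (auto simp: I_def cgenideal_def)
  obtain s where s: "ev s = r" using ev_surj[OF r(1)] by blast
  have k: "f n * (1 - s * y) \<in> kernel"
  proof -
    have "ev (f n) = ev (s * (f n * y))" using r(2) s y(2) by (simp add: ev_mult)
    then have "f n - s * (f n * y) \<in> kernel" by (simp add: ev_eq_iff kernel_def)
    then show ?thesis by (simp add: algebra_simps)
  qed
  have "1 - s * y \<notin> pow 1"
  proof
    assume "1 - s * y \<in> pow 1"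
    from subspace_add[OF N_subspace this N_ideal[OF y(1), of s]] have "1 \<in> pow 1" by simp
    then have "\<one>\<^bsub>A\<^esub> \<in> M" unfolding pow_def ideal_pow_1 by simp
    then show False
      using ideal.one_imp_carrier[OF M_ideal] maximalideal.I_notcarr[OF maximal_ideal] by auto
  qed
  then have "ev (1 - s * y) \<notin> M" unfolding pow_def ideal_pow_1 by simp
  then obtain t where t: "ev t \<otimes>\<^bsub>A\<^esub> ev (1 - s * y) = \<one>\<^bsub>A\<^esub>"
    using unit_if_not_mem[OF ev_closed] ev_surj by metis
  have "t * (f n * (1 - s * y)) \<in> kernel" by (rule Z_ideal[OF k])
  then have "ev (f n) \<otimes>\<^bsub>A\<^esub> (ev t \<otimes>\<^bsub>A\<^esub> ev (1 - s * y)) = \<zero>\<^bsub>A\<^esub>"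
    by (simp add: kernel_def ac_simps flip: ev_mult)
  then have "f n \<in> kernel" using t by (simp add: kernel_def)
  then have "p * f n \<in> kernel" for p by (rule Z_ideal)
  then show False using f(1)[of n] by (auto simp: P_def mult.commute)
qed

end

section \<open>Cubic forms\<close>

definition mono_degree :: "mono \<Rightarrow> nat" where
  "mono_degree e = (\<Sum>i\<in>Poly_Mapping.keys e. Poly_Mapping.lookup e i)"

abbreviation mono_var :: "nat \<Rightarrow> mono" where
  "mono_var i \<equiv> Poly_Mapping.single i 1"

lemma mono_degree_superset:
  "finite S \<Longrightarrow> Poly_Mapping.keys e \<subseteq> S \<Longrightarrow> mono_degree e = (\<Sum>i\<in>S. Poly_Mapping.lookup e i)"
  unfolding mono_degree_def by (rule sum.mono_neutral_left) (auto simp: in_keys_iff)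

lemma mono_degree_add: "mono_degree (a + b) = mono_degree a + mono_degree b"
  using mono_degree_superset[of "Poly_Mapping.keys a \<union> Poly_Mapping.keys b"]
  by (simp add: keys_mono_add lookup_add sum.distrib)

lemma mono_degree_var [simp]: "mono_degree (mono_var i) = 1"
  by (simp add: mono_degree_def)

lemma mono_degree_0 [simp]: "mono_degree 0 = 0"
  by (simp add: mono_degree_def)

lemma mono_degree_eq_0_iff [simp]: "mono_degree e = 0 \<longleftrightarrow> e = 0"
proof
  assume 0: "mono_degree e = 0"
  show "e = 0"
  proof (rule poly_mapping_eqI)
    show "Poly_Mapping.lookup e i = Poly_Mapping.lookup 0 i" for i
      using 0 by (cases "i \<in> Poly_Mapping.keys e") (auto simp: mono_degree_def in_keys_iff)
  qed
qed simp

lemma mono_degree_SucE: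
  assumes "mono_degree e = Suc d"
  obtains i e' where "e = e' + mono_var i" "mono_degree e' = d"
proof -
  have "Poly_Mapping.keys e \<noteq> {}" using assms by (auto simp: mono_degree_def)
  then obtain i where i: "i \<in> Poly_Mapping.keys e" by blast
  have e: "e = (e - mono_var i) + mono_var i"
    using i by (intro poly_mapping_eqI) (auto simp: lookup_add lookup_minus lookup_single when_def in_keys_iff)
  have "mono_degree e = mono_degree (e - mono_var i) + 1"
    using mono_degree_add[of "e - mono_var i" "mono_var i"] unfolding e[symmetric] by simp
  then show ?thesis using that[OF e] assms by simp
qed

lemma keys_mono_var [simp]: "Poly_Mapping.keys (mono_var i) = {i}"
  by simp

lemma mono_degree_1E:
  assumes "mono_degree e = 1"
  obtains i where "e = mono_var i"
proof -
  have "mono_degree e = Suc 0" using assms by simp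
  then obtain e' i where e: "e = e' + mono_var i" "mono_degree e' = 0" by (rule mono_degree_SucE)
  from e(2) have "e' = 0" by (simp only: mono_degree_eq_0_iff)
  then show ?thesis using that[of i] e(1) by simp
qed

lemma mono_degree_2E:
  assumes "mono_degree e = 2"
  obtains i j where "e = mono_var i + mono_var j"
proof -
  have "mono_degree e = Suc 1" using assms by simp
  then obtain e' j where e: "e = e' + mono_var j" "mono_degree e' = 1" by (rule mono_degree_SucE)
  from e(2) obtain i where "e' = mono_var i" by (rule mono_degree_1E)
  then show ?thesis using that[of i j] e(1) by simp
qed

lemma mono_degree_3E:
  assumes "mono_degree e = 3"
  obtains i j k where "e = mono_var i + mono_var j + mono_var k"
proof -
  have "mono_degree e = Suc 2" using assms by simp
  then obtain e' k where e: "e = e' + mono_var k" "mono_degree e' = 2" by (rule mono_degree_SucE)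
  from e(2) obtain i j where "e' = mono_var i + mono_var j" by (rule mono_degree_2E)
  then show ?thesis using that[of i j k] e(1) by simp
qed

definition monos_le :: "nat \<Rightarrow> nat \<Rightarrow> mono set" where
  "monos_le m d = {e. Poly_Mapping.keys e \<subseteq> {..<m} \<and> mono_degree e \<le> d}"

lemma finite_monos_le: "finite (monos_le m d)"
proof (induction d)
  case 0
  have "monos_le m 0 \<subseteq> {0}" by (auto simp: monos_le_def)
  then show ?case by (rule finite_subset) simp
next
  case (Suc d)
  have "monos_le m (Suc d) \<subseteq> monos_le m d \<union> (\<lambda>(e, i). e + mono_var i) ` (monos_le m d \<times> {..<m})"
  proof
    fix e assume e: "e \<in> monos_le m (Suc d)"
    show "e \<in> monos_le m d \<union> (\<lambda>(e, i). e + mono_var i) ` (monos_le m d \<times> {..<m})"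
    proof (cases "mono_degree e \<le> d")
      case False
      then have "mono_degree e = Suc d" using e by (simp add: monos_le_def)
      then obtain e' i where "e = e' + mono_var i" "mono_degree e' = d" by (rule mono_degree_SucE)
      then show ?thesis using e
        by (intro UnI2 image_eqI[of _ _ "(e', i)"]) (auto simp: monos_le_def keys_mono_add)
    qed (use e in \<open>auto simp: monos_le_def\<close>)
  qed
  then show ?case by (rule finite_subset) (simp add: Suc)
qed

section \<open>Nondegenerate cubic forms and the coefficients of F\<close>

lemma form3_iff:
  "form3 n p \<longleftrightarrow> (\<forall>e. Poly_Mapping.lookup p e \<noteq> 0 \<longrightarrow> Poly_Mapping.keys e \<subseteq> {..<n} \<and> mono_degree e = 3)"
  by (auto simp: form3_def mpolys_def mono_degree_def in_keys_iff)

lemma lookup_mvar: "Poly_Mapping.lookup (mvar i) e = (if e = mono_var i then 1 else 0)"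
  by (simp add: mvar_def lookup_single when_def)

lemma mono_var_eq_iff [simp]: "mono_var i = mono_var j \<longleftrightarrow> i = j"
  by (metis keys_mono_var singleton_inject)

lemma mono_fact_var: "mono_fact (mono_var i) = 1"
  by (simp add: mono_fact_def)

lemma linear_poly_eqI:
  assumes "\<And>e. Poly_Mapping.lookup p e \<noteq> 0 \<Longrightarrow> \<exists>i<n. e = mono_var i"
  shows "p = (\<Sum>i<n. mscale (Poly_Mapping.lookup p (mono_var i)) (mvar i))"
proof (rule poly_mapping_eqI)
  fix e
  have *: "Poly_Mapping.lookup (\<Sum>i<n. mscale (Poly_Mapping.lookup p (mono_var i)) (mvar i)) e
      = (\<Sum>i<n. if e = mono_var i then Poly_Mapping.lookup p e else 0)"
    unfolding lookup_sum_mono by (intro sum.cong) (auto simp: lookup_mscale lookup_mvar)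
  show "Poly_Mapping.lookup p e = Poly_Mapping.lookup (\<Sum>i<n. mscale (Poly_Mapping.lookup p (mono_var i)) (mvar i)) e"
  proof (cases "\<exists>i<n. e = mono_var i")
    case True
    then obtain i where "i < n" "e = mono_var i" by blast
    then show ?thesis unfolding * by simp
  next
    case False
    then have z: "Poly_Mapping.lookup p e = 0" using assms by blast
    then have "(\<Sum>i<n. if e = mono_var i then Poly_Mapping.lookup p e else 0) = 0"
      by (intro sum.neutral ballI) (simp only: z if_cancel)
    with z show ?thesis unfolding * by (simp only:)
  qed
qed

abbreviation second_partials :: "nat \<Rightarrow> 'k::field mpoly \<Rightarrow> 'k mpoly set" where
  "second_partials n p \<equiv> {pdiff i (pdiff j p) | i j. i < n \<and> j < n}"

text \<open>Two shifts by a variable turn a cubic form into a linear one, and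
  \<open>mono_fact\<close> is 1 on variables, so divided and ordinary coefficients agree
  there.\<close>

lemma second_partial_form3:
  fixes p :: "'k::field_char_0 mpoly"
  assumes p: "form3 n p"
  shows "pdiff i (pdiff j p) =
    (\<Sum>l<n. mscale (divided_coeff p (mono_var l + mono_var i + mono_var j)) (mvar l))"
proof -
  have dc: "divided_coeff (pdiff i (pdiff j p)) e = divided_coeff p (e + mono_var i + mono_var j)" for e
    by (simp add: divided_coeff_pdiff)
  have "\<exists>l<n. e = mono_var l" if "Poly_Mapping.lookup (pdiff i (pdiff j p)) e \<noteq> 0" for e
  proof -
    have "divided_coeff p (e + mono_var i + mono_var j) \<noteq> 0"
      using that unfolding dc[symmetric] by (simp add: divided_coeff_def mono_fact_nonzero)
    then have "Poly_Mapping.lookup p (e + mono_var i + mono_var j) \<noteq> 0"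
      by (auto simp: divided_coeff_def)
    then have "Poly_Mapping.keys (e + mono_var i + mono_var j) \<subseteq> {..<n}"
      "mono_degree (e + mono_var i + mono_var j) = 3"
      using p unfolding form3_iff by blast+
    then have "mono_degree e = 1" "Poly_Mapping.keys e \<subseteq> {..<n}"
      by (auto simp: mono_degree_add keys_mono_add)
    then show ?thesis by (elim mono_degree_1E) auto
  qed
  then have "pdiff i (pdiff j p) =
      (\<Sum>l<n. mscale (Poly_Mapping.lookup (pdiff i (pdiff j p)) (mono_var l)) (mvar l))"
    by (rule linear_poly_eqI)
  moreover have "Poly_Mapping.lookup (pdiff i (pdiff j p)) (mono_var l) =
      divided_coeff p (mono_var l + mono_var i + mono_var j)" for l
    using dc[of "mono_var l"] by (simp add: divided_coeff_def mono_fact_var)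
  ultimately show ?thesis by simp
qed

lemma independent_mvars: "mpoly.independent (mvar ` {..<n} :: 'k::field mpoly set)"
  and card_mvars: "card (mvar ` {..<n} :: 'k::field mpoly set) = n"
proof -
  have inj: "inj_on (mvar :: nat \<Rightarrow> 'k mpoly) {..<n}"
  proof (rule inj_onI)
    fix i j assume "(mvar i :: 'k mpoly) = mvar j"
    then have "Poly_Mapping.lookup (mvar i :: 'k mpoly) (mono_var i) = Poly_Mapping.lookup (mvar j) (mono_var i)"
      by simp
    then show "i = j" by (simp add: lookup_mvar split: if_splits)
  qed
  then show "card (mvar ` {..<n} :: 'k mpoly set) = n" by (simp add: card_image)
  show "mpoly.independent (mvar ` {..<n} :: 'k mpoly set)"
  proof (rule mpoly.independent_if_scalars_zero)
    fix f :: "'k mpoly \<Rightarrow> 'k" and x :: "'k mpoly"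
    assume f: "(\<Sum>x\<in>mvar ` {..<n}. mscale (f x) x) = 0" and x: "x \<in> mvar ` {..<n}"
    obtain j where j: "j < n" "x = mvar j" using x by blast
    have "Poly_Mapping.lookup (\<Sum>i<n. mscale (f (mvar i)) (mvar i)) (mono_var j) = 0"
    proof -
      have "(\<Sum>x\<in>mvar ` {..<n}. mscale (f x) x) = (\<Sum>i<n. mscale (f (mvar i)) (mvar i))"
        by (rule sum.reindex_cong[OF inj]) auto
      then show ?thesis using f by simp
    qed
    moreover have "Poly_Mapping.lookup (\<Sum>i<n. mscale (f (mvar i)) (mvar i)) (mono_var j)
        = (\<Sum>i<n. if i = j then f (mvar j) else 0)"
      unfolding lookup_sum_mono by (intro sum.cong) (auto simp: lookup_mscale lookup_mvar)
    ultimately show "f x = 0" using j by simp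
  qed simp
qed

lemma second_partials_span:
  assumes "form3 n (p :: 'k::field_char_0 mpoly)"
  shows "mpoly_span (second_partials n p) \<subseteq> mpoly_span (mvar ` {..<n})"
proof (rule mpoly.span_minimal)
  show "second_partials n p \<subseteq> mpoly_span (mvar ` {..<n})"
    using assms by (auto simp: second_partial_form3 intro!: mpoly.span_sum mpoly.span_scale intro: mpoly.span_base)
qed simp

text \<open>All second partials lie in the n-dimensional space of linear forms, so full dimension
  means that every variable is reached. The vectors \<open>b\<close> of a normal form correspond to
  these memberships.\<close>

lemma nondegenerate_form3_iff:
  "nondegenerate_form3 n (p :: 'k::field_char_0 mpoly) \<longleftrightarrow>
    form3 n p \<and> (\<forall>j<n. mvar j \<in> mpoly_span (second_partials n p))"
proof (cases "form3 n p")
  case True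
  let ?S = "mpoly_span (second_partials n p)" and ?Y = "mvar ` {..<n} :: 'k mpoly set"
  have "mpoly_dim ?S = n \<longleftrightarrow> (\<forall>j<n. mvar j \<in> ?S)"
  proof
    assume dim: "mpoly_dim ?S = n"
    obtain B where B: "B \<subseteq> ?S" "mpoly.independent B" "?S \<subseteq> mpoly_span B" "card B = mpoly_dim ?S"
      by (rule mpoly.basis_exists[of ?S])
    have SB: "?S = mpoly_span B"
      by (rule subset_antisym[OF B(3) mpoly.span_minimal[OF B(1) mpoly.subspace_span]])
    have BY: "B \<subseteq> mpoly_span ?Y" using B(1) second_partials_span[OF True] by blast
    show "\<forall>j<n. mvar j \<in> ?S"
    proof (intro allI impI, rule ccontr)
      fix j assume j: "j < n" "mvar j \<notin> ?S"
      then have nB: "mvar j \<notin> B" using B(1) by blast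
      have "mvar j \<notin> mpoly_span B" using j(2) unfolding SB .
      then have ind: "mpoly.independent (insert (mvar j) B)"
        using B(2) by (simp add: mpoly.independent_insert)
      have "mvar j \<in> mpoly_span ?Y" using j(1) by (intro mpoly.span_base) simp
      then have "insert (mvar j) B \<subseteq> mpoly_span ?Y" using BY by simp
      from mpoly.independent_span_bound[OF _ ind this]
      have "finite (insert (mvar j) B) \<and> card (insert (mvar j) B) \<le> card ?Y" by simp
      then have "Suc (card B) \<le> card ?Y" using nB by (auto simp: card_insert_disjoint)
      then show False using B(4) dim card_mvars[where ?'k = 'k, of n] by simp
    qed
  next
    assume "\<forall>j<n. mvar j \<in> ?S"
    then have "mpoly_span ?Y \<subseteq> ?S" by (intro mpoly.span_minimal image_subsetI mpoly.subspace_span) simp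
    then have "?S = mpoly_span ?Y" by (rule subset_antisym[OF second_partials_span[OF True]])
    then show "mpoly_dim ?S = n"
      by (simp only: mpoly.dim_span_eq_card_independent[OF independent_mvars] card_mvars)
  qed
  then show ?thesis using True by (simp add: nondegenerate_form3_def)
qed (simp add: nondegenerate_form3_def)

lemma divided_coeff_mvar_power2:
  "divided_coeff ((mvar i)\<^sup>2 :: 'k::field_char_0 mpoly) e = (if e = mono_var i + mono_var i then 2 else 0)"
proof -
  have "(mvar i)\<^sup>2 = (Poly_Mapping.single (mono_var i + mono_var i) 1 :: 'k mpoly)"
    by (simp add: mvar_def power2_eq_square mult_single)
  moreover have "mono_fact (mono_var i + mono_var i) = (2 :: 'k)"
    by (simp add: mono_fact_plus_single mono_fact_var)
  ultimately show ?thesis by (auto simp: divided_coeff_def lookup_single when_def)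
qed

lemma mono_var_add_self_eq_iff:
  "mono_var i + mono_var j = mono_var k + mono_var k \<longleftrightarrow> i = k \<and> j = k"
proof
  assume "mono_var i + mono_var j = mono_var k + mono_var k"
  then have "Poly_Mapping.keys (mono_var i + mono_var j) = Poly_Mapping.keys (mono_var k + mono_var k)"
    by (rule arg_cong)
  then show "i = k \<and> j = k" unfolding keys_mono_add by auto
qed simp

text \<open>The squares contribute in degree 2 only and \<open>F3\<close> in degree 3 only. The
  facts mirror the clauses of \<open>normal_form\<close> on products of generators.\<close>

lemma divided_coeff_normal_poly:
  fixes F3 :: "'k::field_char_0 mpoly" and m n :: nat
  defines "G \<equiv> divided_coeff (F3 + (\<Sum>i = n..<m. (mvar i)\<^sup>2))"
  assumes F3: "form3 n F3" and nm: "n \<le> m"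
  shows "G e \<noteq> 0 \<Longrightarrow> Poly_Mapping.keys e \<subseteq> {..<m} \<and> (mono_degree e = 2 \<or> mono_degree e = 3)"
    "G (mono_var i + mono_var j) = (if i = j \<and> n \<le> i \<and> i < m then 2 else 0)"
    "mono_degree e = 3 \<Longrightarrow> G e = divided_coeff F3 e"
    "mono_degree e = 3 \<Longrightarrow> \<not> Poly_Mapping.keys e \<subseteq> {..<n} \<Longrightarrow> G e = 0"
proof -
  have G: "G e = divided_coeff F3 e + (\<Sum>i = n..<m. if e = mono_var i + mono_var i then 2 else 0)" for e
    by (simp add: G_def divided_coeff_add divided_coeff_sum divided_coeff_mvar_power2)
  have F: "Poly_Mapping.keys e \<subseteq> {..<n} \<and> mono_degree e = 3" if "divided_coeff F3 e \<noteq> 0" for e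
  proof -
    have "Poly_Mapping.lookup F3 e \<noteq> 0" using that by (auto simp: divided_coeff_def)
    then show ?thesis using F3 unfolding form3_iff by blast
  qed
  show "G (mono_var i + mono_var j) = (if i = j \<and> n \<le> i \<and> i < m then 2 else 0)"
  proof -
    have "divided_coeff F3 (mono_var i + mono_var j) = 0"
      using F[of "mono_var i + mono_var j"] by (auto simp: mono_degree_add)
    moreover have "(\<Sum>k = n..<m. if mono_var i + mono_var j = mono_var k + mono_var k then 2 else 0)
        = (\<Sum>k = n..<m. if k = i then (if i = j then 2 else 0) else (0::'k))"
      unfolding mono_var_add_self_eq_iff by (intro sum.cong) auto
    ultimately show ?thesis unfolding G by auto
  qed
  show G3: "G e = divided_coeff F3 e" if "mono_degree e = 3"
  proof -
    have "e \<noteq> mono_var i + mono_var i" for i using that by (auto simp: mono_degree_add)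
    then show ?thesis unfolding G by simp
  qed
  show "G e = 0" if "mono_degree e = 3" "\<not> Poly_Mapping.keys e \<subseteq> {..<n}"
    using G3[OF that(1)] F[of e] that(2) by auto
  show "Poly_Mapping.keys e \<subseteq> {..<m} \<and> (mono_degree e = 2 \<or> mono_degree e = 3)" if "G e \<noteq> 0"
  proof (cases "divided_coeff F3 e = 0")
    case False
    then show ?thesis using F[OF False] nm by auto
  next
    case True
    then have "(\<Sum>i = n..<m. if e = mono_var i + mono_var i then 2 else 0) \<noteq> (0 :: 'k)"
      using that unfolding G by simp
    then obtain i where i: "i \<in> {n..<m}" "(if e = mono_var i + mono_var i then 2 else 0) \<noteq> (0 :: 'k)"
      by (rule sum.not_neutral_contains_not_neutral)
    then have "e = mono_var i + mono_var i" by presburger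
    with i(1) show ?thesis by (auto simp: mono_degree_add keys_mono_add)
  qed
qed

section \<open>Monomials as power series and maps out of the power series ring\<close>

definition mono_series :: "mono \<Rightarrow> 'k::field pseries" where
  "mono_series a = (\<lambda>e. if e = a then 1 else 0)"

lemma mono_series_closed: "Poly_Mapping.keys a \<subseteq> {..<m} \<Longrightarrow> mono_series a \<in> carrier (pseries_ring m)"
  by (simp add: mono_series_def pseries_ring_sel(1))

lemma contract_mono_series:
  "finite {e. G e \<noteq> 0} \<Longrightarrow> contract G (mono_series a) b = G (a + b)"
  unfolding mono_series_def using contract_single[of G a 1 b] by simp

lemma ps_mult_mono_series:
  "ps_mult (mono_series a) (mono_series b) = (mono_series (a + b) :: 'k::field pseries)"
proof
  fix e
  have "ps_mult (mono_series a) (mono_series b) e =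
      (\<Sum>p\<in>{p. fst p + snd p = e}. if p = (a, b) then 1 else 0 :: 'k)"
    unfolding ps_mult_def mono_series_def split_beta by (intro sum.cong) (auto simp: prod_eq_iff)
  also have "\<dots> = (mono_series (a + b) e :: 'k)"
    by (subst sum.delta) (auto simp: mono_series_def finite_mono_splits_fst_snd)
  finally show "ps_mult (mono_series a) (mono_series b) e = (mono_series (a + b) e :: 'k)" .
qed

text \<open>The constant term of (x^b f) \<circ> F is the divided coefficient of f \<circ> F at b.
  The linear form that sends f to (f \<circ> F)(0) therefore recovers the whole action.\<close>

lemma contract_ps_mult_mono_series:
  fixes G :: "mono \<Rightarrow> 'k::field"
  assumes fin: "finite {e. G e \<noteq> 0}"
  shows "contract G (ps_mult f (mono_series b)) 0 = contract G f b"
proof -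
  have "contract G (ps_mult f (mono_series b)) 0 = (\<Sum>c\<in>divisors G. if c = b then contract G f b else 0)"
    unfolding contract_ps_mult[OF fin] mono_series_def by (intro sum.cong) auto
  also have "\<dots> = contract G f b"
  proof (cases "b \<in> divisors G")
    case False
    then have "contract G f b = 0"
      unfolding contract_def by (intro sum.neutral) (auto simp: divisors_def ac_simps)
    then show ?thesis by (simp only: if_cancel sum.neutral_const)
  qed (simp add: finite_divisors[OF fin])
  finally show ?thesis .
qed

text \<open>By additivity two maps have the same fibres as soon as they have the same
  kernel.\<close>

lemma alg_iso_A_F_iff:
  fixes A :: "('k::field_char_0, 'a) module"
  assumes A: "K_algebra A"
  shows "alg_iso A (A_F m F) \<longleftrightarrow> (\<exists>\<pi>\<in>alg_hom (pseries_ring m) A.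
    \<pi> ` carrier (pseries_ring m) = carrier A \<and>
    (\<forall>f\<in>carrier (pseries_ring m). \<pi> f = \<zero>\<^bsub>A\<^esub> \<longleftrightarrow> f \<in> Ann m F))"
proof -
  let ?R = "pseries_ring m :: ('k, 'k pseries) module"
  interpret R: K_alg ?R by (rule K_alg.intro) (rule pseries_K_algebra)
  interpret A: K_alg A by (rule K_alg.intro) (rule A)
  note Q = quot_alg_hom[OF pseries_K_algebra Ann_ideal, of m F]
  have fib: "(\<forall>f\<in>carrier ?R. \<forall>g\<in>carrier ?R. \<pi> f = \<pi> g \<longleftrightarrow> Ann m F +>\<^bsub>?R\<^esub> f = Ann m F +>\<^bsub>?R\<^esub> g)
      \<longleftrightarrow> (\<forall>f\<in>carrier ?R. \<pi> f = \<zero>\<^bsub>A\<^esub> \<longleftrightarrow> f \<in> Ann m F)" if \<pi>: "\<pi> \<in> alg_hom ?R A" for \<pi>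
  proof -
    interpret \<pi>: ring_hom_ring ?R A \<pi>
      using \<pi> by (intro ring_hom_ringI2 R.ring_axioms A.ring_axioms) (simp add: alg_hom_def)
    have eq: "\<pi> f = \<pi> g \<longleftrightarrow> \<pi> (f \<ominus>\<^bsub>?R\<^esub> g) = \<zero>\<^bsub>A\<^esub>" if "f \<in> carrier ?R" "g \<in> carrier ?R" for f g
      using that by (simp add: R.minus_eq) (simp flip: A.minus_eq)
    show ?thesis
    proof
      assume L: "\<forall>f\<in>carrier ?R. \<forall>g\<in>carrier ?R. \<pi> f = \<pi> g \<longleftrightarrow> Ann m F +>\<^bsub>?R\<^esub> f = Ann m F +>\<^bsub>?R\<^esub> g"
      show "\<forall>f\<in>carrier ?R. \<pi> f = \<zero>\<^bsub>A\<^esub> \<longleftrightarrow> f \<in> Ann m F"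
      proof
        fix f assume f: "f \<in> carrier ?R"
        have "\<pi> f = \<zero>\<^bsub>A\<^esub> \<longleftrightarrow> \<pi> f = \<pi> \<zero>\<^bsub>?R\<^esub>" by simp
        also have "\<dots> \<longleftrightarrow> Ann m F +>\<^bsub>?R\<^esub> f = Ann m F +>\<^bsub>?R\<^esub> \<zero>\<^bsub>?R\<^esub>" using L f R.zero_closed by blast
        also have "\<dots> \<longleftrightarrow> f \<in> Ann m F"
          using rcos_eq_iff[OF R.ring_axioms Ann_ideal f R.zero_closed] f by (simp add: R.minus_eq)
        finally show "\<pi> f = \<zero>\<^bsub>A\<^esub> \<longleftrightarrow> f \<in> Ann m F" .
      qed
    next
      assume "\<forall>f\<in>carrier ?R. \<pi> f = \<zero>\<^bsub>A\<^esub> \<longleftrightarrow> f \<in> Ann m F"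
      then show "\<forall>f\<in>carrier ?R. \<forall>g\<in>carrier ?R. \<pi> f = \<pi> g \<longleftrightarrow> Ann m F +>\<^bsub>?R\<^esub> f = Ann m F +>\<^bsub>?R\<^esub> g"
        using rcos_eq_iff[OF R.ring_axioms Ann_ideal] eq by simp
    qed
  qed
  show ?thesis
    unfolding A_F_def alg_iso_iff_same_fibres[OF pseries_K_algebra A Q(1,2)] using fib by blast
qed

section \<open>Normal forms and inverse systems\<close>

definition mono_eval :: "nat \<Rightarrow> (nat \<Rightarrow> 'q::comm_monoid_mult) \<Rightarrow> mono \<Rightarrow> 'q" where
  "mono_eval m x e = (\<Prod>i<m. x i ^ Poly_Mapping.lookup e i)"

lemma mono_eval_0 [simp]: "mono_eval m x 0 = 1"
  by (simp add: mono_eval_def)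

lemma mono_eval_add: "mono_eval m x (a + b) = mono_eval m x a * mono_eval m x b"
  by (simp add: mono_eval_def lookup_add power_add prod.distrib)

lemma mono_eval_var: "i < m \<Longrightarrow> mono_eval m x (mono_var i) = x i"
proof -
  assume i: "i < m"
  have "mono_eval m x (mono_var i) = (\<Prod>j<m. if j = i then x i else 1)"
    unfolding mono_eval_def by (intro prod.cong) (auto simp: lookup_single)
  then show ?thesis using i by simp
qed

locale ac_local_cover = local_cover sc A ev
  for sc :: "'k::{alg_closed_field, field_char_0} \<Rightarrow> 'q::comm_ring_1 \<Rightarrow> 'q"
    and A :: "('k, 'a) module" and ev
begin

sublocale ac_filtered_algebra sc kernel pow ..

lemma normal_form_iff:
  assumes art: "artinian A" and n: "1 \<le> n" "n < m"
  shows "gorenstein A \<and> has_hilbert_function A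
      (\<lambda>i. if i = 0 then 1 else if i = 1 then m else if i = 2 then n else if i = 3 then 1 else 0)
    \<longleftrightarrow> (\<exists>x b \<phi>. normal_form m n x b \<phi>)" (is "_ \<and> has_hilbert_function A ?H \<longleftrightarrow> _")
proof -
  have S: "Suc 0 = 1" "Suc 1 = 2" "Suc 2 = 3" "Suc 3 = 4"
    by (simp_all add: One_nat_def)
  show ?thesis
  proof
    assume L: "gorenstein A \<and> has_hilbert_function A ?H"
    then obtain t where t: "basis_mod annihilator kernel t 1"
      unfolding gorenstein_iff by blast
    have B: "\<exists>b. basis_mod (pow i) (pow (Suc i)) b (?H i)" for i
      using L unfolding hilbert_function_iff by blast
    obtain b0 b1 b2 b3 where b0: "basis_mod (pow 0) (pow 1) b0 1" and b1: "basis_mod (pow 1) (pow 2) b1 m"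
      and b2: "basis_mod (pow 2) (pow 3) b2 n" and b3: "basis_mod (pow 3) (pow 4) b3 1"
      using B[of 0] B[of 1] B[of 2] B[of 3] unfolding S by (elim exE) simp
    \<comment> \<open>The value 0 in degree 4 says that M^4 = M^5, and the Artinian property turns
      this into M^4 = 0.\<close>
    obtain b4 where "basis_mod (pow 4) (pow (Suc 4)) b4 0"
      using B[of 4] by (elim exE) simp
    then have "pow 4 \<subseteq> pow (Suc 4)"
      by (auto simp: basis_mod_def)
    then have N4: "pow 4 \<subseteq> kernel" by (rule nilpotent[OF art])
    show "\<exists>x b \<phi>. normal_form m n x b \<phi>"
      by (rule basis_imp_normal_form[OF _ N4 b0 b1 b2 b3 t]) (use n in simp)
  next
    assume "\<exists>x b \<phi>. normal_form m n x b \<phi>"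
    then obtain x b \<phi> where nf: "normal_form m n x b \<phi>" by blast
    note N = normal_form_imp_basis[OF nf n]
    have "\<exists>b. basis_mod (pow i) (pow (Suc i)) b (?H i)" for i
    proof -
      have "i = 0 \<or> i = 1 \<or> i = 2 \<or> i = 3 \<or> i = 4 + (i - 4)"
        by linarith
      then consider "i = 0" | "i = 1" | "i = 2" | "i = 3" | j where "i = 4 + j"
        by blast
      then show ?thesis
      proof cases
        case 1
        show ?thesis unfolding 1 S using N(1) by (intro exI[of _ "\<lambda>_. 1"]) simp
      next
        case 2
        show ?thesis unfolding 2 S using N(2) by (intro exI[of _ x]) simp
      next
        case 3
        show ?thesis unfolding 3 S using N(3) by (intro exI[of _ b]) simp
      next
        case 4
        show ?thesis unfolding 4 S using N(4) by (intro exI[of _ "\<lambda>_. b 0 * x 0"]) simp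
      next
        case 5
        then have "pow i = kernel" "pow (Suc i) = kernel"
          using N(5)[of j] N(5)[of "Suc j"] by simp_all
        then show ?thesis using 5 by (simp add: basis_mod_def)
      qed
    qed
    then show "gorenstein A \<and> has_hilbert_function A ?H"
      unfolding hilbert_function_iff gorenstein_iff using N(6) by blast
  qed
qed

section \<open>From a normal form to an inverse system\<close>

lemma mono_eval_pow:
  assumes x: "\<And>i. i < m \<Longrightarrow> x i \<in> pow 1"
  shows "Poly_Mapping.keys e \<subseteq> {..<m} \<Longrightarrow> mono_eval m x e \<in> pow (mono_degree e)"
proof (induction "mono_degree e" arbitrary: e)
  case 0
  then show ?case by (simp add: N_0)
next
  case (Suc d)
  from Suc(2)[symmetric] obtain e' i where e: "e = e' + mono_var i" "mono_degree e' = d"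
    by (rule mono_degree_SucE)
  have i: "i < m" "Poly_Mapping.keys e' \<subseteq> {..<m}" using Suc(3) unfolding e(1) keys_mono_add by auto
  have "mono_eval m x e' \<in> pow d" using Suc(1)[of e'] e(2) i(2) by simp
  from N_Suc[OF this x[OF i(1)]] show ?case
    unfolding e(1) by (simp add: mono_eval_add mono_eval_var i mono_degree_add e(2) Suc_eq_plus1)
qed

text \<open>The span of the monomials and the kernel is a subring. It approximates every element
  modulo each power of M, by induction over products, and some power lies in the kernel.\<close>

lemma span_mono_eval:
  assumes one: "UNIV \<subseteq> spanned_mod (pow 1) (\<lambda>_. 1) 1" and x: "pow 1 \<subseteq> spanned_mod (pow 2) x m"
    and k: "pow k \<subseteq> kernel"
  shows "span (mono_eval m x ` {e. Poly_Mapping.keys e \<subseteq> {..<m}} \<union> kernel) = UNIV"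
proof -
  let ?X = "mono_eval m x ` {e. Poly_Mapping.keys e \<subseteq> {..<m}} \<union> kernel"
  let ?S = "span ?X"
  have S: "subspace ?S" by (rule subspace_span)
  have Xs: "mono_eval m x e \<in> ?S" if "Poly_Mapping.keys e \<subseteq> {..<m}" for e
    using that by (intro span_base) auto
  have Zs: "p \<in> ?S" if "p \<in> kernel" for p
    using that by (intro span_base) auto
  have sub: "subspace {q. p * q \<in> ?S}" for p
    by (rule subspaceI) (auto simp: distrib_left mult_sc subspace_0[OF S] subspace_add[OF S] subspace_scale[OF S])
  have mult1: "mono_eval m x e * q \<in> ?S" if e: "Poly_Mapping.keys e \<subseteq> {..<m}" and q: "q \<in> ?S" for e q
  proof -
    have "?S \<subseteq> {q. mono_eval m x e * q \<in> ?S}"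
    proof (rule span_minimal[OF _ sub])
      show "?X \<subseteq> {q. mono_eval m x e * q \<in> ?S}"
        using e Z_ideal Zs Xs[of "e + _"] by (auto simp: keys_mono_add simp flip: mono_eval_add)
    qed
    then show ?thesis using q by blast
  qed
  have mult: "p * q \<in> ?S" if p: "p \<in> ?S" and q: "q \<in> ?S" for p q
  proof -
    have "?S \<subseteq> {p. q * p \<in> ?S}"
    proof (rule span_minimal[OF _ sub])
      show "?X \<subseteq> {p. q * p \<in> ?S}"
        using mult1[OF _ q] Z_ideal[of _ q] Zs by (auto simp: mult.commute[of q "mono_eval m x _"])
    qed
    then show ?thesis using p by (auto simp: mult.commute)
  qed
  have one': "\<exists>s\<in>?S. q - s \<in> pow 1" for q
  proof -
    obtain c where "q - sc c 1 \<in> pow 1" using one by (auto simp: spanned_mod_def One_nat_def)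
    moreover have "sc c 1 \<in> ?S" using Xs[of 0] by (intro subspace_scale[OF S]) simp
    ultimately show ?thesis by blast
  qed
  have D1: "\<exists>s\<in>?S. q - s \<in> pow 2" if q: "q \<in> pow 1" for q
  proof -
    obtain c where c: "q - comb c x m \<in> pow 2" using subsetD[OF x q] by (auto simp: spanned_mod_def)
    have "x i \<in> ?S" if "i < m" for i
      using Xs[of "mono_var i"] that by (simp add: mono_eval_var)
    then have "comb c x m \<in> ?S" by (intro comb_mem[OF S])
    then show ?thesis using c by blast
  qed
  have D: "\<exists>s\<in>?S. q - s \<in> pow (Suc i)" if "q \<in> pow i" for q i
    using that
  proof (induction i arbitrary: q)
    case 0
    then show ?case using one' by (simp add: One_nat_def)
  next
    case (Suc i)
    let ?T = "{q. \<exists>s\<in>?S. q - s \<in> pow (Suc (Suc i))}"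
    have "pow (Suc i) \<subseteq> ?T"
    proof (rule N_least)
      show "subspace ?T"
      proof (rule subspaceI)
        show "0 \<in> ?T" using subspace_0[OF S] subspace_0[OF N_subspace] by (auto intro!: bexI[of _ 0])
      next
        fix p q assume "p \<in> ?T" "q \<in> ?T"
        then obtain s t where "s \<in> ?S" "t \<in> ?S" "p - s \<in> pow (Suc (Suc i))" "q - t \<in> pow (Suc (Suc i))"
          by blast
        then show "p + q \<in> ?T"
          using subspace_add[OF S, of s t] subspace_add[OF N_subspace, of "p - s" _ "q - t"]
          by (intro CollectI bexI[of _ "s + t"]) (auto simp: add_diff_add)
      next
        fix c q assume "q \<in> ?T"
        then obtain s where "s \<in> ?S" "q - s \<in> pow (Suc (Suc i))" by blast
        then show "sc c q \<in> ?T"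
          using subspace_scale[OF S, of s c] subspace_scale[OF N_subspace, of "q - s" _ c]
          by (intro CollectI bexI[of _ "sc c s"]) (auto simp: scale_right_diff_distrib)
      qed
    next
      show "kernel \<subseteq> ?T"
        using subspace_0[OF S] subsetD[OF Z_subset] by (auto intro!: bexI[of _ 0])
    next
      fix p q assume p: "p \<in> pow i" and q: "q \<in> pow 1"
      \<comment> \<open>The first factor is approximated one degree better and the second modulo
        \<open>pow 2\<close>; both error terms of the product then land in
        \<open>pow (Suc (Suc i))\<close>.\<close>
      obtain s where s: "s \<in> ?S" "p - s \<in> pow (Suc i)" using Suc.IH[OF p] by blast
      obtain t where t: "t \<in> ?S" "q - t \<in> pow 2" using D1[OF q] by blast
      have "p - s \<in> pow i" using s(2) N_Suc_subset by blast
      from subspace_diff[OF N_subspace p this] have "s \<in> pow i" by simp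
      from N_mult[OF this t(2)] have 1: "s * (q - t) \<in> pow (Suc (Suc i))" by simp
      have 2: "(p - s) * q \<in> pow (Suc (Suc i))" by (rule N_Suc[OF s(2) q])
      have "p * q - s * t = s * (q - t) + (p - s) * q" by (simp add: algebra_simps)
      then have "p * q - s * t \<in> pow (Suc (Suc i))"
        using subspace_add[OF N_subspace 1 2] by simp
      then show "p * q \<in> ?T" using mult[OF s(1) t(1)] by blast
    qed
    then show ?case using Suc.prems by blast
  qed
  have all: "\<exists>s\<in>?S. q - s \<in> pow i" for q i
  proof (induction i)
    case 0
    then show ?case using subspace_0[OF S] by (auto simp: N_0)
  next
    case (Suc i)
    then obtain s where s: "s \<in> ?S" "q - s \<in> pow i" by blast
    obtain t where t: "t \<in> ?S" "q - s - t \<in> pow (Suc i)" using D[OF s(2)] by blast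
    then show ?case using subspace_add[OF S s(1) t(1)] by (intro bexI[of _ "s + t"]) (simp_all add: diff_diff_eq)
  qed
  have "q \<in> ?S" for q
  proof -
    obtain s where s: "s \<in> ?S" "q - s \<in> pow k" using all by blast
    then have "q - s \<in> ?S" using k Zs by blast
    from subspace_add[OF S this s(1)] show ?thesis by simp
  qed
  then show ?thesis by blast
qed

text \<open>The map from power series is truncated evaluation at \<open>x\<close>. Because of the
  truncation its multiplicativity is not formal; it is verified by pairing with all
  monomials.\<close>

lemma normal_form_imp_iso:
  assumes nf: "normal_form m n x b \<phi>" and n: "1 \<le> n" "n < m"
  shows "\<exists>F3. nondegenerate_form3 n F3 \<and> alg_iso A (A_F m (F3 + (\<Sum>i = n..<m. (mvar i)\<^sup>2)))"
proof -
  have form: "linear_form \<phi>" and form_Z: "\<And>p. p \<in> kernel \<Longrightarrow> \<phi> p = 0"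
    and nondeg: "\<And>p. (\<And>q. \<phi> (p * q) = 0) \<Longrightarrow> p \<in> kernel" and \<phi>4: "\<And>p. p \<in> pow 4 \<Longrightarrow> \<phi> p = 0"
    and one: "UNIV \<subseteq> spanned_mod (pow 1) (\<lambda>_. 1) 1"
    and xN: "\<And>i. i < m \<Longrightarrow> x i \<in> pow 1" and x_span: "pow 1 \<subseteq> spanned_mod (pow 2) x m"
    and bN: "\<And>j. j < n \<Longrightarrow> b j \<in> pow 2"
    and \<phi>1: "\<phi> 1 = 0" and \<phi>x: "\<And>i. i < m \<Longrightarrow> \<phi> (x i) = 0"
    and xx: "\<And>i j. i < m \<Longrightarrow> j < m \<Longrightarrow> \<phi> (x i * x j) = (if i = j \<and> n \<le> i then 2 else 0)"
    and xxx: "\<And>i j k. i < m \<Longrightarrow> j < m \<Longrightarrow> k < m \<Longrightarrow> n \<le> k \<Longrightarrow> \<phi> (x i * x j * x k) = 0"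
    and bx: "\<And>j k. j < n \<Longrightarrow> k < m \<Longrightarrow> \<phi> (b j * x k) = (if j = k then 1 else 0)"
    using nf unfolding normal_form_def by simp_all
  note form_simps = linear_form_simps[OF form] form_comb[OF form] form_comb'[OF form]
  have mem4: "\<phi> (p * q) = 0" if "p \<in> pow i" "q \<in> pow j" "4 \<le> i + j" for p q i j
    using N_mult[OF that(1,2)] N_antimono[OF that(3)] \<phi>4 by blast
  have N4: "pow 4 = kernel" using normal_form_imp_basis(5)[OF nf n, of 0] by simp
  let ?X = "mono_eval m x"
  \<comment> \<open>The cubic part is read off from the form on cubic monomials in the first n
    generators; the other terms of F are dictated by the normal form.\<close>
  define E3 where "E3 = {e \<in> monos_le n 3. mono_degree e = 3}"
  define F3 where "F3 = (\<Sum>e\<in>E3. Poly_Mapping.single e (\<phi> (?X e) / mono_fact e))"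
  have fin3: "finite E3" unfolding E3_def using finite_monos_le by simp
  have lookup3: "Poly_Mapping.lookup F3 e = (if e \<in> E3 then \<phi> (?X e) / mono_fact e else 0)" for e
  proof -
    have "Poly_Mapping.lookup F3 e = (\<Sum>d\<in>E3. if d = e then \<phi> (?X e) / mono_fact e else 0)"
      unfolding F3_def lookup_sum_mono by (intro sum.cong) (auto simp: lookup_single when_def)
    then show ?thesis using fin3 by simp
  qed
  have F3: "form3 n F3"
    unfolding form3_iff lookup3 by (auto simp: E3_def monos_le_def)
  have dc3: "divided_coeff F3 e = \<phi> (?X e)" if "Poly_Mapping.keys e \<subseteq> {..<n}" "mono_degree e = 3" for e
    using that by (simp add: divided_coeff_def lookup3 E3_def monos_le_def mono_fact_nonzero)
  define F where "F = F3 + (\<Sum>i = n..<m. (mvar i)\<^sup>2)"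
  define G where "G = divided_coeff F"
  note Gp = divided_coeff_normal_poly[OF F3 less_imp_le[OF n(2)], folded F_def, folded G_def]
  have finG: "finite {e. G e \<noteq> 0}" unfolding G_def by (rule finite_divided_coeff)
  have X3: "?X (mono_var i + mono_var j + mono_var k) = x i * x j * x k" if "i < m" "j < m" "k < m" for i j k
    using that by (simp add: mono_eval_add mono_eval_var)
  \<comment> \<open>The bridge between the form and F. The clauses on values at monomials enter
    degree by degree, including the vanishing of cubic monomials with a late variable and of
    everything from degree 4 on.\<close>
  have GX: "G e = \<phi> (?X e)" if e: "Poly_Mapping.keys e \<subseteq> {..<m}" for e
  proof -
    consider "mono_degree e = 0" | "mono_degree e = 1" | "mono_degree e = 2" | "mono_degree e = 3" | "4 \<le> mono_degree e"
      by linarith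
    then show ?thesis
    proof cases
      case 1
      then have "G e = 0" using Gp(1)[of e] by auto
      then show ?thesis using 1 \<phi>1 by simp
    next
      case 2
      then have "G e = 0" using Gp(1)[of e] by auto
      moreover obtain i where "e = mono_var i" using 2 by (rule mono_degree_1E)
      ultimately show ?thesis using e \<phi>x by (simp add: mono_eval_var)
    next
      case 3
      then obtain i j where ij: "e = mono_var i + mono_var j" by (rule mono_degree_2E)
      then have "i < m" "j < m" using e by (auto simp: keys_mono_add)
      then show ?thesis unfolding ij using xx by (simp add: Gp(2) mono_eval_add mono_eval_var)
    next
      case 4
      show ?thesis
      proof (cases "Poly_Mapping.keys e \<subseteq> {..<n}")
        case True
        then show ?thesis using Gp(3)[OF 4] dc3 4 by simp
      next
        case False
        obtain i j k where ijk: "e = mono_var i + mono_var j + mono_var k" using 4 by (rule mono_degree_3E)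
        then have lt: "i < m" "j < m" "k < m" using e by (auto simp: keys_mono_add)
        have "n \<le> i \<or> n \<le> j \<or> n \<le> k" using False unfolding ijk by (auto simp: keys_mono_add)
        then have "\<phi> (x i * x j * x k) = 0"
          using xxx[of i j k] xxx[of i k j] xxx[of j k i] lt by (auto simp: ac_simps)
        then show ?thesis using Gp(4)[OF 4 False] X3[OF lt] ijk by simp
      qed
    next
      case 5
      then have "G e = 0" using Gp(1)[of e] by auto
      moreover have "?X e \<in> pow (mono_degree e)"
        by (rule mono_eval_pow[OF _ e]) (rule xN)
      then have "?X e \<in> pow 4"
        using N_antimono[OF 5] by blast
      ultimately show ?thesis using \<phi>4 by simp
    qed
  qed
  let ?R = "pseries_ring m :: ('k, 'k pseries) module"
  let ?E = "monos_le m 3"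
  let ?D = "divisors G"
  have DE: "?D \<subseteq> ?E"
  proof
    fix a assume "a \<in> ?D"
    then obtain d where "G (a + d) \<noteq> 0" by (auto simp: divisors_def)
    from Gp(1)[OF this] show "a \<in> ?E" by (auto simp: monos_le_def keys_mono_add mono_degree_add)
  qed
  have GD: "G (a + d) = 0" if "a \<notin> ?D" for a d using that by (auto simp: divisors_def)
  \<comment> \<open>Truncation after degree 3 loses nothing in A, since monomials of degree at least
    4 lie in \<open>pow 4\<close>, which is the kernel.\<close>
  define P where "P f = (\<Sum>e\<in>?E. sc (f e) (?X e))" for f
  have \<phi>P: "\<phi> (P f * q) = (\<Sum>e\<in>?E. f e * \<phi> (?X e * q))" for f q
    unfolding P_def by (simp add: sum_distrib_right sc_mult linear_form_simps[OF form])
  have contr: "\<phi> (P f * ?X d) = contract G f d" if d: "Poly_Mapping.keys d \<subseteq> {..<m}" for f d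
  proof -
    have "\<phi> (P f * ?X d) = (\<Sum>e\<in>?E. f e * G (e + d))"
      unfolding \<phi>P using d GX by (intro sum.cong) (auto simp: monos_le_def keys_mono_add mono_eval_add)
    also have "\<dots> = contract G f d"
      unfolding contract_def using DE GD finite_monos_le by (intro sum.mono_neutral_right) auto
    finally show ?thesis .
  qed
  have span: "span (?X ` {e. Poly_Mapping.keys e \<subseteq> {..<m}} \<union> kernel) = UNIV"
    by (rule span_mono_eval[OF one x_span, of 4]) (simp add: N4)
  have zero: "p \<in> kernel" if p: "\<And>d. Poly_Mapping.keys d \<subseteq> {..<m} \<Longrightarrow> \<phi> (p * ?X d) = 0" for p
  proof (rule nondeg)
    fix q
    have "span (?X ` {e. Poly_Mapping.keys e \<subseteq> {..<m}} \<union> kernel) \<subseteq> {q. \<phi> (p * q) = 0}"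
      by (rule span_minimal[OF _ subspace_form_kernel[OF form]]) (use p form_Z Z_ideal in auto)
    then show "\<phi> (p * q) = 0" unfolding span by blast
  qed
  \<comment> \<open>An element of A is determined by its pairings with monomials, and those of
    \<open>P f\<close> form the contraction of \<open>G\<close> by \<open>f\<close>.
    Multiplicativity thus becomes an identity of contractions.\<close>
  have eqv: "ev (P f) = ev p" if p: "\<And>d. Poly_Mapping.keys d \<subseteq> {..<m} \<Longrightarrow> contract G f d = \<phi> (p * ?X d)" for f p
  proof -
    have "P f - p \<in> kernel"
      by (rule zero) (simp add: left_diff_distrib linear_form_simps[OF form] contr p)
    then show ?thesis by (simp add: ev_eq_iff kernel_def)
  qed
  define \<pi> where "\<pi> f = ev (P f)" for f
  have P_add: "P (\<lambda>e. f e + g e) = P f + P g" for f g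
    by (simp add: P_def scale_left_distrib sum.distrib)
  have P_sc: "P (\<lambda>e. c * f e) = sc c (P f)" for c f
    by (simp add: P_def scale_sum_right)
  have hom: "\<pi> \<in> alg_hom ?R A"
  proof (rule alg_homI)
    fix f g :: "'k pseries"
    show "\<pi> f \<in> carrier A" by (simp add: \<pi>_def)
    show "\<pi> (c \<odot>\<^bsub>?R\<^esub> f) = c \<odot>\<^bsub>A\<^esub> \<pi> f" for c
      by (simp add: \<pi>_def pseries_ring_sel(6) P_sc ev_sc)
    show "\<pi> (f \<oplus>\<^bsub>?R\<^esub> g) = \<pi> f \<oplus>\<^bsub>A\<^esub> \<pi> g"
      by (simp add: \<pi>_def pseries_ring_sel(5) P_add ev_add)
    have "ev (P (ps_mult f g)) = ev (P f * P g)"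
    proof (rule eqv)
      fix d :: mono assume d: "Poly_Mapping.keys d \<subseteq> {..<m}"
      have "\<phi> (P f * P g * ?X d) = \<phi> (P g * (P f * ?X d))" by (simp add: ac_simps)
      also have "\<dots> = (\<Sum>c\<in>?E. g c * contract G f (c + d))"
        unfolding \<phi>P
      proof (intro sum.cong refl)
        fix c assume "c \<in> ?E"
        then have "Poly_Mapping.keys (c + d) \<subseteq> {..<m}" using d by (auto simp: monos_le_def keys_mono_add)
        from contr[OF this, of f] show "g c * \<phi> (?X c * (P f * ?X d)) = g c * contract G f (c + d)"
          by (simp add: mono_eval_add ac_simps)
      qed
      also have "\<dots> = contract G (ps_mult f g) d"
        unfolding contract_ps_mult[OF finG]
      proof (rule sum.mono_neutral_right[OF finite_monos_le DE])
        show "\<forall>c\<in>?E - ?D. g c * contract G f (c + d) = 0"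
        proof
          fix c assume "c \<in> ?E - ?D"
          then have "G (a + (c + d)) = 0" for a using GD[of c "a + d"] by (simp add: ac_simps)
          then show "g c * contract G f (c + d) = 0" by (simp add: contract_def)
        qed
      qed
      finally show "contract G (ps_mult f g) d = \<phi> (P f * P g * ?X d)" by simp
    qed
    then show "\<pi> (f \<otimes>\<^bsub>?R\<^esub> g) = \<pi> f \<otimes>\<^bsub>A\<^esub> \<pi> g"
      by (simp add: \<pi>_def pseries_ring_sel(2) ev_mult)
  next
    have "P (\<lambda>e. if e = 0 then 1 else 0) = (\<Sum>e\<in>?E. if e = 0 then 1 else 0)"
      unfolding P_def by (intro sum.cong) auto
    also have "\<dots> = 1"
    proof -
      have "0 \<in> ?E" by (simp add: monos_le_def)
      then show ?thesis by (simp add: finite_monos_le)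
    qed
    finally show "\<pi> \<one>\<^bsub>?R\<^esub> = \<one>\<^bsub>A\<^esub>" by (simp add: \<pi>_def pseries_ring_sel(3))
  qed
  have surj: "\<pi> ` carrier ?R = carrier A"
  proof
    show "\<pi> ` carrier ?R \<subseteq> carrier A" using alg_hom_simps(1)[OF hom] by blast
    interpret R: K_alg ?R by (rule K_alg.intro) (rule pseries_K_algebra)
    let ?S = "{q. \<exists>f\<in>carrier ?R. \<pi> f = ev q}"
    have "span (?X ` {e. Poly_Mapping.keys e \<subseteq> {..<m}} \<union> kernel) \<subseteq> ?S"
    proof (rule span_minimal)
      show "subspace ?S"
      proof (rule subspaceI)
        show "0 \<in> ?S" using R.zero_closed
          by (intro CollectI bexI[of _ "\<zero>\<^bsub>?R\<^esub>"]) (simp_all add: \<pi>_def pseries_ring_sel(4) P_def)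
      next
        fix p q assume "p \<in> ?S" "q \<in> ?S"
        then obtain f g where f: "f \<in> carrier ?R" "\<pi> f = ev p" and g: "g \<in> carrier ?R" "\<pi> g = ev q"
          by (elim CollectE bexE)
        have "\<pi> (f \<oplus>\<^bsub>?R\<^esub> g) = ev (p + q)"
          unfolding alg_hom_simps(2)[OF hom f(1) g(1)] f(2) g(2) ev_add ..
        then show "p + q \<in> ?S" using R.a_closed[OF f(1) g(1)] by (intro CollectI bexI)
      next
        fix c q assume "q \<in> ?S"
        then obtain f where f: "f \<in> carrier ?R" "\<pi> f = ev q" by (elim CollectE bexE)
        have "\<pi> (c \<odot>\<^bsub>?R\<^esub> f) = ev (sc c q)"
          unfolding alg_hom_simps(5)[OF hom f(1)] f(2) ev_sc ..
        then show "sc c q \<in> ?S" using R.smult_mem[OF f(1)] by (intro CollectI bexI)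
      qed
      have "?X e \<in> ?S" if e: "Poly_Mapping.keys e \<subseteq> {..<m}" for e
      proof -
        have "ev (P (mono_series e)) = ev (?X e)"
        proof (rule eqv)
          fix d :: mono assume "Poly_Mapping.keys d \<subseteq> {..<m}"
          then show "contract G (mono_series e) d = \<phi> (?X e * ?X d)"
            using e GX[of "e + d"] by (simp add: contract_mono_series[OF finG] keys_mono_add mono_eval_add)
        qed
        then show ?thesis using mono_series_closed[OF e] by (auto simp: \<pi>_def)
      qed
      moreover have "p \<in> ?S" if "p \<in> kernel" for p
        using that R.zero_closed
        by (intro CollectI bexI[of _ "\<zero>\<^bsub>?R\<^esub>"]) (simp_all add: \<pi>_def pseries_ring_sel(4) P_def kernel_def)
      ultimately show "?X ` {e. Poly_Mapping.keys e \<subseteq> {..<m}} \<union> kernel \<subseteq> ?S" by blast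
    qed
    then have rep: "\<exists>f\<in>carrier ?R. \<pi> f = ev q" for q unfolding span by auto
    show "carrier A \<subseteq> \<pi> ` carrier ?R"
    proof
      fix a assume "a \<in> carrier A"
      then obtain q where q: "ev q = a" by (rule ev_surj)
      obtain f where "f \<in> carrier ?R" "\<pi> f = ev q" using rep[of q] by (rule bexE)
      then show "a \<in> \<pi> ` carrier ?R" using q by (intro image_eqI[of _ _ f]) simp_all
    qed
  qed
  have ker: "\<pi> f = \<zero>\<^bsub>A\<^esub> \<longleftrightarrow> f \<in> Ann m F" if f: "f \<in> carrier ?R" for f
  proof
    assume "\<pi> f = \<zero>\<^bsub>A\<^esub>"
    then have Pf: "P f \<in> kernel" by (simp add: \<pi>_def kernel_def)
    have "contract G f d = 0" for d
    proof (cases "Poly_Mapping.keys d \<subseteq> {..<m}")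
      case True
      have "?X d * P f \<in> kernel" by (rule Z_ideal[OF Pf])
      then show ?thesis using contr[OF True, of f] form_Z by (simp add: mult.commute)
    next
      case False
      then have "G (a + d) = 0" for a using Gp(1)[of "a + d"] by (auto simp: keys_mono_add)
      then show ?thesis by (simp add: contract_def)
    qed
    then show "f \<in> Ann m F" using f by (simp add: Ann_iff G_def)
  next
    assume "f \<in> Ann m F"
    then have "contract G f d = 0" for d by (simp add: Ann_iff G_def)
    then have "ev (P f) = ev 0" by (intro eqv) (simp add: linear_form_simps[OF form])
    then show "\<pi> f = \<zero>\<^bsub>A\<^esub>" by (simp add: \<pi>_def)
  qed
  have iso: "alg_iso A (A_F m F)"
    unfolding alg_iso_A_F_iff[OF K_algebra] using hom surj ker by blast
  let ?SP = "mpoly_span (second_partials n F3)"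
  \<comment> \<open>\<open>L q\<close> is the linear form whose coefficients are the pairings of q
    with the first n generators. It maps products of two generators to second partials of
    \<open>F3\<close> or to 0, and \<open>b j\<close> to the j-th variable. As such products span
    \<open>pow 2\<close> up to elements that \<open>L\<close> kills, the variables lie in the span
    of the second partials.\<close>
  define L where "L q = (\<Sum>l<n. mscale (\<phi> (q * x l)) (mvar l))" for q
  have L_add: "L (p + q) = L p + L q" for p q
    by (simp add: L_def distrib_right linear_form_simps[OF form] mpoly.scale_left_distrib sum.distrib)
  have L_sc: "L (sc c q) = mscale c (L q)" for c q
    by (simp add: L_def sc_mult linear_form_simps[OF form] mpoly.scale_sum_right)
  let ?T = "{q. L q \<in> ?SP}"
  have L_zero: "q \<in> ?T" if "\<And>l. l < n \<Longrightarrow> \<phi> (q * x l) = 0" for q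
    using that by (simp add: L_def mpoly.span_zero)
  have T: "subspace {q. p * q \<in> ?T}" for p
  proof (rule subspaceI)
    show "0 \<in> {q. p * q \<in> ?T}" using L_zero[of 0] by (simp add: linear_form_simps[OF form])
  qed (simp_all add: distrib_left mult_sc L_add L_sc mpoly.span_add mpoly.span_scale)
  have xx_T: "x i * x k \<in> ?T" if ik: "i < m" "k < m" for i k
  proof (cases "i < n \<and> k < n")
    case True
    have "L (x i * x k) = pdiff i (pdiff k F3)"
      unfolding second_partial_form3[OF F3] L_def
    proof (intro sum.cong refl)
      fix l assume l: "l \<in> {..<n}"
      have "divided_coeff F3 (mono_var l + mono_var i + mono_var k) = \<phi> (x l * x i * x k)"
        using dc3[of "mono_var l + mono_var i + mono_var k"] X3[of l i k] True l n
        by (simp add: keys_mono_add mono_degree_add)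
      then show "mscale (\<phi> (x i * x k * x l)) (mvar l) =
          mscale (divided_coeff F3 (mono_var l + mono_var i + mono_var k)) (mvar l)"
        by (simp add: ac_simps)
    qed
    then show ?thesis using True by (auto intro!: mpoly.span_base)
  next
    case False
    show ?thesis
    proof (rule L_zero)
      fix l assume "l < n"
      then show "\<phi> (x i * x k * x l) = 0"
        using False ik n xxx[of i l k] xxx[of k l i] by (auto simp: ac_simps)
    qed
  qed
  have 21: "q * p \<in> ?T" if "p \<in> pow 2" "q \<in> pow 1" for p q
  proof (rule L_zero)
    fix l assume "l < n"
    then have "x l \<in> pow 1" using xN n by simp
    from N_mult[OF that(2) this] have "q * x l \<in> pow 2" by simp
    from mem4[OF that(1) this] show "\<phi> (q * p * x l) = 0" by (simp add: ac_simps)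
  qed
  have x1: "x k * p \<in> ?T" if p: "p \<in> pow 1" and k: "k < m" for p k
  proof -
    have "spanned_mod (pow 2) x m \<subseteq> {p. x k * p \<in> ?T}"
      by (rule spanned_mod_subset[OF T]) (use 21 xN[OF k] xx_T[OF k] in blast)+
    then show ?thesis using p x_span by blast
  qed
  have 11: "p * q \<in> ?T" if p: "p \<in> pow 1" and q: "q \<in> pow 1" for p q
  proof -
    have "spanned_mod (pow 2) x m \<subseteq> {q. p * q \<in> ?T}"
    proof (rule spanned_mod_subset[OF T])
      show "pow 2 \<subseteq> {q. p * q \<in> ?T}" using 21 p by blast
      show "x i \<in> {q. p * q \<in> ?T}" if "i < m" for i
        using x1[OF p that] by (simp add: mult.commute)
    qed
    then show ?thesis using q x_span by blast
  qed
  have "pow (Suc 1) \<subseteq> ?T"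
  proof (rule N_least)
    show "subspace ?T" using T[of 1] by simp
    show "kernel \<subseteq> ?T"
    proof
      fix q assume q: "q \<in> kernel"
      show "q \<in> ?T"
      proof (rule L_zero)
        show "\<phi> (q * x l) = 0" for l
          using form_Z[OF Z_ideal[OF q, of "x l"]] by (simp add: mult.commute)
      qed
    qed
  qed (rule 11)
  then have bT: "b j \<in> ?T" if "j < n" for j
    using bN[OF that] by (auto simp: numeral_2_eq_2 One_nat_def)
  have "mvar j \<in> ?SP" if j: "j < n" for j
  proof -
    have "L (b j) = (\<Sum>l<n. if l = j then mvar j else 0)"
      unfolding L_def using bx j n by (intro sum.cong) auto
    then show ?thesis using bT[OF j] j by simp
  qed
  then have "nondegenerate_form3 n F3"
    unfolding nondegenerate_form3_iff using F3 by blast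
  then show ?thesis using iso unfolding F_def by blast
qed

end

section \<open>From an inverse system to a normal form\<close>

context cover
begin

lemma ideal_image:
  assumes J: "subspace J" and mult: "\<And>p q. p \<in> J \<Longrightarrow> q * p \<in> J"
  shows "ideal (ev ` J) A"
proof (rule idealI[OF A.ring_axioms])
  show "subgroup (ev ` J) (add_monoid A)"
  proof (rule A.add.subgroupI)
    show "ev ` J \<noteq> {}" using subspace_0[OF J] by blast
  next
    fix a assume "a \<in> ev ` J"
    then obtain p where p: "p \<in> J" "a = ev p" by blast
    have "\<ominus>\<^bsub>A\<^esub> a = ev (0 - p)" unfolding ev_diff p(2) by (simp add: A.minus_eq)
    then show "\<ominus>\<^bsub>A\<^esub> a \<in> ev ` J" using subspace_diff[OF J subspace_0[OF J] p(1)] by (rule image_eqI)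
  next
    fix a b assume "a \<in> ev ` J" "b \<in> ev ` J"
    then obtain p q where pq: "p \<in> J" "a = ev p" "q \<in> J" "b = ev q" by blast
    have "a \<oplus>\<^bsub>A\<^esub> b = ev (p + q)" unfolding ev_add pq(2,4) ..
    then show "a \<oplus>\<^bsub>A\<^esub> b \<in> ev ` J" using subspace_add[OF J pq(1,3)] by (rule image_eqI)
  qed auto
next
  fix a x assume "a \<in> ev ` J" and x: "x \<in> carrier A"
  then obtain p where p: "p \<in> J" "a = ev p" by blast
  obtain q where q: "ev q = x" using x by (rule ev_surj)
  have "x \<otimes>\<^bsub>A\<^esub> a = ev (q * p)" unfolding ev_mult p(2) q ..
  then show xa: "x \<otimes>\<^bsub>A\<^esub> a \<in> ev ` J" using mult[OF p(1)] by (rule image_eqI)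
  have "a \<otimes>\<^bsub>A\<^esub> x = x \<otimes>\<^bsub>A\<^esub> a" using x p by (simp add: A.m_comm)
  then show "a \<otimes>\<^bsub>A\<^esub> x \<in> ev ` J" using xa by simp
qed

end

context ac_local_cover
begin

text \<open>Elements are handled through series that represent them. The powers of M are compared
  with the elements represented by series of order at least k, where degrees can be counted.\<close>

lemma iso_imp_normal_form:
  assumes F3: "nondegenerate_form3 n F3" and n: "1 \<le> n" "n < m"
    and iso: "alg_iso A (A_F m (F3 + (\<Sum>i = n..<m. (mvar i)\<^sup>2)))"
  shows "\<exists>x b \<phi>. normal_form m n x b \<phi>"
proof -
  define F where "F = F3 + (\<Sum>i = n..<m. (mvar i)\<^sup>2)"
  define G where "G = divided_coeff F"
  have F3': "form3 n F3" and nd: "\<And>j. j < n \<Longrightarrow> mvar j \<in> mpoly_span (second_partials n F3)"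
    using F3 unfolding nondegenerate_form3_iff by blast+
  note Gp = divided_coeff_normal_poly[OF F3' less_imp_le[OF n(2)], folded F_def, folded G_def]
  have finG: "finite {e. G e \<noteq> 0}" unfolding G_def by (rule finite_divided_coeff)
  let ?R = "pseries_ring m :: ('k, 'k pseries) module"
  interpret R: K_alg ?R by (rule K_alg.intro) (rule pseries_K_algebra)
  obtain \<pi> where hom: "\<pi> \<in> alg_hom ?R A" and surj: "\<pi> ` carrier ?R = carrier A"
    and ker: "\<forall>f\<in>carrier ?R. \<pi> f = \<zero>\<^bsub>A\<^esub> \<longleftrightarrow> f \<in> Ann m F"
    using iso unfolding F_def[symmetric] alg_iso_A_F_iff[OF K_algebra] by (elim bexE conjE)
  note H = alg_hom_simps[OF hom]
  \<comment> \<open>Equality in A is equality of contractions, so the value of the form does not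
    depend on the representing series.\<close>
  have fib: "\<pi> f = \<pi> g \<longleftrightarrow> (\<forall>d. contract G f d = contract G g d)"
    if f: "f \<in> carrier ?R" and g: "g \<in> carrier ?R" for f g
  proof -
    let ?d = "f \<oplus>\<^bsub>?R\<^esub> (-1) \<odot>\<^bsub>?R\<^esub> g"
    have d: "?d \<in> carrier ?R" using R.a_closed[OF f R.smult_mem[OF g]] .
    have \<pi>d: "\<pi> ?d = \<pi> f \<oplus>\<^bsub>A\<^esub> (-1) \<odot>\<^bsub>A\<^esub> \<pi> g"
      unfolding H(2)[OF f R.smult_mem[OF g]] H(5)[OF g] ..
    obtain p q where p: "ev p = \<pi> f" "ev q = \<pi> g" using H(1)[OF f] H(1)[OF g] ev_surj by metis
    have "\<pi> ?d = ev (p - q)"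
      unfolding \<pi>d p[symmetric] by (simp flip: ev_sc ev_add)
    then have "\<pi> f = \<pi> g \<longleftrightarrow> \<pi> ?d = \<zero>\<^bsub>A\<^esub>"
      using ev_eq_iff[of p q] p by simp
    also have "\<dots> \<longleftrightarrow> ?d \<in> Ann m F" using ker d by blast
    also have "\<dots> \<longleftrightarrow> (\<forall>b. contract G f b + -1 * contract G g b = 0)"
      unfolding Ann_iff G_def[symmetric] using d
      by (simp only: pseries_ring_sel(5,6) contract_add contract_scale simp_thms)
    finally show ?thesis by simp
  qed
  have rep: "\<exists>f\<in>carrier ?R. \<pi> f = ev q" for q
  proof -
    have "ev q \<in> \<pi> ` carrier ?R" unfolding surj by simp
    then show ?thesis by (elim imageE) (rule bexI, rule sym)
  qed
  define \<phi> where "\<phi> q = contract G (SOME f. f \<in> carrier ?R \<and> \<pi> f = ev q) 0" for q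
  have \<phi>: "\<phi> q = contract G f 0" if f: "f \<in> carrier ?R" "\<pi> f = ev q" for f q
  proof -
    let ?g = "SOME f. f \<in> carrier ?R \<and> \<pi> f = ev q"
    have "?g \<in> carrier ?R \<and> \<pi> ?g = ev q" by (rule someI[of _ f]) (use f in simp)
    then have "\<forall>d. contract G ?g d = contract G f d" using fib[of ?g f] f by simp
    then show ?thesis unfolding \<phi>_def by simp
  qed
  have radd: "\<pi> (f \<oplus>\<^bsub>?R\<^esub> g) = ev (p + q)" "f \<oplus>\<^bsub>?R\<^esub> g \<in> carrier ?R"
    and rmult: "\<pi> (ps_mult f g) = ev (p * q)"
    if f: "f \<in> carrier ?R" "\<pi> f = ev p" and g: "g \<in> carrier ?R" "\<pi> g = ev q" for f g p q
  proof -
    show "\<pi> (f \<oplus>\<^bsub>?R\<^esub> g) = ev (p + q)" unfolding H(2)[OF f(1) g(1)] f(2) g(2) ev_add ..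
    show "f \<oplus>\<^bsub>?R\<^esub> g \<in> carrier ?R" by (rule R.a_closed[OF f(1) g(1)])
    show "\<pi> (ps_mult f g) = ev (p * q)"
      using H(3)[OF f(1) g(1)] unfolding f(2) g(2) ev_mult pseries_ring_sel(2) .
  qed
  have rsc: "\<pi> (c \<odot>\<^bsub>?R\<^esub> f) = ev (sc c p)" "c \<odot>\<^bsub>?R\<^esub> f \<in> carrier ?R"
    if f: "f \<in> carrier ?R" "\<pi> f = ev p" for f c p
  proof -
    show "\<pi> (c \<odot>\<^bsub>?R\<^esub> f) = ev (sc c p)" unfolding H(5)[OF f(1)] f(2) ev_sc ..
    show "c \<odot>\<^bsub>?R\<^esub> f \<in> carrier ?R" by (rule R.smult_mem[OF f(1)])
  qed
  have zero_R: "(\<lambda>e. 0) \<in> carrier ?R" using R.zero_closed unfolding pseries_ring_sel(4) .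
  have rzero: "\<pi> (\<lambda>e. 0) = ev q \<longleftrightarrow> q \<in> kernel" for q
  proof -
    have "(\<lambda>e. 0 :: 'k) \<in> Ann m F" using zero_R by (simp add: Ann_iff contract_def)
    then have "\<pi> (\<lambda>e. 0) = \<zero>\<^bsub>A\<^esub>" using ker zero_R by blast
    then show ?thesis by (auto simp: kernel_def)
  qed
  have form: "linear_form \<phi>"
    unfolding linear_form_def
  proof (intro conjI allI)
    fix p q c
    obtain f g where f: "f \<in> carrier ?R" "\<pi> f = ev p" and g: "g \<in> carrier ?R" "\<pi> g = ev q"
      using rep[of p] rep[of q] by (elim bexE)
    show "\<phi> (p + q) = \<phi> p + \<phi> q"
      unfolding \<phi>[OF radd(2,1)[OF f g]] \<phi>[OF f] \<phi>[OF g] pseries_ring_sel(5) contract_add ..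
    show "\<phi> (sc c p) = c * \<phi> p"
      unfolding \<phi>[OF rsc(2,1)[OF f]] \<phi>[OF f] pseries_ring_sel(6) contract_scale ..
  qed
  have form_Z: "\<phi> p = 0" if "p \<in> kernel" for p
    using \<phi>[OF zero_R] rzero[of p] that by (simp add: contract_def)
  \<comment> \<open>The generators are lifts of the images of the variables; from index m on, 0 is a
    filler.\<close>
  have "\<exists>x. \<forall>i. ev (x i) = (if i < m then \<pi> (mono_series (mono_var i)) else ev 0)"
  proof (rule choice, rule allI)
    fix i
    show "\<exists>y. ev y = (if i < m then \<pi> (mono_series (mono_var i)) else ev 0)"
    proof (cases "i < m")
      case True
      then have "\<pi> (mono_series (mono_var i)) \<in> carrier A" by (intro H(1) mono_series_closed) simp
      then obtain y where "ev y = \<pi> (mono_series (mono_var i))" by (rule ev_surj)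
      then show ?thesis using True by auto
    next
      case False
      then show ?thesis by (intro exI[of _ 0]) simp
    qed
  qed
  then obtain x where x0: "\<And>i. ev (x i) = (if i < m then \<pi> (mono_series (mono_var i)) else ev 0)" by blast
  then have x: "\<And>i. i < m \<Longrightarrow> \<pi> (mono_series (mono_var i)) = ev (x i)" by simp
  have varR: "mono_series (mono_var i) \<in> carrier ?R" if "i < m" for i
    using that by (intro mono_series_closed) simp
  let ?X = "mono_eval m x"
  have X: "\<pi> (mono_series e) = ev (?X e)" if "Poly_Mapping.keys e \<subseteq> {..<m}" for e
    using that
  proof (induction "mono_degree e" arbitrary: e)
    case 0
    have "mono_series 0 = \<one>\<^bsub>?R\<^esub>" by (simp add: mono_series_def pseries_ring_sel(3))
    then show ?case using 0(1)[symmetric] H(4) by simp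
  next
    case (Suc d)
    from Suc(2)[symmetric] obtain e' i where e: "e = e' + mono_var i" "mono_degree e' = d"
      by (rule mono_degree_SucE)
    have i: "i < m" "Poly_Mapping.keys e' \<subseteq> {..<m}" using Suc(3) unfolding e(1) keys_mono_add by auto
    have "\<pi> (mono_series e') = ev (?X e')" using Suc(1)[of e'] e(2) i(2) by simp
    from rmult[OF mono_series_closed[OF i(2)] this varR[OF i(1)] x[OF i(1)]]
    show ?case unfolding e(1) ps_mult_mono_series by (simp add: mono_eval_add mono_eval_var i)
  qed
  have \<phi>X: "\<phi> (q * ?X d) = contract G f d"
    if f: "f \<in> carrier ?R" "\<pi> f = ev q" and d: "Poly_Mapping.keys d \<subseteq> {..<m}" for f q d
  proof -
    have "\<phi> (q * ?X d) = contract G (ps_mult f (mono_series d)) 0"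
      by (rule \<phi>[OF _ rmult[OF f mono_series_closed[OF d] X[OF d]]])
        (rule ps_mult_closed[OF f(1) mono_series_closed[OF d]])
    then show ?thesis unfolding contract_ps_mult_mono_series[OF finG] .
  qed
  have \<phi>G: "\<phi> (?X d) = G d" if d: "Poly_Mapping.keys d \<subseteq> {..<m}" for d
    using \<phi>[OF mono_series_closed[OF d] X[OF d]] by (simp add: contract_mono_series[OF finG])
  have contract_out: "contract G f d = 0" if "\<not> Poly_Mapping.keys d \<subseteq> {..<m}" for f d
  proof -
    have "G (a + d) = 0" for a using that Gp(1)[of "a + d"] by (auto simp: keys_mono_add)
    then show ?thesis by (simp add: contract_def)
  qed
  \<comment> \<open>Pairing with a monomial reads off one coefficient of the contraction, and
    exponents with variables beyond m give 0 by the support of \<open>G\<close>. If all pairings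
    vanish, the series annihilates F.\<close>
  have nondeg: "p \<in> kernel" if p: "\<And>q. \<phi> (p * q) = 0" for p
  proof -
    obtain f where f: "f \<in> carrier ?R" "\<pi> f = ev p" using rep[of p] by (elim bexE)
    have "contract G f d = contract G (\<lambda>e. 0) d" for d
      using \<phi>X[OF f, of d] p[of "?X d"] contract_out[of d f] by (cases "Poly_Mapping.keys d \<subseteq> {..<m}") (simp_all add: contract_def)
    then have "\<pi> (\<lambda>e. 0) = ev p" using fib[OF f(1) zero_R] f(2) by simp
    then show ?thesis by (simp only: rzero)
  qed
  \<comment> \<open>Elements represented by a series of order at least k. Degree counting makes this
    filtration multiplicative; it contains the powers of M, so that the form vanishes on
    \<open>pow 4\<close>.\<close>
  define O' where "O' k = {q. \<exists>f\<in>carrier ?R. (\<forall>e. f e \<noteq> 0 \<longrightarrow> k \<le> mono_degree e) \<and> \<pi> f = ev q}" for k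
  have O_sub: "subspace (O' k)" for k
  proof (rule subspaceI)
    show "0 \<in> O' k" unfolding O'_def
      using zero_R rzero[of 0] subspace_0[OF subspace_kernel] by (intro CollectI bexI[of _ "\<lambda>e. 0"]) simp_all
  next
    fix p q assume "p \<in> O' k" "q \<in> O' k"
    then obtain f g where f: "f \<in> carrier ?R" "\<pi> f = ev p" and g: "g \<in> carrier ?R" "\<pi> g = ev q"
      and fg: "\<And>e. f e \<noteq> 0 \<Longrightarrow> k \<le> mono_degree e" "\<And>e. g e \<noteq> 0 \<Longrightarrow> k \<le> mono_degree e"
      unfolding O'_def by blast
    have "k \<le> mono_degree e" if "(f \<oplus>\<^bsub>?R\<^esub> g) e \<noteq> 0" for e
      using that fg[of e] unfolding pseries_ring_sel(5) by (cases "f e = 0") auto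
    then show "p + q \<in> O' k" unfolding O'_def using radd[OF f g] by blast
  next
    fix c q assume "q \<in> O' k"
    then obtain f where f: "f \<in> carrier ?R" "\<pi> f = ev q" and fk: "\<And>e. f e \<noteq> 0 \<Longrightarrow> k \<le> mono_degree e"
      unfolding O'_def by blast
    have "k \<le> mono_degree e" if "(c \<odot>\<^bsub>?R\<^esub> f) e \<noteq> 0" for e
      using that fk[of e] unfolding pseries_ring_sel(6) by auto
    then show "sc c q \<in> O' k" unfolding O'_def using rsc[OF f, of c] by blast
  qed
  have O_kernel: "kernel \<subseteq> O' k" for k
  proof
    fix q assume "q \<in> kernel"
    then have "\<pi> (\<lambda>e. 0) = ev q" by (simp only: rzero)
    then show "q \<in> O' k" unfolding O'_def using zero_R by (intro CollectI bexI[of _ "\<lambda>e. 0"]) simp_all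
  qed
  have O_mult: "p * q \<in> O' (i + j)" if p: "p \<in> O' i" and q: "q \<in> O' j" for p q i j
  proof -
    obtain f g where f: "f \<in> carrier ?R" "\<pi> f = ev p" and g: "g \<in> carrier ?R" "\<pi> g = ev q"
      and fg: "\<And>e. f e \<noteq> 0 \<Longrightarrow> i \<le> mono_degree e" "\<And>e. g e \<noteq> 0 \<Longrightarrow> j \<le> mono_degree e"
      using p q unfolding O'_def by blast
    have "i + j \<le> mono_degree e" if nz: "ps_mult f g e \<noteq> 0" for e
    proof -
      obtain a b where "a + b = e" "f a \<noteq> 0" "g b \<noteq> 0" using nz by (rule ps_mult_nonzeroE)
      then show ?thesis using fg(1)[of a] fg(2)[of b] mono_degree_add[of a b] by simp
    qed
    then show ?thesis
      unfolding O'_def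
      by (intro CollectI bexI[OF _ ps_mult_closed[OF f(1) g(1)]] conjI allI impI rmult[OF f g])
  qed
  have O_0: "O' 0 = UNIV" unfolding O'_def using rep by auto
  have O_big: "\<phi> p = 0" if p: "p \<in> O' 4" for p
  proof -
    obtain f where f: "f \<in> carrier ?R" "\<pi> f = ev p" and f4: "\<And>e. f e \<noteq> 0 \<Longrightarrow> 4 \<le> mono_degree e"
      using p unfolding O'_def by blast
    have "f a * G (a + 0) = 0" for a
      using f4[of a] Gp(1)[of a] by (cases "f a = 0") auto
    then show ?thesis unfolding \<phi>[OF f] contract_def by (intro sum.neutral ballI)
  qed
  have O_const: "\<exists>c. q - sc c 1 \<in> O' 1" for q
  proof -
    obtain f where f: "f \<in> carrier ?R" "\<pi> f = ev q" using rep[of q] by (elim bexE)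
    have one: "\<one>\<^bsub>?R\<^esub> \<in> carrier ?R" "\<pi> \<one>\<^bsub>?R\<^esub> = ev 1" using H(4) by simp_all
    let ?g = "f \<oplus>\<^bsub>?R\<^esub> (- f 0) \<odot>\<^bsub>?R\<^esub> \<one>\<^bsub>?R\<^esub>"
    note g = radd[OF f rsc(2,1)[OF one, of "- f 0"]]
    have "1 \<le> mono_degree e" if "?g e \<noteq> 0" for e
    proof (rule ccontr)
      assume "\<not> 1 \<le> mono_degree e"
      then have "e = 0" using mono_degree_eq_0_iff[of e] by linarith
      then show False using that by (simp add: pseries_ring_sel(3,5,6))
    qed
    then have "q + sc (- f 0) 1 \<in> O' 1" unfolding O'_def using g by blast
    then show ?thesis by (intro exI[of _ "f 0"]) simp
  qed
  \<comment> \<open>Otherwise all second partials of \<open>F3\<close> vanish, and the first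
    variable, present because \<open>1 \<le> n\<close>, could not be in their span.\<close>
  have "\<exists>e. mono_degree e = 3 \<and> G e \<noteq> 0"
  proof (rule ccontr)
    assume no: "\<not> ?thesis"
    have "pdiff i (pdiff j F3) = 0" for i j
    proof -
      have "divided_coeff F3 (mono_var l + mono_var i + mono_var j) = 0" for l
        using no Gp(3)[of "mono_var l + mono_var i + mono_var j"] by (auto simp: mono_degree_add)
      then show ?thesis unfolding second_partial_form3[OF F3'] by simp
    qed
    then have "second_partials n F3 \<subseteq> {0}" by auto
    then have "mpoly_span (second_partials n F3) \<subseteq> {0}"
      by (rule mpoly.span_minimal) (rule mpoly.subspace_single_0)
    then have "(mvar 0 :: 'k mpoly) = 0" using nd[of 0] n by auto
    then have "Poly_Mapping.lookup (mvar 0 :: 'k mpoly) (mono_var 0) = 0" by simp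
    then show False by (simp add: lookup_mvar)
  qed
  then obtain e3 where e3: "mono_degree e3 = 3" "G e3 \<noteq> 0" by blast
  \<comment> \<open>If 1 had a representative without constant term, multiplication by it would give
    a cubic monomial a representative of order 4. The form would vanish there, although its value is
    a nonzero coefficient of \<open>G\<close>.\<close>
  have one_notin: "1 \<notin> O' 1"
  proof
    assume "1 \<in> O' 1"
    have e3m: "Poly_Mapping.keys e3 \<subseteq> {..<m}" using Gp(1)[OF e3(2)] by blast
    have "?X e3 \<in> O' 3"
      unfolding O'_def
      by (intro CollectI bexI[of _ "mono_series e3"])
        (use e3(1) X[OF e3m] mono_series_closed[OF e3m] in \<open>auto simp: mono_series_def\<close>)
    from O_mult[OF \<open>1 \<in> O' 1\<close> this] have "?X e3 \<in> O' 4" by simp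
    then show False using O_big \<phi>G[OF e3m] e3(2) by simp
  qed
  \<comment> \<open>Every element is a scalar modulo \<open>O' 1\<close>, so a strictly larger ideal
    contains a nonzero scalar. By uniqueness of the maximal ideal this image is M.\<close>
  have "maximalideal (ev ` O' 1) A"
  proof (rule maximalidealI)
    show id: "ideal (ev ` O' 1) A"
      by (rule ideal_image[OF O_sub]) (use O_mult[of _ 0 _ 1] O_0 in auto)
    show "carrier A \<noteq> ev ` O' 1"
    proof
      assume "carrier A = ev ` O' 1"
      then have "ev ` UNIV = ev ` O' 1" by (simp add: ev_range)
      from ev_image_eq[OF subspace_UNIV _ O_sub O_kernel this] show False using one_notin by auto
    qed
    fix J assume J: "ideal J A" "ev ` O' 1 \<subseteq> J" "J \<subseteq> carrier A"
    note J' = subspace_preimage[OF J(1)]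
    show "J = ev ` O' 1 \<or> J = carrier A"
    proof (rule disjCI)
      assume "J \<noteq> carrier A"
      then have "\<one>\<^bsub>A\<^esub> \<notin> J" using ideal.one_imp_carrier[OF J(1)] by blast
      then have 1: "ev 1 \<notin> J" by simp
      have "a \<in> ev ` O' 1" if a: "a \<in> J" for a
      proof -
        have "a \<in> carrier A" using J(3) a by blast
        then obtain q where q: "ev q = a" by (rule ev_surj)
        obtain c where c: "q - sc c 1 \<in> O' 1" using O_const by blast
        then have "ev (q - sc c 1) \<in> J" using J(2) by blast
        with subspace_diff[OF J', of q "q - sc c 1"] have "ev (sc c 1) \<in> J" using q a by simp
        with subspace_scale[OF J', of "sc c 1" "inverse c"] have "c = 0" using 1 by (cases "c = 0") auto
        then show ?thesis using c q by auto
      qed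
      then show "J = ev ` O' 1" using J(2) by blast
    qed
  qed
  then have M: "ev ` O' 1 = M" by (rule maximal_ideal_unique)
  have pow1: "pow 1 = O' 1"
  proof (rule ev_image_eq[OF N_subspace Z_subset O_sub O_kernel])
    show "ev ` pow 1 = ev ` O' 1"
      unfolding M pow_def ideal_pow_1 using ideal.Icarr[OF M_ideal] ev_surj by (auto simp: image_iff) metis
  qed
  have pow_O: "pow k \<subseteq> O' k" for k
  proof (induction k)
    case (Suc k)
    show ?case
    proof (rule N_least[OF O_sub O_kernel])
      show "p * q \<in> O' (Suc k)" if "p \<in> pow k" "q \<in> pow 1" for p q
        using O_mult[of p k q 1] Suc that unfolding pow1 Suc_eq_plus1 by auto
    qed
  qed (simp add: O_0)
  have xN: "x i \<in> pow 1" if i: "i < m" for i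
    unfolding pow1 O'_def
    by (intro CollectI bexI[of _ "mono_series (mono_var i)"])
      (use x[OF i] varR[OF i] in \<open>auto simp: mono_series_def split: if_splits\<close>)
  let ?E = "monos_le m 3"
  have DE: "divisors G \<subseteq> ?E"
  proof
    fix a assume "a \<in> divisors G"
    then obtain d where "G (a + d) \<noteq> 0" by (auto simp: divisors_def)
    from Gp(1)[OF this] show "a \<in> ?E" by (auto simp: monos_le_def keys_mono_add mono_degree_add)
  qed
  \<comment> \<open>Dropping the terms of degree above 3 does not change the contraction, since
    divisors of \<open>G\<close> have degree at most 3. On the finite sum that is left,
    \<open>\<pi>\<close> can be computed term by term.\<close>
  have trunc: "q - (\<Sum>e\<in>?E. sc (f e) (?X e)) \<in> kernel" if f: "f \<in> carrier ?R" "\<pi> f = ev q" for f q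
  proof -
    have *: "(\<lambda>e. if e \<in> E then f e else 0) \<in> carrier ?R \<and>
        \<pi> (\<lambda>e. if e \<in> E then f e else 0) = ev (\<Sum>e\<in>E. sc (f e) (?X e))" if "finite E" "E \<subseteq> ?E" for E
      using that
    proof (induction E rule: finite_induct)
      case empty
      then show ?case using zero_R rzero[of 0] subspace_0[OF subspace_kernel] by simp
    next
      case (insert d E)
      let ?g = "\<lambda>e. if e \<in> E then f e else 0"
      have d: "Poly_Mapping.keys d \<subseteq> {..<m}" using insert.prems by (auto simp: monos_le_def)
      have g: "?g \<in> carrier ?R" "\<pi> ?g = ev (\<Sum>e\<in>E. sc (f e) (?X e))"
        using insert by simp_all
      have eq: "(f d \<odot>\<^bsub>?R\<^esub> mono_series d) \<oplus>\<^bsub>?R\<^esub> ?g = (\<lambda>e. if e \<in> insert d E then f e else 0)"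
        unfolding pseries_ring_sel(5,6) using insert.hyps(2) by (auto simp: mono_series_def fun_eq_iff)
      show ?case
        using radd[OF rsc(2,1)[OF mono_series_closed[OF d] X[OF d], of "f d"] g]
        unfolding eq sum.insert[OF insert.hyps] by simp
    qed
    let ?g = "\<lambda>e. if e \<in> ?E then f e else 0"
    have g: "?g \<in> carrier ?R" "\<pi> ?g = ev (\<Sum>e\<in>?E. sc (f e) (?X e))"
      using *[OF finite_monos_le subset_refl] by simp_all
    have "contract G f d = contract G ?g d" for d
      unfolding contract_def using DE by (intro sum.cong) auto
    then have "\<pi> f = \<pi> ?g" using fib[OF f(1) g(1)] by simp
    then have "ev q = ev (\<Sum>e\<in>?E. sc (f e) (?X e))" using f(2) g(2) by simp
    then show ?thesis by (simp add: ev_eq_iff kernel_def)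
  qed
  have x_span: "pow 1 \<subseteq> spanned_mod (pow 2) x m"
  proof
    fix q assume "q \<in> pow 1"
    then obtain f where f: "f \<in> carrier ?R" "\<pi> f = ev q" and f1: "\<And>e. f e \<noteq> 0 \<Longrightarrow> 1 \<le> mono_degree e"
      unfolding pow1 O'_def by blast
    let ?S = "spanned_mod (pow 2) x m"
    have S: "subspace ?S" by (rule subspace_spanned_mod[OF N_subspace])
    have "sc (f e) (?X e) \<in> ?S" if e: "e \<in> ?E" for e
    proof -
      have em: "Poly_Mapping.keys e \<subseteq> {..<m}" using e by (simp add: monos_le_def)
      consider "mono_degree e = 0" | "mono_degree e = 1" | "2 \<le> mono_degree e" by linarith
      then show ?thesis
      proof cases
        case 1
        then have "f e = 0" using f1[of e] by auto
        then show ?thesis using subspace_0[OF S] by simp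
      next
        case 2
        then obtain i where i: "e = mono_var i" by (rule mono_degree_1E)
        then have "i < m" using em by simp
        then show ?thesis
          unfolding i by (simp add: mono_eval_var subspace_scale[OF S] spanned_mod_base[OF N_subspace])
      next
        case 3
        have "?X e \<in> pow (mono_degree e)" by (rule mono_eval_pow[OF _ em]) (rule xN)
        then have "?X e \<in> ?S" using N_antimono[OF 3] spanned_mod_superset by blast
        then show ?thesis by (rule subspace_scale[OF S])
      qed
    qed
    then have 1: "(\<Sum>e\<in>?E. sc (f e) (?X e)) \<in> ?S" by (rule subspace_sum[OF S])
    have "q - (\<Sum>e\<in>?E. sc (f e) (?X e)) \<in> ?S"
      using trunc[OF f] Z_subset spanned_mod_superset by blast
    from subspace_add[OF S this 1] show "q \<in> ?S" by simp
  qed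
  have xx: "\<phi> (x i * x j) = (if i = j \<and> n \<le> i then 2 else 0)" if "i < m" "j < m" for i j
    using \<phi>G[of "mono_var i + mono_var j"] that
    by (simp add: keys_mono_add mono_eval_add mono_eval_var Gp(2))
  have xxxG: "\<phi> (x i * x j * x k) = G (mono_var i + mono_var j + mono_var k)" if "i < m" "j < m" "k < m" for i j k
    using \<phi>G[of "mono_var i + mono_var j + mono_var k"] that
    by (simp add: keys_mono_add mono_eval_add mono_eval_var)
  have xxx: "\<phi> (x i * x j * x k) = 0" if "i < m" "j < m" "k < m" "n \<le> i \<or> n \<le> j \<or> n \<le> k" for i j k
  proof -
    have "\<not> Poly_Mapping.keys (mono_var i + mono_var j + mono_var k) \<subseteq> {..<n}"
      using that(4) by (auto simp: keys_mono_add)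
    then show ?thesis
      unfolding xxxG[OF that(1-3)] by (intro Gp(4)) (simp_all add: mono_degree_add)
  qed
  \<comment> \<open>Polynomials whose linear coefficients in the first n variables are the pairings
    of some element of \<open>pow 2\<close> with the generators. The second partials belong to this
    subspace, with \<open>x i * x k\<close> as witness, hence so do the variables; their witnesses
    are the \<open>b j\<close>.\<close>
  let ?W = "{p. \<exists>q\<in>pow 2. \<forall>l<m. \<phi> (q * x l) = (if l < n then Poly_Mapping.lookup p (mono_var l) else 0)}"
  have "mpoly_span (second_partials n F3) \<subseteq> ?W"
  proof (rule mpoly.span_minimal)
    show "mpoly.subspace ?W"
    proof (rule mpoly.subspaceI)
      show "0 \<in> ?W"
        using subspace_0[OF N_subspace] by (intro CollectI bexI[of _ 0]) (simp_all add: linear_form_simps[OF form])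
    next
      fix p p' assume "p \<in> ?W" "p' \<in> ?W"
      then obtain q q' where "q \<in> pow 2" "q' \<in> pow 2"
        "\<forall>l<m. \<phi> (q * x l) = (if l < n then Poly_Mapping.lookup p (mono_var l) else 0)"
        "\<forall>l<m. \<phi> (q' * x l) = (if l < n then Poly_Mapping.lookup p' (mono_var l) else 0)" by blast
      then show "p + p' \<in> ?W"
        using subspace_add[OF N_subspace, of q 2 q']
        by (intro CollectI bexI[of _ "q + q'"]) (simp_all add: distrib_right linear_form_simps[OF form] lookup_add)
    next
      fix c p assume "p \<in> ?W"
      then obtain q where "q \<in> pow 2"
        "\<forall>l<m. \<phi> (q * x l) = (if l < n then Poly_Mapping.lookup p (mono_var l) else 0)" by blast
      then show "mscale c p \<in> ?W"
        using subspace_scale[OF N_subspace, of q 2 c]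
        by (intro CollectI bexI[of _ "sc c q"]) (simp_all add: sc_mult linear_form_simps[OF form] lookup_mscale)
    qed
    show "second_partials n F3 \<subseteq> ?W"
    proof
      fix p assume "p \<in> second_partials n F3"
      then obtain i k where ik: "i < n" "k < n" "p = pdiff i (pdiff k F3)" by blast
      have "\<phi> (x i * x k * x l) = (if l < n then Poly_Mapping.lookup p (mono_var l) else 0)" if l: "l < m" for l
      proof (cases "l < n")
        case False
        then show ?thesis using xxx[of i k l] ik l n by simp
      next
        case True
        have "Poly_Mapping.lookup p (mono_var l) = divided_coeff p (mono_var l)"
          by (simp add: divided_coeff_def mono_fact_var)
        also have "\<dots> = divided_coeff F3 (mono_var l + mono_var i + mono_var k)"
          unfolding ik(3) by (simp add: divided_coeff_pdiff)
        also have "\<dots> = G (mono_var l + mono_var i + mono_var k)"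
          by (rule Gp(3)[symmetric]) (simp add: mono_degree_add)
        also have "\<dots> = \<phi> (x i * x k * x l)"
          using xxxG[of i k l] ik l n by (simp add: ac_simps)
        finally show ?thesis using True by simp
      qed
      moreover have "x i * x k \<in> pow 2"
        using N_mult[OF xN[of i] xN[of k]] ik n by simp
      ultimately show "p \<in> ?W" by blast
    qed
  qed
  then have W: "mvar j \<in> ?W" if "j < n" for j
    using nd[OF that] by (rule subsetD)
  have "\<exists>b. \<forall>j. j < n \<longrightarrow> b j \<in> pow 2 \<and> (\<forall>l<m. \<phi> (b j * x l) =
      (if l < n then Poly_Mapping.lookup (mvar j :: 'k mpoly) (mono_var l) else 0))"
  proof (rule choice, rule allI)
    show "\<exists>q. j < n \<longrightarrow> q \<in> pow 2 \<and> (\<forall>l<m. \<phi> (q * x l) =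
        (if l < n then Poly_Mapping.lookup (mvar j :: 'k mpoly) (mono_var l) else 0))" for j
      using CollectD[OF W[of j]] by blast
  qed
  then obtain b where b: "\<And>j. j < n \<Longrightarrow> b j \<in> pow 2 \<and> (\<forall>l<m. \<phi> (b j * x l) =
      (if l < n then Poly_Mapping.lookup (mvar j :: 'k mpoly) (mono_var l) else 0))"
    by blast
  have "normal_form m n x b \<phi>"
    unfolding normal_form_def
  proof (intro conjI allI impI ballI)
    show "linear_form \<phi>" by (rule form)
    show "\<phi> p = 0" if "p \<in> kernel" for p using that by (rule form_Z)
    show "p \<in> kernel" if "\<forall>q. \<phi> (p * q) = 0" for p using that by (intro nondeg) blast
    show "\<phi> p = 0" if "p \<in> pow 4" for p using that pow_O O_big by blast
    show "UNIV \<subseteq> spanned_mod (pow 1) (\<lambda>_. 1) 1"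
    proof
      fix q
      obtain c where "q - sc c 1 \<in> pow 1" using O_const pow1 by blast
      then show "q \<in> spanned_mod (pow 1) (\<lambda>_. 1) 1"
        unfolding spanned_mod_def by (intro CollectI exI[of _ "\<lambda>_. c"]) (simp add: One_nat_def)
    qed
    show "x i \<in> pow 1" if "i < m" for i using that by (rule xN)
    show "pow 1 \<subseteq> spanned_mod (pow 2) x m" by (rule x_span)
    show "b j \<in> pow 2" if "j < n" for j using b[OF that] by blast
    show "\<phi> 1 = 0"
    proof -
      have "G 0 = 0" using Gp(1)[of 0] by auto
      then show ?thesis using \<phi>G[of 0] by simp
    qed
    show "\<phi> (x i) = 0" if "i < m" for i
    proof -
      have "G (mono_var i) = 0" using Gp(1)[of "mono_var i"] by auto
      then show ?thesis using \<phi>G[of "mono_var i"] that by (simp add: mono_eval_var)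
    qed
    show "\<phi> (x i * x j) = (if i = j \<and> n \<le> i then 2 else 0)" if "i < m" "j < m" for i j
      using that by (rule xx)
    show "\<phi> (x i * x j * x k) = 0" if "i < m" "j < m" "k < m" "n \<le> k" for i j k
      using that xxx by blast
    show "\<phi> (b j * x k) = (if j = k then 1 else 0)" if "j < n" "k < m" for j k
      using b[OF that(1)] that by (auto simp: lookup_mvar)
  qed
  then show ?thesis by blast
qed

end

theorem theorem4p1:
  fixes A :: "('k :: {alg_closed_field, field_char_0}, 'a) module"
    and m n :: nat
  assumes "1 \<le> n" and "n < m"
    and "K_algebra A" and "pseries_quotient A"
    and "artinian A" and "local_ring A"
  shows "(artinian A \<and> local_ring A \<and> gorenstein A \<and>
          has_hilbert_function A
            (\<lambda>i. if i = 0 then 1 else if i = 1 then m else if i = 2 then n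
                 else if i = 3 then 1 else 0))
     \<longleftrightarrow> (\<exists>F3 :: 'k mpoly. nondegenerate_form3 n F3 \<and>
            alg_iso A (A_F m (F3 + (\<Sum>i = n..<m. (mvar i)\<^sup>2))))"
proof -
  interpret A: K_alg A by (rule K_alg.intro) (rule assms(3))
  \<comment> \<open>With the polynomial ring on the elements of \<open>'a\<close> as cover, both
    sides become the existence of a normal form.\<close>
  interpret C: ac_local_cover "\<lambda>c p. Poly_Mapping.single 0 c * p" A A.multiset_ev
    by (intro ac_local_cover.intro local_cover.intro local_cover_axioms.intro A.cover_multiset_ev assms(6))
  show ?thesis
    using C.normal_form_iff[OF assms(5,1,2)] C.normal_form_imp_iso[OF _ assms(1,2)]
      C.iso_imp_normal_form[OF _ assms(1,2)] assms(5,6)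
    by blast
qed

end
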